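(* Let $d\ge 1$ and $n,p\in\mathbb N=\{1,2,\dots\}$. (i) For all $\kappa,\rho\in[0,\infty)$ and all $x\in\mathbb Z^d$, the limit $\lambda_p^{(n)}(\kappa,\rho)=\lim_{t\to\infty}\frac1{pt}\log \mathbb E_0^{\otimes n}\big([u(x,t)]^p\big)$ exists and is finite, and it is independent of $x$ if $(\kappa,\rho)\neq(0,0)$. (ii) On $[0,\infty)^2$, the function $(\kappa,\rho)\mapsto\lambda_p^{(n)}(\kappa,\rho)$ (where at $(\kappa,\rho)=(0,0)$ the limit is taken with $x=0$) is continuous, convex, and non-increasing in both $\kappa$ and $\rho$.
   Context: $\Delta$ is the discrete Laplacian on $\mathbb Z^d$: $\Delta f(x)=\sum_{y\sim x}[f(y)-f(x)]$, the sum being over nearest neighbours $y$ of $x$. A simple random walk on $\mathbb Z^d$ with step rate $2d\nu$ ($\nu\ge0$) is the continuous-time Markov process with generator $\nu\Delta$ (it jumps to each nearest neighbour at rate $\nu$; it does not move if $\nu=0$). Let $Y_1^\rho,\dots,Y_n^\rho$ be independent simple random walks on $\mathbb Z^d$ with step rate $2d\rho$, all starting from $0$; $\mathbb E_0^{\otimes n}$ is expectation with respect to them. Put $\xi(x,t)=\sum_{k=1}^n\delta_x(Y_k^\rho(t))$, where $\delta_x(y)=1$ if $y=x$ and $0$ otherwise. Let $u$ be the solution of the parabolic Anderson model $\partial_t u(x,t)=\kappa\Delta u(x,t)+\xi(x,t)u(x,t)$, $u(x,0)=1$, $x\in\mathbb Z^d$, $t\ge0$, given by the Feynman–Kac formula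 $u(x,t)=\mathrm E_x\big(\exp[\int_0^t\xi(X^\kappa(s),t-s)\,ds]\big)$, where $X^\kappa$ is a simple random walk on $\mathbb Z^d$ with step rate $2d\kappa$, independent of $\xi$, started at $x$ under $\mathrm E_x$. *)

theory Defs
  imports "HOL-Probability.Probability"
begin

text \<open>
  The lattice \<open>\<int>\<^sup>d\<close> is the type \<open>int ^ 'd\<close> with \<open>'d :: finite\<close>, so \<open>d = CARD('d) \<ge> 1\<close>.
\<close>

definition nearest_neighbours :: "int ^ 'd \<Rightarrow> (int ^ 'd) set"
  where "nearest_neighbours x = {y. (\<Sum>i\<in>UNIV. \<bar>y $ i - x $ i\<bar>) = 1}"

lemma finite_nearest_neighbours: "finite (nearest_neighbours (x :: int ^ 'd))"
proof -
  have "vec_nth y \<in> (\<Pi>\<^sub>E i\<in>UNIV. {x $ i - 1..x $ i + 1})"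
    if "y \<in> nearest_neighbours x" for y
  proof (rule PiE_I)
    fix i
    have "\<bar>y $ i - x $ i\<bar> \<le> (\<Sum>i\<in>UNIV. \<bar>y $ i - x $ i\<bar>)"
      by (rule member_le_sum) auto
    then show "y $ i \<in> {x $ i - 1..x $ i + 1}"
      using that by (auto simp: nearest_neighbours_def)
  qed simp
  then have "vec_nth ` nearest_neighbours x \<subseteq> (\<Pi>\<^sub>E i\<in>UNIV. {x $ i - 1..x $ i + 1})"
    by blast
  moreover have "finite (\<Pi>\<^sub>E i\<in>UNIV. {x $ i - 1..x $ i + 1})"
    by (rule finite_PiE) auto
  ultimately have "finite (vec_nth ` nearest_neighbours x)"
    using finite_subset by blast
  moreover have "inj_on vec_nth (nearest_neighbours x)"
    by (auto simp: inj_on_def vec_nth_inject)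
  ultimately show ?thesis by (rule finite_imageD)
qed

definition laplacian :: "(int ^ 'd \<Rightarrow> real) \<Rightarrow> int ^ 'd \<Rightarrow> real"
  where "laplacian f x = (\<Sum>y\<in>nearest_neighbours x. f y - f x)"

text \<open>
  The Markov semigroup with generator \<open>\<nu> \<Delta>\<close>. As \<open>\<Delta>\<close> is a bounded operator on bounded
  functions, the semigroup is the exponential series of \<open>t \<nu> \<Delta>\<close>, which converges
  pointwise for every bounded \<open>f\<close>.
\<close>

definition srw_semigroup :: "real \<Rightarrow> real \<Rightarrow> (int ^ 'd \<Rightarrow> real) \<Rightarrow> int ^ 'd \<Rightarrow> real"
  where "srw_semigroup \<nu> t f x = (\<Sum>k. (t * \<nu>) ^ k / fact k * (laplacian ^^ k) f x)"

definition srw_transition :: "real \<Rightarrow> real \<Rightarrow> int ^ 'd \<Rightarrow> int ^ 'd \<Rightarrow> real"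
  where "srw_transition \<nu> t x y = srw_semigroup \<nu> t (indicator {y}) x"

text \<open>
  \<open>Z\<close> is, under \<open>M\<close>, a simple random walk with step rate \<open>2 d \<nu>\<close> started at \<open>x\<close>: the Markov
  process with the above transition function, with right-continuous paths having left limits
  (for the discrete topology of the lattice). The Markov property is expressed through the
  finite-dimensional distributions. Path regularity is required on all of \<open>space M\<close>, which
  makes path integrals measurable without completing \<open>M\<close>; times \<open>t < 0\<close> play no role.
\<close>

definition simple_random_walk ::
    "'a measure \<Rightarrow> real \<Rightarrow> int ^ 'd \<Rightarrow> (real \<Rightarrow> 'a \<Rightarrow> int ^ 'd) \<Rightarrow> bool"
  where "simple_random_walk M \<nu> x Z \<longleftrightarrow>
    prob_space M \<and>
    (\<forall>t\<ge>0. Z t \<in> M \<rightarrow>\<^sub>M count_space UNIV) \<and>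
    (\<forall>\<omega>\<in>space M. \<forall>t\<ge>0. \<forall>\<^sub>F s in at_right t. Z s \<omega> = Z t \<omega>) \<and>
    (\<forall>\<omega>\<in>space M. \<forall>t>0. \<exists>z. \<forall>\<^sub>F s in at_left t. Z s \<omega> = z) \<and>
    (AE \<omega> in M. Z 0 \<omega> = x) \<and>
    (\<forall>m (t :: nat \<Rightarrow> real) z.
       t 0 = 0 \<and> (\<forall>i<m. t i \<le> t (Suc i)) \<and> z 0 = x \<longrightarrow>
       measure M {\<omega> \<in> space M. \<forall>i\<in>{1..m}. Z (t i) \<omega> = z i} =
         (\<Prod>i<m. srw_transition \<nu> (t (Suc i) - t i) (z i) (z (Suc i))))"

text \<open>Independence of \<open>n\<close> walks is independence of the whole paths \<open>(Y k t)\<^sub>t\<^sub>\<ge>\<^sub>0\<close>.\<close>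

definition independent_srws ::
    "'a measure \<Rightarrow> nat \<Rightarrow> real \<Rightarrow> int ^ 'd \<Rightarrow> (nat \<Rightarrow> real \<Rightarrow> 'a \<Rightarrow> int ^ 'd) \<Rightarrow> bool"
  where "independent_srws M n \<nu> x Y \<longleftrightarrow>
    (\<forall>k\<in>{1..n}. simple_random_walk M \<nu> x (Y k)) \<and>
    prob_space.indep_vars M (\<lambda>k. \<Pi>\<^sub>M t\<in>{0..}. count_space UNIV)
      (\<lambda>k \<omega>. \<lambda>t\<in>{0..}. Y k t \<omega>) {1..n}"

definition catalyst ::
    "nat \<Rightarrow> (nat \<Rightarrow> real \<Rightarrow> 'a \<Rightarrow> int ^ 'd) \<Rightarrow> 'a \<Rightarrow> int ^ 'd \<Rightarrow> real \<Rightarrow> real"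
  where "catalyst n Y \<omega> x t = (\<Sum>k = 1..n. indicator {x} (Y k t \<omega>))"

text \<open>
  The Feynman--Kac formula for a fixed realisation \<open>\<xi>\<close> of the potential. The walk \<open>X\<close> started
  at \<open>x\<close> lives under its own measure \<open>P x\<close>, which makes it independent of \<open>\<xi>\<close>.
\<close>

definition feynman_kac ::
    "(int ^ 'd \<Rightarrow> 'b measure) \<Rightarrow> (real \<Rightarrow> 'b \<Rightarrow> int ^ 'd) \<Rightarrow> (int ^ 'd \<Rightarrow> real \<Rightarrow> real) \<Rightarrow>
     int ^ 'd \<Rightarrow> real \<Rightarrow> real"
  where "feynman_kac P X \<xi> x t =
    (\<integral>w. exp (LINT s:{0..t}|lborel. \<xi> (X s w) (t - s)) \<partial>P x)"

definition log_moment_rate ::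
    "nat \<Rightarrow> nat \<Rightarrow> 'a measure \<Rightarrow> (nat \<Rightarrow> real \<Rightarrow> 'a \<Rightarrow> int ^ 'd) \<Rightarrow>
     (int ^ 'd \<Rightarrow> 'b measure) \<Rightarrow> (real \<Rightarrow> 'b \<Rightarrow> int ^ 'd) \<Rightarrow> int ^ 'd \<Rightarrow> real \<Rightarrow> real"
  where "log_moment_rate n p M Y P X x t =
    1 / (real p * t) * ln (\<integral>\<omega>. (feynman_kac P X (catalyst n Y \<omega>) x t) ^ p \<partial>M)"

end

theory Submission
  imports Defs "HOL-Library.Groups_Big_Fun"
begin

text \<open>
  The expectation of \<open>u(x,t)\<^sup>p\<close> involves \<open>p\<close> copies of \<open>X\<close> and the \<open>n\<close> catalysts. Reversing the
  time of the catalysts turns it into a Feynman--Kac functional of \<open>p + n\<close> walks, generated by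
  \<open>H = \<kappa> \<Delta>\<^sub>X + \<rho> \<Delta>\<^sub>Y + V\<close>, where \<open>V\<close> counts the coincidences \<open>X\<^sub>j = Y\<^sub>k\<close>. Concretely, Riemann sums for the
  path integrals and the Markov property give
  \<open>E[u(x,t)\<^sup>p; Y(t) = y] = lim\<^sub>m ((1 + t/m H)\<^sup>m f) (x,\<dots>,x,y)\<close> with \<open>f\<close> the indicator of \<open>Y = 0\<close>, so that only
  finite-range operators have to be studied. Their growth rate is \<open>\<Lambda> = sup \<langle>f, H f\<rangle>\<close> over normalised
  finitely supported \<open>f\<close>: the upper bound is an energy estimate in an exponentially weighted
  \<open>l\<^sup>2\<close> norm, the weight making the sums over the free endpoints converge; the lower bound
  uses log-convexity of \<open>m \<mapsto> \<parallel>(1 + s H)\<^sup>m f\<parallel>\<^sup>2\<close> and irreducibility. If \<open>\<kappa> = 0\<close> or \<open>\<rho> = 0\<close>, the frozen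
  particles can be moved to one site without decreasing the quotient, by averaging
  \<open>V\<close> over them. As a supremum of functions that are affine in \<open>(\<kappa>,\<rho>)\<close> with nonpositive bounded slopes,
  \<open>\<Lambda>\<close> is convex, Lipschitz continuous and non-increasing.
\<close>

section \<open>Symmetric hopping operators with a potential\<close>

text \<open>The start weight does not decay in the \<open>X\<close> coordinates, and the moment sums
  over all final catalyst positions, so neither end of the problem lies in \<open>l\<^sup>2\<close>.
  A weight of the form \<open>exp (\<epsilon> * (|Y| - |X|))\<close> repairs both ends at once; it
  adds \<open>(exp \<epsilon> - 1) * R\<close> to the rate, and \<epsilon> tends to 0 only after
  \<open>t\<close> has tended to infinity. Powers of \<open>1 + s H\<close> are used instead of
  \<open>exp (t H)\<close> because they keep finite supports finite: finite sums and the
  Cauchy-Schwarz inequality then replace spectral theory. Time reversal of the catalysts rests on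
  the symmetry of the transition function: the indicator of the current catalyst position, read as a
  function of the lattice point, is moved by the walk semigroup. The supremum \<Lambda> ranges over
  all configurations, whereas the walks start at \<open>x\<close> and the catalysts at 0. For
  particles that move this makes no difference, but frozen ones stay where they are, hence the
  relocation argument. At \<open>(0, 0)\<close> nothing moves and the limit is the potential of the
  initial configuration divided by \<open>p\<close>, which depends on \<open>x\<close>; for
  \<open>x = 0\<close> that potential has its maximal value \<open>p * n\<close>, which is also the
  value of \<Lambda> there.\<close>

abbreviation finsupp :: "('s \<Rightarrow> real) \<Rightarrow> bool"
  where "finsupp f \<equiv> finite {a. f a \<noteq> 0}"

definition ip :: "('s \<Rightarrow> real) \<Rightarrow> ('s \<Rightarrow> real) \<Rightarrow> real"
  where "ip f g = Sum_any (\<lambda>a. f a * g a)"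

lemma ip_eq_sum:
  assumes "finite A" "{a. f a \<noteq> 0} \<subseteq> A"
  shows "ip f g = (\<Sum>a\<in>A. f a * g a)"
  unfolding ip_def using assms by (intro Sum_any.expand_superset) auto

lemma ip_commute: "ip f g = ip g f"
  by (simp add: ip_def mult.commute)

lemma ip_add_right:
  assumes "finsupp f"
  shows "ip f (\<lambda>a. g a + h a) = ip f g + ip f h"
  using assms by (subst (1 2 3) ip_eq_sum[of "{a. f a \<noteq> 0}"]) (auto simp: sum.distrib algebra_simps)

lemma ip_scale_left: "ip (\<lambda>a. c * f a) g = c * ip f g"
proof (cases "c = 0")
  case False
  have "{a. c * (f a * g a) \<noteq> 0} = {a. f a * g a \<noteq> 0}" using False by auto
  then show ?thesis
    unfolding ip_def Sum_any.expand_set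
    by (simp add: mult.assoc sum_distrib_left)
qed (simp add: ip_def)

lemma ip_scale_right: "ip f (\<lambda>a. c * g a) = c * ip f g"
  by (subst (1 2) ip_commute) (rule ip_scale_left)

lemma ip_sum_right:
  assumes "finsupp f"
  shows "ip f (\<lambda>a. \<Sum>e\<in>E. g e a) = (\<Sum>e\<in>E. ip f (g e))"
  using assms
  by (subst ip_eq_sum[of "{a. f a \<noteq> 0}"], simp, simp,
      subst sum.cong[OF refl ip_eq_sum[of "{a. f a \<noteq> 0}"]])
     (auto simp: sum_distrib_left intro: sum.swap)

lemma ip_self_nonneg: "0 \<le> ip f f"
  unfolding ip_def Sum_any.expand_set by (intro sum_nonneg) simp

lemma ip_mono:
  assumes "finsupp f" "\<And>a. 0 \<le> f a" "\<And>a. g a \<le> h a"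
  shows "ip f g \<le> ip f h"
  using assms by (subst (1 2) ip_eq_sum[of "{a. f a \<noteq> 0}"]) (auto intro!: sum_mono mult_left_mono)

lemma ip_self_pos:
  assumes "finsupp f" "f a \<noteq> 0"
  shows "0 < ip f f"
proof -
  have "ip f f = (\<Sum>a\<in>{a. f a \<noteq> 0}. f a * f a)"
    using assms by (intro ip_eq_sum) auto
  also have "\<dots> > 0"
    using assms by (intro sum_pos2[of _ a]) (auto simp: zero_less_mult_iff)
  finally show ?thesis .
qed

lemma sq_le_ip_self:
  assumes "finsupp f"
  shows "(f a)\<^sup>2 \<le> ip f f"
proof (cases "f a = 0")
  case False
  have "f a * f a \<le> (\<Sum>a\<in>{a. f a \<noteq> 0}. f a * f a)"
    using assms False by (intro member_le_sum) auto
  also have "\<dots> = ip f f"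
    using assms by (intro ip_eq_sum[symmetric]) auto
  finally show ?thesis by (simp add: power2_eq_square)
qed (simp add: ip_self_nonneg)

lemma ip_Cauchy_Schwarz:
  assumes "finsupp f" "finsupp g"
  shows "(ip f g)\<^sup>2 \<le> ip f f * ip g g"
proof -
  let ?A = "{a. f a \<noteq> 0} \<union> {a. g a \<noteq> 0}"
  have "finite ?A" using assms by simp
  then have "ip f g = (\<Sum>a\<in>?A. f a * g a)" "ip f f = (\<Sum>a\<in>?A. (f a)\<^sup>2)" "ip g g = (\<Sum>a\<in>?A. (g a)\<^sup>2)"
    by (auto simp: ip_eq_sum[of ?A] power2_eq_square)
  then show ?thesis using Cauchy_Schwarz_ineq_sum[of f g ?A] by simp
qed

lemma ip_abs_le:
  assumes "finsupp f" "finsupp g" "ip f f \<le> c" "ip g g \<le> c"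
  shows "\<bar>ip f g\<bar> \<le> c"
proof -
  have "(ip f g)\<^sup>2 \<le> ip f f * ip g g" by (rule ip_Cauchy_Schwarz) fact+
  also have "\<dots> \<le> c * c" using assms ip_self_nonneg[of f] ip_self_nonneg[of g] by (intro mult_mono) auto
  finally have "(ip f g)\<^sup>2 \<le> c\<^sup>2" by (simp add: power2_eq_square)
  moreover have "0 \<le> c" using assms(3) ip_self_nonneg[of f] by simp
  ultimately show ?thesis by (metis abs_le_square_iff abs_of_nonneg)
qed

lemma ip_add_self:
  assumes "finsupp f" "finsupp g"
  shows "ip (\<lambda>a. f a + s * g a) (\<lambda>a. f a + s * g a) = ip f f + 2 * s * ip f g + s\<^sup>2 * ip g g"
proof -
  let ?A = "{a. f a \<noteq> 0} \<union> {a. g a \<noteq> 0}"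
  have "finite ?A" using assms by simp
  then have "ip (\<lambda>a. f a + s * g a) (\<lambda>a. f a + s * g a) = (\<Sum>a\<in>?A. (f a + s * g a) * (f a + s * g a))"
    "ip f f = (\<Sum>a\<in>?A. f a * f a)" "ip f g = (\<Sum>a\<in>?A. f a * g a)" "ip g g = (\<Sum>a\<in>?A. g a * g a)"
    by (intro ip_eq_sum; auto)+
  then show ?thesis
    by (simp add: sum_distrib_left flip: sum.distrib) (simp add: algebra_simps power2_eq_square)
qed

text \<open>Each move is a bijection whose inverse is a move of the same rate; this is what makes
  \<open>H\<close> symmetric for \<open>ip\<close>. The potential is bounded, so no question of
  domains arises, and the state space carries no structure at all.\<close>

locale hopping =
  fixes E :: "'e set" and mv :: "'e \<Rightarrow> 's \<Rightarrow> 's" and inv :: "'e \<Rightarrow> 'e"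
    and r :: "'e \<Rightarrow> real" and V :: "'s \<Rightarrow> real" and vmax :: real
  assumes finite_E: "finite E"
    and inv_in: "e \<in> E \<Longrightarrow> inv e \<in> E"
    and inv_inv: "inv (inv e) = e"
    and mv_inv: "mv (inv e) (mv e a) = a"
    and r_inv: "r (inv e) = r e"
    and r_nonneg: "0 \<le> r e"
    and V_nonneg: "0 \<le> V a" and V_le: "V a \<le> vmax"
begin

definition H :: "('s \<Rightarrow> real) \<Rightarrow> 's \<Rightarrow> real"
  where "H f a = (\<Sum>e\<in>E. r e * (f (mv e a) - f a)) + V a * f a"

definition Q :: "real \<Rightarrow> ('s \<Rightarrow> real) \<Rightarrow> 's \<Rightarrow> real"
  where "Q s f a = f a + s * H f a"

definition R :: real where "R = (\<Sum>e\<in>E. r e)"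

text \<open>The top of the spectrum of \<open>H\<close> as a bounded symmetric operator on
  \<open>l\<^sup>2\<close>, written as a supremum over finitely supported functions, which are
  dense.\<close>

definition Lam :: real
  where "Lam = Sup {ip f (H f) | f. finsupp f \<and> ip f f = 1}"

lemma R_nonneg: "0 \<le> R" unfolding R_def by (intro sum_nonneg r_nonneg)
lemma vmax_nonneg: "0 \<le> vmax" using V_nonneg V_le order_trans by blast

lemma mv_inv': "mv e (mv (inv e) a) = a"
  using mv_inv[of "inv e" a] by (simp add: inv_inv)

lemma bij_mv: "bij (mv e)"
  by (rule bij_betwI[of _ _ _ "mv (inv e)"]) (auto simp: mv_inv mv_inv')

lemma finsupp_mv:
  assumes "finsupp f"
  shows "finsupp (\<lambda>a. f (mv e a))"
proof -
  have "{a. f (mv e a) \<noteq> 0} \<subseteq> mv (inv e) ` {a. f a \<noteq> 0}"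
    by (auto simp: image_iff intro!: exI[of _ "mv e _"] simp: mv_inv)
  with assms show ?thesis by (meson finite_imageI finite_subset)
qed

lemma finsupp_dominated:
  assumes "finsupp (f :: 's \<Rightarrow> real)" "\<And>e. e \<in> E \<Longrightarrow> finsupp (f' e)"
    and "\<And>a. f a = 0 \<Longrightarrow> (\<And>e. e \<in> E \<Longrightarrow> f' e a = 0) \<Longrightarrow> g a = 0"
  shows "finsupp (g :: 's \<Rightarrow> real)"
proof -
  have "{a. g a \<noteq> 0} \<subseteq> {a. f a \<noteq> 0} \<union> (\<Union>e\<in>E. {a. f' e a \<noteq> 0})"
    using assms(3) by blast
  moreover have "finite ({a. f a \<noteq> 0} \<union> (\<Union>e\<in>E. {a. f' e a \<noteq> 0}))"
    using assms finite_E by blast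
  ultimately show ?thesis by (rule finite_subset)
qed

lemma finsupp_Q:
  assumes "finsupp f" shows "finsupp (Q s f)"
  by (rule finsupp_dominated[of f "\<lambda>e a. f (mv e a)"]) (use assms finsupp_mv in \<open>auto simp: Q_def H_def\<close>)

lemma finsupp_Q_pow:
  assumes "finsupp f" shows "finsupp ((Q s ^^ m) f)"
  by (induction m) (use assms finsupp_Q in auto)

lemma ip_mv: "ip (\<lambda>a. f (mv e a)) g = ip f (\<lambda>a. g (mv (inv e) a))"
  unfolding ip_def
  by (rule Sum_any.reindex_cong[of "mv (inv e)"]) (auto simp: bij_mv mv_inv' fun_eq_iff)

lemma ip_mv_mv: "ip (\<lambda>a. f (mv e a)) (\<lambda>a. g (mv e a)) = ip f g"
  by (simp add: ip_mv mv_inv')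

lemma ip_mv_le:
  assumes "finsupp f" shows "\<bar>ip f (\<lambda>a. f (mv e a))\<bar> \<le> ip f f"
  using assms by (intro ip_abs_le finsupp_mv) (auto simp: ip_mv_mv)

lemma ip_H:
  assumes "finsupp f"
  shows "ip f (H g) = (\<Sum>e\<in>E. r e * (ip f (\<lambda>a. g (mv e a)) - ip f g)) + ip f (\<lambda>a. V a * g a)"
proof -
  have "H g = (\<lambda>a. (\<Sum>e\<in>E. r e * (g (mv e a) + (-1) * g a)) + V a * g a)"
    by (auto simp: H_def fun_eq_iff)
  then show ?thesis
    using assms by (simp only: ip_add_right ip_sum_right ip_scale_right) simp
qed

lemma ip_H_sym:
  assumes "finsupp f" "finsupp g"
  shows "ip (H f) g = ip f (H g)"
proof -
  have *: "(\<Sum>e\<in>E. r e * ip f (\<lambda>a. g (mv e a))) = (\<Sum>e\<in>E. r e * ip g (\<lambda>a. f (mv e a)))"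
    by (rule sum.reindex_bij_witness[of _ inv inv])
       (auto simp: inv_in inv_inv r_inv ip_mv ip_commute[of g])
  have "ip f (\<lambda>a. V a * g a) = ip g (\<lambda>a. V a * f a)"
    by (simp add: ip_def algebra_simps)
  then show ?thesis
    unfolding ip_commute[of "H f"] ip_H[OF assms(1)] ip_H[OF assms(2)]
    using * by (simp add: right_diff_distrib sum_subtractf ip_commute[of g f])
qed

lemma ip_Q:
  assumes "finsupp f"
  shows "ip f (Q s g) = ip f g + s * ip f (H g)"
proof -
  have "Q s g = (\<lambda>a. g a + s * H g a)" by (auto simp: Q_def)
  then show ?thesis using assms by (simp add: ip_add_right ip_scale_right)
qed

lemma ip_Q_sym:
  assumes "finsupp f" "finsupp g"
  shows "ip (Q s f) g = ip f (Q s g)"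
  using ip_Q[OF assms(1), of s g] ip_Q[OF assms(2), of s f] ip_H_sym[OF assms]
    ip_commute[of "Q s f" g] ip_commute[of "H f" g] ip_commute[of f g] by simp

lemma ip_Q_pow_sym:
  assumes "finsupp f" "finsupp g"
  shows "ip ((Q s ^^ m) f) g = ip f ((Q s ^^ m) g)"
  using assms
proof (induction m arbitrary: g)
  case (Suc m)
  have "ip ((Q s ^^ Suc m) f) g = ip ((Q s ^^ m) f) (Q s g)"
    using Suc.prems by (simp add: ip_Q_sym finsupp_Q_pow)
  also have "\<dots> = ip f ((Q s ^^ m) (Q s g))"
    using Suc by (simp add: finsupp_Q)
  finally show ?case by (simp add: funpow_swap1)
qed simp

text \<open>Moves preserve \<open>ip\<close>, so by Cauchy-Schwarz the hopping part contributes a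
  nonpositive amount and only the potential can be positive. Consequently the set in the definition
  of \<open>Lam\<close> is bounded above.\<close>

lemma ip_H_le:
  assumes "finsupp f" shows "ip f (H f) \<le> vmax * ip f f"
proof -
  have "(\<Sum>e\<in>E. r e * (ip f (\<lambda>a. f (mv e a)) - ip f f)) \<le> 0"
    using ip_mv_le[OF assms] r_nonneg by (intro sum_nonpos mult_nonneg_nonpos) (auto simp: abs_le_iff)
  moreover have "ip f (\<lambda>a. V a * f a) \<le> vmax * ip f f"
  proof -
    have "ip f (\<lambda>a. V a * f a) = (\<Sum>a\<in>{a. f a \<noteq> 0}. V a * (f a)\<^sup>2)"
      using assms by (subst ip_eq_sum[of "{a. f a \<noteq> 0}"]) (auto simp: power2_eq_square algebra_simps)
    also have "\<dots> \<le> (\<Sum>a\<in>{a. f a \<noteq> 0}. vmax * (f a)\<^sup>2)"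
      by (intro sum_mono mult_right_mono V_le) auto
    also have "\<dots> = vmax * ip f f"
      using assms by (subst ip_eq_sum[of "{a. f a \<noteq> 0}"]) (auto simp: power2_eq_square sum_distrib_left)
    finally show ?thesis .
  qed
  ultimately show ?thesis unfolding ip_H[OF assms] by linarith
qed

lemma Lam_bdd: "bdd_above {ip f (H f) | f. finsupp f \<and> ip f f = 1}"
  by (rule bdd_aboveI[of _ vmax]) (use ip_H_le in fastforce)

lemma H_scale: "H (\<lambda>a. c * f a) = (\<lambda>a. c * H f a)"
  by (auto simp: H_def fun_eq_iff sum_distrib_left algebra_simps)

lemma ip_H_le_Lam:
  assumes "finsupp f"
  shows "ip f (H f) \<le> Lam * ip f f"
proof (cases "\<exists>a. f a \<noteq> 0")
  case True
  then have pos: "ip f f > 0" using ip_self_pos[OF assms] by blast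
  define c where "c = 1 / sqrt (ip f f)"
  define g where "g = (\<lambda>a. c * f a)"
  have c2: "c * c * ip f f = 1" using pos by (simp add: c_def)
  have "finsupp g" unfolding g_def by (rule finite_subset[OF _ assms]) auto
  moreover have "ip g g = 1" unfolding g_def ip_scale_left ip_scale_right using c2 by (simp only: mult.assoc)
  ultimately have "ip g (H g) \<le> Lam" unfolding Lam_def by (intro cSup_upper Lam_bdd) auto
  moreover have "ip g (H g) = c * c * ip f (H f)"
    unfolding g_def H_scale ip_scale_left ip_scale_right by (simp only: mult.assoc)
  moreover have "c * c > 0" using pos by (simp add: c_def)
  ultimately have "c * c * ip f (H f) * ip f f \<le> Lam * ip f f" using pos by simp
  moreover have "c * c * ip f (H f) * ip f f = ip f (H f)" 
    using c2 by (metis mult.assoc mult.commute mult.right_neutral)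
  ultimately show ?thesis by simp
next
  case False
  then have "f = (\<lambda>_. 0)" by auto
  then show ?thesis by (simp add: ip_def)
qed

text \<open>Combes--Thomas estimate: \<open>w Q\<^sub>s w\<^sup>-\<^sup>1\<close> is a small perturbation of \<open>Q\<^sub>s\<close> if \<open>w\<close> varies slowly.\<close>

lemma weighted_Q_le:
  assumes "finsupp f" "0 \<le> s" "0 \<le> \<epsilon>"
    and w_pos: "\<And>a. 0 < w a" and w_mv: "\<And>e a. e \<in> E \<Longrightarrow> w a \<le> exp \<epsilon> * w (mv e a)"
  defines "K \<equiv> (exp \<epsilon> * R + R + vmax)\<^sup>2 * (card E + 1)\<^sup>2"
  shows "ip (\<lambda>a. w a * Q s f a) (\<lambda>a. w a * Q s f a)
     \<le> (1 + 2 * s * (Lam + (exp \<epsilon> - 1) * R) + s\<^sup>2 * K) * ip (\<lambda>a. w a * f a) (\<lambda>a. w a * f a)"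
proof -
  \<comment> \<open>Conjugation by the weight: \<open>w a * H f a\<close> equals
    \<open>H h a + D a\<close>, where \<open>D\<close> only involves the deviations of
    \<open>w a / w (mv e a)\<close> from 1.\<close>
  define h where "h = (\<lambda>a. w a * f a)"
  define D where "D = (\<lambda>a. \<Sum>e\<in>E. r e * ((w a / w (mv e a) - 1) * h (mv e a)))"
  define g where "g = (\<lambda>a. H h a + D a)"
  have h: "finsupp h" unfolding h_def by (rule finite_subset[OF _ assms(1)]) auto
  have hm: "finsupp (\<lambda>a. h (mv e a))" for e by (rule finsupp_mv[OF h])
  have g: "finsupp g"
    by (rule finsupp_dominated[of h "\<lambda>e a. h (mv e a)"]) (use h hm in \<open>auto simp: g_def D_def H_def\<close>)
  have ratio: "w a / w (mv e a) \<le> exp \<epsilon>" "exp (-\<epsilon>) \<le> w a / w (mv e a)" if "e \<in> E" for e a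
  proof -
    show "w a / w (mv e a) \<le> exp \<epsilon>" using w_mv[OF that, of a] w_pos[of "mv e a"]
      by (simp add: divide_le_eq)
    have "w (mv e a) \<le> exp \<epsilon> * w a" using w_mv[OF inv_in[OF that], of "mv e a"] by (simp add: mv_inv)
    then show "exp (-\<epsilon>) \<le> w a / w (mv e a)" using w_pos[of "mv e a"] 
      by (simp add: exp_minus field_simps)
  qed
  \<comment> \<open>Since \<open>exp \<epsilon> + exp (-\<epsilon>) \<ge> 2\<close>, the downward
    deviation of the ratio is bounded by the upward one.\<close>
  have eps: "1 - exp (-\<epsilon>) \<le> exp \<epsilon> - 1"
    using exp_ge_add_one_self[of \<epsilon>] exp_ge_add_one_self[of "-\<epsilon>"] by linarith
  have abs_ratio: "\<bar>w a / w (mv e a) - 1\<bar> \<le> exp \<epsilon> - 1" if "e \<in> E" for e a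
    using ratio[OF that, of a] eps by (simp add: abs_le_iff)
  have QE: "w a * Q s f a = h a + s * g a" for a
  proof -
    have "w a * H f a = g a"
    proof -
      have "g a = (\<Sum>e\<in>E. r e * (h (mv e a) - h a) + r e * ((w a / w (mv e a) - 1) * h (mv e a))) + V a * h a"
        by (simp add: g_def H_def D_def sum.distrib)
      also have "(\<Sum>e\<in>E. r e * (h (mv e a) - h a) + r e * ((w a / w (mv e a) - 1) * h (mv e a)))
         = (\<Sum>e\<in>E. w a * (r e * (f (mv e a) - f a)))"
      proof (rule sum.cong[OF refl])
        fix e assume "e \<in> E"
        have "w (mv e a) \<noteq> 0" using w_pos[of "mv e a"] by simp
        then show "r e * (h (mv e a) - h a) + r e * ((w a / w (mv e a) - 1) * h (mv e a))
           = w a * (r e * (f (mv e a) - f a))"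
          by (simp add: h_def field_simps)
      qed
      finally show ?thesis by (simp add: H_def h_def sum_distrib_left algebra_simps)
    qed
    then show ?thesis by (simp add: Q_def h_def algebra_simps)
  qed
  \<comment> \<open>First-order term: its constant enters the growth rate, so it has to vanish as
    \<epsilon> tends to 0.\<close>
  have "ip h D \<le> (exp \<epsilon> - 1) * R * ip h h"
  proof -
    have "ip h D = (\<Sum>e\<in>E. r e * ip h (\<lambda>a. (w a / w (mv e a) - 1) * h (mv e a)))"
      unfolding D_def using h by (simp only: ip_sum_right ip_scale_right)
    also have "\<dots> \<le> (\<Sum>e\<in>E. r e * ((exp \<epsilon> - 1) * ip h h))"
    proof (intro sum_mono mult_left_mono r_nonneg)
      fix e assume e: "e \<in> E"
      have "ip h (\<lambda>a. (w a / w (mv e a) - 1) * h (mv e a))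
          = (\<Sum>a\<in>{a. h a \<noteq> 0}. h a * ((w a / w (mv e a) - 1) * h (mv e a)))"
        using h by (intro ip_eq_sum) auto
      also have "\<dots> \<le> (\<Sum>a\<in>{a. h a \<noteq> 0}. \<bar>h a\<bar> * ((exp \<epsilon> - 1) * \<bar>h (mv e a)\<bar>))"
      proof (rule sum_mono)
        fix a
        have "h a * ((w a / w (mv e a) - 1) * h (mv e a)) \<le> \<bar>h a\<bar> * (\<bar>w a / w (mv e a) - 1\<bar> * \<bar>h (mv e a)\<bar>)"
          by (metis abs_ge_self abs_mult)
        also have "\<dots> \<le> \<bar>h a\<bar> * ((exp \<epsilon> - 1) * \<bar>h (mv e a)\<bar>)"
          by (intro mult_left_mono mult_right_mono abs_ratio e) auto
        finally show "h a * ((w a / w (mv e a) - 1) * h (mv e a)) \<le> \<bar>h a\<bar> * ((exp \<epsilon> - 1) * \<bar>h (mv e a)\<bar>)" .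
      qed
      also have "\<dots> = (exp \<epsilon> - 1) * ip (\<lambda>a. \<bar>h a\<bar>) (\<lambda>a. \<bar>h (mv e a)\<bar>)"
        using h by (subst ip_eq_sum[of "{a. h a \<noteq> 0}"]) (auto simp: sum_distrib_left algebra_simps)
      also have "\<dots> \<le> (exp \<epsilon> - 1) * ip h h"
      proof (intro mult_left_mono)
        have ab: "ip (\<lambda>a. \<bar>h a\<bar>) (\<lambda>a. \<bar>h a\<bar>) = ip h h" by (simp add: ip_def)
        have "\<bar>ip (\<lambda>a. \<bar>h a\<bar>) (\<lambda>a. \<bar>h (mv e a)\<bar>)\<bar> \<le> ip h h"
          using ip_mv_mv[of "\<lambda>a. \<bar>h a\<bar>" e "\<lambda>a. \<bar>h a\<bar>"] h hm[of e] by (intro ip_abs_le) (auto simp: ab)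
        then show "ip (\<lambda>a. \<bar>h a\<bar>) (\<lambda>a. \<bar>h (mv e a)\<bar>) \<le> ip h h" by simp
        show "0 \<le> exp \<epsilon> - 1" using assms by simp
      qed
      finally show "ip h (\<lambda>a. (w a / w (mv e a) - 1) * h (mv e a)) \<le> (exp \<epsilon> - 1) * ip h h" .
    qed
    also have "\<dots> = (exp \<epsilon> - 1) * R * ip h h" unfolding R_def sum_distrib_left sum_distrib_right by (simp only: mult_ac)
    finally show ?thesis .
  qed
  then have hg: "ip h g \<le> (Lam + (exp \<epsilon> - 1) * R) * ip h h"
    using ip_H_le_Lam[OF h] h unfolding g_def by (simp add: ip_add_right algebra_simps)
  \<comment> \<open>Second-order term: it carries the factor \<open>s\<^sup>2\<close>, so a crude
    bound suffices. One factor \<open>card E + 1\<close> of \<open>K\<close> comes from squaring a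
    sum of that many terms, the other from the number of shifted copies of \<open>h\<close>.\<close>
  have gg: "ip g g \<le> K * ip h h"
  proof -
    define M where "M = exp \<epsilon> * R + R + vmax"
    have M0: "0 \<le> M" using R_nonneg vmax_nonneg by (simp add: M_def)
    have gb: "\<bar>g a\<bar> \<le> M * (\<bar>h a\<bar> + (\<Sum>e\<in>E. \<bar>h (mv e a)\<bar>))" for a
    proof -
      have rR: "r e \<le> R" if "e \<in> E" for e
        unfolding R_def using that finite_E r_nonneg by (intro member_le_sum) auto
      have "g a = (\<Sum>e\<in>E. r e * (w a / w (mv e a)) * h (mv e a)) - R * h a + V a * h a"
        unfolding g_def H_def D_def R_def sum_distrib_right
        by (simp add: algebra_simps sum.distrib sum_subtractf)
      also have "\<bar>\<dots>\<bar> \<le> (\<Sum>e\<in>E. \<bar>r e * (w a / w (mv e a)) * h (mv e a)\<bar>) + R * \<bar>h a\<bar> + vmax * \<bar>h a\<bar>"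
      proof -
        have "\<bar>V a * h a\<bar> \<le> vmax * \<bar>h a\<bar>" using V_nonneg V_le by (auto simp: abs_mult intro!: mult_right_mono)
        moreover have "\<bar>R * h a\<bar> = R * \<bar>h a\<bar>" using R_nonneg by (simp add: abs_mult)
        ultimately show ?thesis using sum_abs[of "\<lambda>e. r e * (w a / w (mv e a)) * h (mv e a)" E] by linarith
      qed
      also have "(\<Sum>e\<in>E. \<bar>r e * (w a / w (mv e a)) * h (mv e a)\<bar>) \<le> (\<Sum>e\<in>E. M * \<bar>h (mv e a)\<bar>)"
      proof (rule sum_mono)
        fix e assume e: "e \<in> E"
        have "r e * (w a / w (mv e a)) \<le> R * exp \<epsilon>"
          using rR[OF e] ratio(1)[OF e, of a] r_nonneg[of e] R_nonneg w_pos[of a] w_pos[of "mv e a"]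
          by (intro mult_mono) auto
        also have "\<dots> \<le> M" using R_nonneg vmax_nonneg by (simp add: M_def)
        finally have "r e * (w a / w (mv e a)) \<le> M" .
        moreover have "0 \<le> r e * (w a / w (mv e a))" using r_nonneg[of e] w_pos[of a] w_pos[of "mv e a"] by simp
        ultimately show "\<bar>r e * (w a / w (mv e a)) * h (mv e a)\<bar> \<le> M * \<bar>h (mv e a)\<bar>"
          unfolding abs_mult[of _ "h (mv e a)"] by (metis abs_ge_zero abs_of_nonneg mult_right_mono)
      qed
      also have "(\<Sum>e\<in>E. M * \<bar>h (mv e a)\<bar>) + R * \<bar>h a\<bar> + vmax * \<bar>h a\<bar> \<le> M * (\<bar>h a\<bar> + (\<Sum>e\<in>E. \<bar>h (mv e a)\<bar>))"
      proof -
        have "(R + vmax) * \<bar>h a\<bar> \<le> M * \<bar>h a\<bar>"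
          using R_nonneg by (intro mult_right_mono) (auto simp: M_def)
        then show ?thesis by (simp add: sum_distrib_left distrib_left distrib_right)
      qed
      finally show ?thesis by simp
    qed
    have g2: "(g a)\<^sup>2 \<le> M\<^sup>2 * (card E + 1) * ((h a)\<^sup>2 + (\<Sum>e\<in>E. (h (mv e a))\<^sup>2))" for a
    proof -
      \<comment> \<open>\<open>None\<close> indexes the point itself and \<open>Some e\<close> its
        neighbours, so that one inequality for squares of sums covers all \<open>card E + 1\<close>
        terms.\<close>
      let ?x = "\<lambda>e. case e of None \<Rightarrow> \<bar>h a\<bar> | Some e \<Rightarrow> \<bar>h (mv e a)\<bar>"
      have ins: "(\<Sum>e\<in>insert None (Some ` E). F e) = F None + (\<Sum>e\<in>E. F (Some e))" for F :: "_ \<Rightarrow> real"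
        using finite_E by (subst sum.insert) (auto simp: sum.reindex)
      have "(g a)\<^sup>2 \<le> (M * (\<bar>h a\<bar> + (\<Sum>e\<in>E. \<bar>h (mv e a)\<bar>)))\<^sup>2"
        using gb[of a] by (metis abs_ge_zero power2_abs power_mono)
      also have "\<dots> = M\<^sup>2 * (\<Sum>e\<in>insert None (Some ` E). ?x e)\<^sup>2"
        by (simp only: ins) (simp add: power_mult_distrib)
      also have "\<dots> \<le> M\<^sup>2 * ((\<Sum>e\<in>insert None (Some ` E). (?x e)\<^sup>2) * card (insert None (Some ` E)))"
        by (intro mult_left_mono sum_squared_le_sum_of_squares) simp
      also have "\<dots> = M\<^sup>2 * (card E + 1) * ((h a)\<^sup>2 + (\<Sum>e\<in>E. (h (mv e a))\<^sup>2))"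
        using finite_E by (simp only: ins) (simp add: card_image algebra_simps)
      finally show ?thesis .
    qed
    have "ip g g = (\<Sum>a\<in>{a. g a \<noteq> 0}. (g a)\<^sup>2)"
      using g by (subst ip_eq_sum[of "{a. g a \<noteq> 0}"]) (auto simp: power2_eq_square)
    also have "\<dots> \<le> (\<Sum>a\<in>{a. g a \<noteq> 0}. M\<^sup>2 * (card E + 1) * ((h a)\<^sup>2 + (\<Sum>e\<in>E. (h (mv e a))\<^sup>2)))"
      by (intro sum_mono g2)
    also have "\<dots> = M\<^sup>2 * (card E + 1) * ((\<Sum>a\<in>{a. g a \<noteq> 0}. (h a)\<^sup>2) + (\<Sum>e\<in>E. \<Sum>a\<in>{a. g a \<noteq> 0}. (h (mv e a))\<^sup>2))"
    proof -
      have sw: "(\<Sum>a\<in>{a. g a \<noteq> 0}. \<Sum>e\<in>E. (h (mv e a))\<^sup>2) = (\<Sum>e\<in>E. \<Sum>a\<in>{a. g a \<noteq> 0}. (h (mv e a))\<^sup>2)"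
        by (rule sum.swap)
      show ?thesis unfolding sw[symmetric] sum.distrib[symmetric] sum_distrib_left[symmetric] ..
    qed
    also have "\<dots> \<le> M\<^sup>2 * (card E + 1) * (ip h h + (\<Sum>e\<in>E. ip h h))"
    proof (intro mult_left_mono add_mono sum_mono)
      have le: "(\<Sum>a\<in>A. (k a)\<^sup>2) \<le> ip k k" if "finite A" "finsupp k" for A and k :: "'s \<Rightarrow> real"
      proof -
        have "(\<Sum>a\<in>A. (k a)\<^sup>2) \<le> (\<Sum>a\<in>A \<union> {a. k a \<noteq> 0}. (k a)\<^sup>2)"
          using that by (intro sum_mono2) auto
        also have "\<dots> = ip k k" using that by (subst ip_eq_sum[of "A \<union> {a. k a \<noteq> 0}"]) (auto simp: power2_eq_square)
        finally show ?thesis .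
      qed
      show "(\<Sum>a\<in>{a. g a \<noteq> 0}. (h a)\<^sup>2) \<le> ip h h" using le[OF g h] .
      show "(\<Sum>a\<in>{a. g a \<noteq> 0}. (h (mv e a))\<^sup>2) \<le> ip h h" for e
        using le[OF g hm[of e]] by (simp add: ip_mv_mv)
    qed auto
    also have "\<dots> = K * ip h h" by (simp add: K_def M_def power2_eq_square algebra_simps)
    finally show ?thesis .
  qed
  have "ip (\<lambda>a. w a * Q s f a) (\<lambda>a. w a * Q s f a) = ip h h + 2 * s * ip h g + s\<^sup>2 * ip g g"
    unfolding QE by (rule ip_add_self[OF h g])
  also have "\<dots> \<le> ip h h + 2 * s * ((Lam + (exp \<epsilon> - 1) * R) * ip h h) + s\<^sup>2 * (K * ip h h)"
    using hg gg assms(2) by (intro add_mono mult_left_mono) auto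
  also have "\<dots> = (1 + 2 * s * (Lam + (exp \<epsilon> - 1) * R) + s\<^sup>2 * K) * ip h h"
    by (simp add: algebra_simps)
  finally show ?thesis by (simp add: h_def)
qed

end

context hopping begin

text \<open>Iteration of the one-step bound with \<open>1 + x \<le> exp x\<close>; the exponential
  form suits the limit in which \<open>m * s\<close> stays fixed.\<close>

lemma weighted_Q_pow_le:
  assumes "finsupp f" "0 \<le> s" "0 \<le> \<epsilon>"
    and w_pos: "\<And>a. 0 < w a" and w_mv: "\<And>e a. e \<in> E \<Longrightarrow> w a \<le> exp \<epsilon> * w (mv e a)"
  defines "K \<equiv> (exp \<epsilon> * R + R + vmax)\<^sup>2 * (card E + 1)\<^sup>2"
  shows "ip (\<lambda>a. w a * (Q s ^^ m) f a) (\<lambda>a. w a * (Q s ^^ m) f a)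
     \<le> exp (real m * (2 * s * (Lam + (exp \<epsilon> - 1) * R) + s\<^sup>2 * K)) * ip (\<lambda>a. w a * f a) (\<lambda>a. w a * f a)"
proof (induction m)
  case (Suc m)
  let ?x = "2 * s * (Lam + (exp \<epsilon> - 1) * R) + s\<^sup>2 * K"
  have "ip (\<lambda>a. w a * (Q s ^^ Suc m) f a) (\<lambda>a. w a * (Q s ^^ Suc m) f a)
      \<le> (1 + 2 * s * (Lam + (exp \<epsilon> - 1) * R) + s\<^sup>2 * K) * ip (\<lambda>a. w a * (Q s ^^ m) f a) (\<lambda>a. w a * (Q s ^^ m) f a)"
    unfolding K_def using weighted_Q_le[of "(Q s ^^ m) f" s \<epsilon> w] finsupp_Q_pow[OF assms(1)] assms(2,3) w_pos w_mv by simp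
  also have "\<dots> \<le> exp ?x * ip (\<lambda>a. w a * (Q s ^^ m) f a) (\<lambda>a. w a * (Q s ^^ m) f a)"
    using exp_ge_add_one_self[of ?x] by (intro mult_right_mono ip_self_nonneg) (simp add: algebra_simps)
  also have "\<dots> \<le> exp ?x * (exp (m * ?x) * ip (\<lambda>a. w a * f a) (\<lambda>a. w a * f a))"
    by (intro mult_left_mono Suc.IH) auto
  also have "\<dots> = exp (Suc m * ?x) * ip (\<lambda>a. w a * f a) (\<lambda>a. w a * f a)"
    by (simp add: distrib_right exp_add)
  finally show ?case .
qed simp

text \<open>Finite propagation speed: \<open>m\<close> steps reach only points whose rank exceeds
  that of \<open>a\<close> by at most \<open>m\<close>. The set \<open>S\<close> is meant for the
  configurations in which all indices that never move have prescribed positions.\<close>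

lemma Q_pow_cong:
  fixes rk :: "'s \<Rightarrow> nat"
  assumes "\<And>e a. e \<in> E \<Longrightarrow> a \<in> S \<Longrightarrow> mv e a \<in> S" "\<And>e a. e \<in> E \<Longrightarrow> rk (mv e a) \<le> Suc (rk a)"
  shows "a \<in> S \<Longrightarrow> (\<And>b. b \<in> S \<Longrightarrow> rk b \<le> rk a + m \<Longrightarrow> f b = g b) \<Longrightarrow> (Q s ^^ m) f a = (Q s ^^ m) g a"
proof (induction m arbitrary: a)
  case (Suc m)
  have "(Q s ^^ m) f a = (Q s ^^ m) g a"
    using Suc.prems by (intro Suc.IH) auto
  moreover have "(Q s ^^ m) f (mv e a) = (Q s ^^ m) g (mv e a)" if "e \<in> E" for e
  proof (rule Suc.IH)
    show "mv e a \<in> S" using assms(1) that Suc.prems by blast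
    fix b assume "b \<in> S" "rk b \<le> rk (mv e a) + m"
    then show "f b = g b" using assms(2)[OF that, of a] by (intro Suc.prems(2)) auto
  qed
  ultimately show ?case by (simp add: Q_def[of s "(Q s ^^ m) f"] Q_def[of s "(Q s ^^ m) g"] H_def)
qed simp

text \<open>By finite propagation speed \<open>f\<close> may be cut off to finitely many points of
  \<open>S\<close>, and \<open>C\<close> bounds the weighted norm of every such cut-off, even if
  \<open>f\<close> itself has infinite support. A single value is at most the weighted norm divided
  by the weight, which produces \<open>C / w a\<close>.\<close>

lemma Q_pow_upper:
  fixes rk :: "'s \<Rightarrow> nat"
  assumes "0 \<le> s" "0 \<le> \<epsilon>"
    and w_pos: "\<And>a. 0 < w a" and w_mv: "\<And>e a. e \<in> E \<Longrightarrow> w a \<le> exp \<epsilon> * w (mv e a)"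
    and S: "\<And>e a. e \<in> E \<Longrightarrow> a \<in> S \<Longrightarrow> mv e a \<in> S"
    and rk: "\<And>e a. e \<in> E \<Longrightarrow> rk (mv e a) \<le> Suc (rk a)"
    and fin: "\<And>N. finite {b\<in>S. rk b \<le> N}"
    and C: "\<And>A. finite A \<Longrightarrow> A \<subseteq> S \<Longrightarrow> (\<Sum>b\<in>A. (w b * f b)\<^sup>2) \<le> C\<^sup>2" and C0: "0 \<le> C"
    and a: "a \<in> S"
  defines "K \<equiv> (exp \<epsilon> * R + R + vmax)\<^sup>2 * (card E + 1)\<^sup>2"
  shows "\<bar>(Q s ^^ m) f a\<bar> \<le> C / w a * exp (real m * s * (Lam + (exp \<epsilon> - 1) * R + s * K / 2))"
proof -
  let ?A = "{b\<in>S. rk b \<le> rk a + m}"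
  let ?x = "real m * s * (Lam + (exp \<epsilon> - 1) * R + s * K / 2)"
  define g where "g = (\<lambda>b. if b \<in> ?A then f b else 0)"
  have g: "finsupp g" unfolding g_def by (rule finite_subset[OF _ fin[of "rk a + m"]]) auto
  have eq: "(Q s ^^ m) f a = (Q s ^^ m) g a"
    by (rule Q_pow_cong[of S rk]) (use S rk a in \<open>auto simp: g_def\<close>)
  have wg: "finsupp (\<lambda>a. w a * (Q s ^^ m) g a)"
    by (rule finite_subset[OF _ finsupp_Q_pow[OF g]]) auto
  have "(w a * (Q s ^^ m) g a)\<^sup>2 \<le> ip (\<lambda>a. w a * (Q s ^^ m) g a) (\<lambda>a. w a * (Q s ^^ m) g a)"
    by (rule sq_le_ip_self[OF wg])
  also have "\<dots> \<le> exp (real m * (2 * s * (Lam + (exp \<epsilon> - 1) * R) + s\<^sup>2 * K)) * ip (\<lambda>a. w a * g a) (\<lambda>a. w a * g a)"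
    unfolding K_def by (rule weighted_Q_pow_le) (use assms g in auto)
  also have "real m * (2 * s * (Lam + (exp \<epsilon> - 1) * R) + s\<^sup>2 * K) = ?x + ?x"
    by (simp add: algebra_simps power2_eq_square)
  also have "ip (\<lambda>a. w a * g a) (\<lambda>a. w a * g a) = (\<Sum>b\<in>?A. (w b * f b)\<^sup>2)"
    by (subst ip_eq_sum[of ?A]) (use fin in \<open>auto simp: g_def power2_eq_square split: if_splits\<close>)
  also have "exp (?x + ?x) * (\<Sum>b\<in>?A. (w b * f b)\<^sup>2) \<le> exp (?x + ?x) * C\<^sup>2"
    using fin by (intro mult_left_mono C) auto
  also have "\<dots> = (exp ?x * C)\<^sup>2" unfolding exp_add power2_eq_square by simp
  finally have "\<bar>w a * (Q s ^^ m) g a\<bar> \<le> exp ?x * C"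
    using C0 by (metis abs_le_square_iff abs_of_nonneg exp_ge_zero mult_nonneg_nonneg)
  then show ?thesis
    using w_pos[of a] by (simp add: eq abs_mult field_simps)
qed

section \<open>Positivity of the one-step operator and lower bounds for its powers\<close>

text \<open>This is \<open>H + R\<close>, which has nonnegative coefficients. It exhibits
  \<open>Q s\<close> as a combination of the identity and \<open>B\<close> that preserves positivity
  as long as \<open>s * R \<le> 1\<close>; the powers of \<open>B\<close> add up weights of
  paths.\<close>

definition B :: "('s \<Rightarrow> real) \<Rightarrow> 's \<Rightarrow> real"
  where "B f a = (\<Sum>e\<in>E. r e * f (mv e a)) + V a * f a"

lemma Q_eq_B: "Q s f a = (1 - s * R) * f a + s * B f a"
proof -
  have *: "(\<Sum>e\<in>E. r e * (f (mv e a) - f a)) = (\<Sum>e\<in>E. r e * f (mv e a)) - R * f a"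
    by (simp add: R_def sum_subtractf right_diff_distrib sum_distrib_right)
  show ?thesis unfolding Q_def H_def B_def * by (simp add: algebra_simps)
qed

lemma B_mono: "(\<And>a. f a \<le> g a) \<Longrightarrow> B f a \<le> B g a"
  unfolding B_def by (intro add_mono sum_mono mult_left_mono r_nonneg V_nonneg)

lemma Q_mono:
  assumes "0 \<le> s" "s * R \<le> 1" "\<And>a. f a \<le> g a" shows "Q s f a \<le> Q s g a"
  unfolding Q_eq_B using assms by (intro add_mono mult_left_mono B_mono) auto

lemma Q_pow_mono:
  assumes "0 \<le> s" "s * R \<le> 1" "\<And>a. f a \<le> g a" shows "(Q s ^^ m) f a \<le> (Q s ^^ m) g a"
  using assms(3) by (induction m arbitrary: a) (auto intro!: Q_mono[OF assms(1,2)])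

lemma Q_zero [simp]: "(Q s ^^ m) (\<lambda>_. 0) = (\<lambda>_. 0)"
  by (induction m) (auto simp: Q_def H_def fun_eq_iff)

lemma Q_pow_nonneg:
  assumes "0 \<le> s" "s * R \<le> 1" "\<And>a. 0 \<le> f a" shows "0 \<le> (Q s ^^ m) f a"
  using Q_pow_mono[of s "\<lambda>_. 0" f] assms by simp

lemma Q_scale: "Q s (\<lambda>a. c * f a) = (\<lambda>a. c * Q s f a)"
  by (auto simp: Q_def H_scale fun_eq_iff algebra_simps)

lemma Q_pow_scale: "(Q s ^^ m) (\<lambda>a. c * f a) = (\<lambda>a. c * (Q s ^^ m) f a)"
  by (induction m) (simp_all add: Q_scale)

lemma B_scale: "B (\<lambda>a. c * f a) a = c * B f a"
  by (simp add: B_def sum_distrib_left algebra_simps)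

lemma B_pow_nonneg: "(\<And>a. 0 \<le> f a) \<Longrightarrow> 0 \<le> (B ^^ k) f a"
  by (induction k arbitrary: a) (auto simp: B_def intro!: add_nonneg_nonneg sum_nonneg mult_nonneg_nonneg r_nonneg V_nonneg)

text \<open>A single term of the binomial expansion of \<open>((1 - s * R) + s * B) ^ l\<close>, all
  other terms being nonnegative. The induction on \<open>l\<close> follows Pascal's rule.\<close>

lemma Q_pow_ge_binomial:
  assumes "0 \<le> s" "s * R \<le> 1" "\<And>a. 0 \<le> f a"
  shows "real (l choose k) * s ^ k * (1 - s * R) ^ (l - k) * (B ^^ k) f a \<le> (Q s ^^ l) f a"
proof (induction l arbitrary: k a)
  case 0
  then show ?case using assms(3)[of a] by (cases k) auto
next
  case (Suc l)
  let ?q = "1 - s * R"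
  have q: "0 \<le> ?q" using assms by simp
  have nn: "0 \<le> (B ^^ k) f a" for k a using B_pow_nonneg assms(3) by blast
  have l1: "real (l choose k) * s ^ k * ?q ^ (Suc l - k) * (B ^^ k) f a \<le> ?q * (Q s ^^ l) f a" for k
  proof (cases "k \<le> l")
    case True
    have "?q * (real (l choose k) * s ^ k * ?q ^ (l - k) * (B ^^ k) f a) \<le> ?q * (Q s ^^ l) f a"
      by (rule mult_left_mono[OF Suc q])
    then show ?thesis using True by (simp add: Suc_diff_le algebra_simps)
  next
    case False
    then show ?thesis using q Q_pow_nonneg[OF assms] by (simp add: binomial_eq_0)
  qed
  have l2: "real (l choose k) * s ^ Suc k * ?q ^ (l - k) * (B ^^ Suc k) f a \<le> s * B ((Q s ^^ l) f) a" for k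
  proof -
    have "s * B (\<lambda>b. real (l choose k) * s ^ k * ?q ^ (l - k) * (B ^^ k) f b) a \<le> s * B ((Q s ^^ l) f) a"
      by (intro mult_left_mono B_mono Suc assms(1))
    then show ?thesis unfolding B_scale by (simp add: mult_ac)
  qed
  show ?case
  proof (cases k)
    case 0
    have "0 \<le> s * B ((Q s ^^ l) f) a"
      using assms(1) Q_pow_nonneg[OF assms] B_mono[of "\<lambda>_. 0" "(Q s ^^ l) f" a]
      by (intro mult_nonneg_nonneg) (auto simp: B_def)
    with l1[of 0] 0 show ?thesis by (simp add: Q_eq_B[of s "(Q s ^^ l) f" a])
  next
    case (Suc j)
    have "real (Suc l choose Suc j) * s ^ Suc j * ?q ^ (Suc l - Suc j) * (B ^^ Suc j) f a
       = real (l choose Suc j) * s ^ Suc j * ?q ^ (Suc l - Suc j) * (B ^^ Suc j) f a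
         + real (l choose j) * s ^ Suc j * ?q ^ (l - j) * (B ^^ Suc j) f a"
      by (simp add: distrib_right)
    also have "\<dots> \<le> ?q * (Q s ^^ l) f a + s * B ((Q s ^^ l) f) a"
      by (intro add_mono l1 l2)
    finally show ?thesis unfolding Suc by (simp add: Q_eq_B[of s "(Q s ^^ l) f" a])
  qed
qed

lemma one_minus_ge_exp:
  fixes x :: real assumes "0 \<le> x" "x \<le> 1/2" shows "exp (- 2 * x) \<le> 1 - x"
proof -
  have "exp (2 * x) * (1 - x) \<ge> (1 + 2 * x) * (1 - x)"
    using assms exp_ge_add_one_self[of "2*x"] by (intro mult_right_mono) auto
  also have "(1 + 2 * x) * (1 - x) = 1 + x * (1 - 2 * x)" by (simp add: algebra_simps)
  also have "\<dots> \<ge> 1" using assms by simp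
  finally show ?thesis by (simp add: exp_minus field_simps)
qed

text \<open>A bound independent of the step size. If the \<open>l\<close> steps cover a time between
  1 and 2, then \<open>(l choose k) * s ^ k\<close> is at least
  \<open>(l * s / k) ^ k \<ge> (1 / k) ^ k\<close>, and the steps without a move contribute at least
  \<open>exp (- 2 * s * R * l) \<ge> exp (- 4 * R)\<close>. For \<open>k = 0\<close> the convention
  \<open>0 ^ 0 = 1\<close> yields the right factor.\<close>

lemma Q_pow_ge_B_pow:
  assumes "0 < s" "s * R \<le> 1/2" "\<And>a. 0 \<le> f a" "k \<le> l" "1 \<le> real l * s" "real l * s \<le> 2"
  shows "(1 / k) ^ k * exp (- 4 * R) * (B ^^ k) f a \<le> (Q s ^^ l) f a"
proof -
  let ?q = "1 - s * R"
  have sR: "0 \<le> s * R" using assms R_nonneg by simp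
  have "exp (- 4 * R) \<le> exp (l * (- 2 * (s * R)))"
    using mult_right_mono[OF assms(6) R_nonneg] by (simp add: mult_ac)
  also have "\<dots> = exp (- 2 * (s * R)) ^ l" by (rule exp_of_nat_mult)
  also have "\<dots> \<le> ?q ^ l" using sR assms by (intro power_mono one_minus_ge_exp) auto
  also have "\<dots> \<le> ?q ^ (l - k)" using sR assms by (intro power_decreasing) auto
  finally have q: "exp (- 4 * R) \<le> ?q ^ (l - k)" .
  have "(1 / k) ^ k \<le> (l * s / k) ^ k"
    using assms by (intro power_mono divide_right_mono) auto
  also have "\<dots> = (real l / k) ^ k * s ^ k" by (simp add: power_mult_distrib power_divide)
  also have "\<dots> \<le> real (l choose k) * s ^ k"
    using assms by (intro mult_right_mono binomial_ge_n_over_k_pow_k) auto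
  finally have "(1 / k) ^ k * exp (- 4 * R) \<le> real (l choose k) * s ^ k * ?q ^ (l - k)"
    using q assms by (intro mult_mono) auto
  then have "(1 / k) ^ k * exp (- 4 * R) * (B ^^ k) f a \<le> real (l choose k) * s ^ k * ?q ^ (l - k) * (B ^^ k) f a"
    using B_pow_nonneg[of f] assms(3) by (intro mult_right_mono) auto
  also have "\<dots> \<le> (Q s ^^ l) f a" using assms by (intro Q_pow_ge_binomial) auto
  finally show ?thesis .
qed

text \<open>The squared norms \<open>N k\<close> are log-convex by symmetry and Cauchy-Schwarz, so
  the ratios \<open>N (k + 1) / N k\<close> do not decrease, and the first one is at least the
  square of \<open>ip f (Q s f) = 1 + s * ip f (H f)\<close>. This takes the place of Jensen's
  inequality for the spectral measure of \<open>f\<close>.\<close>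

lemma norm_Q_pow_ge:
  assumes f: "finsupp f" "ip f f = 1" and pos: "0 < 1 + s * ip f (H f)"
  shows "(1 + s * ip f (H f)) ^ (2 * k) \<le> ip ((Q s ^^ k) f) ((Q s ^^ k) f)"
proof -
  define N where "N k = ip ((Q s ^^ k) f) ((Q s ^^ k) f)" for k
  define c where "c = (1 + s * ip f (H f))\<^sup>2"
  have c: "c > 0" using pos by (simp add: c_def)
  have N_sq: "N (Suc k) ^ 2 \<le> N k * N (Suc (Suc k))" for k
  proof -
    have "N (Suc k) = ip ((Q s ^^ k) f) ((Q s ^^ Suc (Suc k)) f)"
      unfolding N_def using f by (simp add: ip_Q_sym finsupp_Q finsupp_Q_pow)
    then show ?thesis unfolding N_def using f by (simp add: ip_Cauchy_Schwarz finsupp_Q finsupp_Q_pow)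
  qed
  have "0 < N k \<and> c * N k \<le> N (Suc k)" for k
  proof (induction k)
    case 0
    have "(ip f (Q s f))\<^sup>2 \<le> ip f f * ip (Q s f) (Q s f)"
      using f by (intro ip_Cauchy_Schwarz finsupp_Q)
    then show ?case using f by (simp add: N_def c_def ip_Q)
  next
    case (Suc k)
    then have pos': "0 < N (Suc k)" using c by (meson less_le_trans mult_pos_pos)
    have "c * N k * N (Suc k) \<le> N (Suc k) * N (Suc k)" using Suc pos' by (intro mult_right_mono) auto
    also have "\<dots> \<le> N k * N (Suc (Suc k))" using N_sq[of k] by (simp add: power2_eq_square)
    finally have "N k * (c * N (Suc k)) \<le> N k * N (Suc (Suc k))" by (simp add: mult_ac)
    with Suc pos' show ?case by simp
  qed
  then have "c ^ k \<le> N k"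
  proof (induction k)
    case (Suc k)
    have "c ^ Suc k \<le> c * N k" using Suc c by simp
    also have "\<dots> \<le> N (Suc k)" using Suc by blast
    finally show ?case .
  qed (use f in \<open>simp add: N_def\<close>)
  then show ?thesis by (simp add: N_def c_def power_mult)
qed

text \<open>Absolute values keep the norm and the potential energy and can only increase the hopping
  terms, whose rates are nonnegative. Test functions may therefore be taken nonnegative, as
  comparison arguments with the positive operator \<open>Q s\<close> require.\<close>

lemma ip_H_abs_ge:
  assumes "finsupp f"
  shows "ip f (H f) \<le> ip (\<lambda>a. \<bar>f a\<bar>) (H (\<lambda>a. \<bar>f a\<bar>))"
proof -
  have le: "ip f (\<lambda>a. f (mv e a)) \<le> ip (\<lambda>a. \<bar>f a\<bar>) (\<lambda>a. \<bar>f (mv e a)\<bar>)" for e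
    using assms by (subst (1 2) ip_eq_sum[of "{a. f a \<noteq> 0}"])
      (auto intro!: sum_mono simp: abs_mult[symmetric] simp del: abs_mult)
  have eq: "ip (\<lambda>a. \<bar>f a\<bar>) (\<lambda>a. \<bar>f a\<bar>) = ip f f" by (simp add: ip_def)
  have eq': "ip (\<lambda>a. \<bar>f a\<bar>) (\<lambda>a. V a * \<bar>f a\<bar>) = ip f (\<lambda>a. V a * f a)"
    unfolding ip_def by (rule Sum_any.cong) (metis abs_mult_self_eq mult.left_commute)
  have "finsupp (\<lambda>a. \<bar>f a\<bar>)" using assms by simp
  then show ?thesis
    unfolding ip_H[OF assms] using le
    by (subst ip_H) (auto simp: eq eq' intro!: sum_mono mult_left_mono r_nonneg)
qed

text \<open>Two time segments of length about 1 connect \<open>z\<close> with the support of the test function \<open>f\<close>;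
  in between, log-convexity of the norms gives the growth rate \<open>\<langle>f, H f\<rangle>\<close>.\<close>

lemma Q_pow_lower:
  assumes f: "finsupp f" "ip f f = 1" "\<And>a. 0 \<le> f a"
    and conn: "\<And>a. f a \<noteq> 0 \<Longrightarrow> \<exists>k. 0 < (B ^^ k) (indicator {z}) a"
  shows "\<exists>c>0. \<forall>t\<ge>10. \<forall>\<^sub>F N in sequentially.
     c * exp (t * ip f (H f)) \<le> (Q (t / real (2 * N)) ^^ (2 * N)) (indicator {z}) z"
proof -
  define g where "g = ip f (H f)"
  define F where "F = {a. f a \<noteq> 0}"
  have F: "finite F" using f by (simp add: F_def)
  obtain k where k: "\<And>a. a \<in> F \<Longrightarrow> 0 < (B ^^ (k a)) (indicator {z}) a"
    using bchoice[of F "\<lambda>a k. 0 < (B ^^ k) (indicator {z}) a"] conn unfolding F_def by blast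
  \<comment> \<open>The evolution from \<open>z\<close> during a time of order 1 dominates a
    multiple of the test function: its support is finite, and each point of it is connected with
    \<open>z\<close>.\<close>
  have "\<exists>c>0. \<forall>a\<in>F. c * f a \<le> (1 / k a) ^ k a * exp (- 4 * R) * (B ^^ k a) (indicator {z}) a"
    using F k
  proof (induction F)
    case (insert b F)
    then obtain c where c: "c > 0" "\<forall>a\<in>F. c * f a \<le> (1 / k a) ^ k a * exp (- 4 * R) * (B ^^ k a) (indicator {z}) a"
      by auto
    define x where "x = (1 / k b) ^ k b * exp (- 4 * R) * (B ^^ k b) (indicator {z}) b"
    have "(1 / real (k b)) ^ k b > 0" by (cases "k b") auto
    then have x: "x > 0" using insert.prems[of b] by (simp add: x_def)
    define c' where "c' = min c (x / (f b + 1))"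
    have fb: "f b + 1 > 0" using f(3)[of b] by simp
    then have "c' > 0" using c x by (simp add: c'_def)
    moreover have "c' * f b \<le> x"
    proof -
      have "c' * f b \<le> x / (f b + 1) * f b" by (intro mult_right_mono f(3)) (simp add: c'_def)
      also have "\<dots> \<le> x" using fb x by (simp add: field_simps)
      finally show ?thesis .
    qed
    moreover have "c' * f a \<le> c * f a" for a by (intro mult_right_mono f(3)) (simp add: c'_def)
    ultimately show ?case using c(2) by (intro exI[of _ c']) (force simp: x_def intro: order_trans)
  qed (auto intro: exI[of _ 1])
  then obtain c where c: "c > 0" 
    "\<And>a. a \<in> F \<Longrightarrow> c * f a \<le> (1 / k a) ^ k a * exp (- 4 * R) * (B ^^ k a) (indicator {z}) a" by blast
  define kmax where "kmax = Max (insert 0 (k ` F))"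
  have kmax: "k a \<le> kmax" if "a \<in> F" for a unfolding kmax_def using F that by (intro Max_ge) auto
  \<comment> \<open>The loss \<open>4 * \<bar>g\<bar>\<close> pays for the two connecting segments,
    whose total time is at most 4, and \<open>2 * g\<^sup>2\<close> for replacing
    \<open>ln (1 + s * g)\<close> by \<open>s * g\<close> over a time at most \<open>t\<close>,
    where \<open>t * s \<le> 1\<close>. The threshold for \<open>N\<close> makes \<open>s\<close>
    small enough for all estimates below.\<close>
  have main: "c\<^sup>2 * exp (- 4 * \<bar>g\<bar> - 2 * g\<^sup>2) * exp (t * g) \<le> (Q (t / real (2 * N)) ^^ (2 * N)) (indicator {z}) z"
    if t: "t \<ge> 10" and N: "real N \<ge> t * t * (1 + R + \<bar>g\<bar>) + t * (real kmax + 1)" for t N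
  proof -
    define s where "s = t / real (2 * N)"
    \<comment> \<open>The least number of steps that covers a time of at least 1; as
      \<open>s \<le> 1/2\<close>, that time is at most 2.\<close>
    define l where "l = nat \<lceil>1 / s\<rceil>"
    have t2: "t * t \<ge> t" "t * t > 0" using t by auto
    have tR: "t * t * (1 + R + \<bar>g\<bar>) \<ge> t * t * 1" using t2 R_nonneg by (intro mult_left_mono) auto
    have tk: "t * (real kmax + 1) \<ge> t * 1" using t by (intro mult_left_mono) auto
    have Nt: "real N \<ge> t" "real N \<ge> t * t" "real N > 0" using N tR tk t t2 by linarith+
    have s0: "s > 0" using Nt t by (simp add: s_def)
    have sN: "real (2 * N) * s = t" using Nt by (simp add: s_def)
    have s_half: "s \<le> 1/2" using Nt t by (simp add: s_def field_simps)
    have ts: "t * s \<le> 1" using Nt t by (simp add: s_def field_simps)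
    have sx: "s * x \<le> 1/2" if "0 \<le> x" "x \<le> 1 + R + \<bar>g\<bar>" for x
    proof -
      have "t * x \<le> t * t * (1 + R + \<bar>g\<bar>)" using that t t2 R_nonneg by (intro mult_mono) auto
      also have "\<dots> \<le> N" using N tk t by linarith
      finally show ?thesis using Nt by (simp add: s_def field_simps)
    qed
    have sR: "s * R \<le> 1/2" using R_nonneg by (intro sx) auto
    have sg: "\<bar>s * g\<bar> \<le> 1/2" using sx[of "\<bar>g\<bar>"] R_nonneg s0 by (simp add: abs_mult)
    have l1: "1 \<le> l * s" "l * s \<le> 2"
    proof -
      have ce: "real l = of_int \<lceil>1 / s\<rceil>" using s0 by (simp add: l_def)
      have "1 / s \<le> l" unfolding ce by linarith
      then show "1 \<le> l * s" using s0 by (simp add: field_simps)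
      have "real l \<le> 1 / s + 1" unfolding ce by linarith
      then have "real l * s \<le> (1 / s + 1) * s" using s0 by (intro mult_right_mono) auto
      moreover have "(1 / s + 1) * s = 1 + s" using s0 by (simp add: distrib_right)
      ultimately show "l * s \<le> 2" using s_half by linarith
    qed
    have lk: "kmax \<le> l"
    proof -
      have "t * real kmax \<le> N" using N tR t2 t distrib_left[of t "real kmax" 1] by linarith
      also have "real N = 1 / s * t / 2" using sN s0 by (simp add: field_simps)
      also have "\<dots> \<le> real l * t / 2"
        using l1 s0 t by (intro divide_right_mono mult_right_mono) (auto simp: field_simps)
      also have "\<dots> \<le> t * real l" using t by simp
      finally have "t * real kmax \<le> t * real l" .
      then show ?thesis using t by simp
    qed
    have lN: "l \<le> N"
    proof -
      have "l * s \<le> N * s" using l1 sN t by simp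
      then show ?thesis using s0 by simp
    qed
    define d where "d = (indicator {z} :: 's \<Rightarrow> real)"
    have d: "finsupp d" "\<And>a. 0 \<le> d a" by (auto simp: d_def indicator_def)
    have ql: "c * f a \<le> (Q s ^^ l) d a" for a
    proof (cases "a \<in> F")
      case True
      have "c * f a \<le> (1 / k a) ^ k a * exp (- 4 * R) * (B ^^ k a) d a" using c(2)[OF True] by (simp add: d_def)
      also have "\<dots> \<le> (Q s ^^ l) d a"
        using s0 sR d l1 lk kmax[OF True] by (intro Q_pow_ge_B_pow) auto
      finally show ?thesis .
    next
      case False
      then show ?thesis using Q_pow_nonneg[of s d] s0 sR d by (simp add: F_def)
    qed
    \<comment> \<open>One outer segment will be moved to the other side of \<open>ip\<close>, and
      the even power in the middle becomes a squared norm. This is why the total number of steps is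
      even.\<close>
    have split: "(Q s ^^ (2 * N)) d = (Q s ^^ l) ((Q s ^^ (2 * (N - l))) ((Q s ^^ l) d))"
    proof -
      have "2 * N = l + (2 * (N - l) + l)" using lN by simp
      then show ?thesis by (metis (no_types, lifting) comp_apply funpow_add)
    qed
    have cf: "finsupp (\<lambda>a. c * f a)" using f c by simp
    have pos: "0 < 1 + s * g" using sg by linarith
    have "c\<^sup>2 * (1 + s * g) ^ (2 * (N - l)) \<le> c\<^sup>2 * ip ((Q s ^^ (N - l)) f) ((Q s ^^ (N - l)) f)"
      unfolding g_def using f pos by (intro mult_left_mono norm_Q_pow_ge) (auto simp: g_def)
    also have "\<dots> = ip (\<lambda>a. c * f a) ((Q s ^^ (2 * (N - l))) (\<lambda>a. c * f a))"
    proof -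
      have "ip ((Q s ^^ (N - l)) f) ((Q s ^^ (N - l)) f) = ip f ((Q s ^^ (2 * (N - l))) f)"
        using f by (simp add: ip_Q_pow_sym finsupp_Q_pow funpow_add mult_2)
      then show ?thesis by (simp add: Q_pow_scale ip_scale_left ip_scale_right power2_eq_square)
    qed
    also have "\<dots> \<le> ip (\<lambda>a. c * f a) ((Q s ^^ (2 * (N - l))) ((Q s ^^ l) d))"
      using cf c f s0 sR ql by (intro ip_mono Q_pow_mono) auto
    also have "\<dots> = ip ((Q s ^^ (2 * (N - l))) ((Q s ^^ l) d)) (\<lambda>a. c * f a)"
      by (rule ip_commute)
    also have "\<dots> \<le> ip ((Q s ^^ (2 * (N - l))) ((Q s ^^ l) d)) ((Q s ^^ l) d)"
      using d s0 sR ql by (intro ip_mono Q_pow_nonneg finsupp_Q_pow) auto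
    also have "\<dots> = ip d ((Q s ^^ (2 * N)) d)"
      using d by (simp add: split ip_Q_pow_sym finsupp_Q_pow ip_commute[of _ "(Q s ^^ l) d"])
    also have "\<dots> = (Q s ^^ (2 * N)) d z"
      by (subst ip_eq_sum[of "{z}"]) (auto simp: d_def indicator_def split: if_splits)
    finally have 1: "c\<^sup>2 * (1 + s * g) ^ (2 * (N - l)) \<le> (Q s ^^ (2 * N)) d z" .
    have 2: "exp (t * g - 4 * \<bar>g\<bar> - 2 * g\<^sup>2) \<le> (1 + s * g) ^ (2 * (N - l))"
    proof -
      define u where "u = real (2 * (N - l)) * s"
      have u: "u = t - 2 * (l * s)" using lN sN by (simp add: u_def of_nat_diff algebra_simps)
      have u0: "0 \<le> u" "u \<le> t" "t - 4 \<le> u" using u l1 t by linarith+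
      have "t * g - u * g \<le> 4 * \<bar>g\<bar>"
      proof -
        have "(t - u) * g \<le> (t - u) * \<bar>g\<bar>" using u0 by (intro mult_left_mono) auto
        also have "\<dots> \<le> 4 * \<bar>g\<bar>" using u0 by (intro mult_right_mono) auto
        finally show ?thesis by (simp add: algebra_simps)
      qed
      moreover have "u * (2 * s * g\<^sup>2) \<le> 2 * g\<^sup>2"
      proof -
        have "u * (2 * s * g\<^sup>2) \<le> t * (2 * s * g\<^sup>2)" using u0 s0 by (intro mult_right_mono) auto
        also have "\<dots> = (t * s) * (2 * g\<^sup>2)" by simp
        also have "\<dots> \<le> 1 * (2 * g\<^sup>2)" by (intro mult_right_mono ts) auto
        finally show ?thesis by simp
      qed
      ultimately have "t * g - 4 * \<bar>g\<bar> - 2 * g\<^sup>2 \<le> u * g - u * (2 * s * g\<^sup>2)" by linarith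
      also have "\<dots> = real (2 * (N - l)) * (s * g - 2 * (s * g)\<^sup>2)" 
        by (simp add: u_def algebra_simps power2_eq_square)
      also have "\<dots> \<le> real (2 * (N - l)) * ln (1 + s * g)"
        using abs_ln_one_plus_x_minus_x_bound[OF sg] by (intro mult_left_mono) linarith+
      finally have "exp (t * g - 4 * \<bar>g\<bar> - 2 * g\<^sup>2) \<le> exp (real (2 * (N - l)) * ln (1 + s * g))" by simp
      also have "\<dots> = (1 + s * g) ^ (2 * (N - l))" using pos by (simp only: exp_of_nat_mult) simp
      finally show ?thesis .
    qed
    have "c\<^sup>2 * exp (- 4 * \<bar>g\<bar> - 2 * g\<^sup>2) * exp (t * g) = c\<^sup>2 * exp (t * g - 4 * \<bar>g\<bar> - 2 * g\<^sup>2)"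
      by (simp add: exp_add[symmetric] algebra_simps)
    also have "\<dots> \<le> c\<^sup>2 * (1 + s * g) ^ (2 * (N - l))" by (intro mult_left_mono 2) auto
    also have "\<dots> \<le> (Q s ^^ (2 * N)) d z" by (rule 1)
    finally show ?thesis by (simp add: s_def d_def)
  qed
  show ?thesis
  proof (intro exI conjI allI impI)
    show "0 < c\<^sup>2 * exp (- 4 * \<bar>g\<bar> - 2 * g\<^sup>2)" using c by simp
    fix t :: real assume "10 \<le> t"
    have "\<forall>\<^sub>F N in sequentially. real N \<ge> t * t * (1 + R + \<bar>g\<bar>) + t * (real kmax + 1)"
      by (rule eventually_sequentiallyI[of "nat \<lceil>t * t * (1 + R + \<bar>g\<bar>) + t * (real kmax + 1)\<rceil>"]) linarith
    then show "\<forall>\<^sub>F N in sequentially. c\<^sup>2 * exp (- 4 * \<bar>g\<bar> - 2 * g\<^sup>2) * exp (t * ip f (H f))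
        \<le> (Q (t / real (2 * N)) ^^ (2 * N)) (indicator {z}) z"
      by eventually_elim (use main \<open>10 \<le> t\<close> in \<open>simp add: g_def\<close>)
  qed
qed

end

section \<open>The random walk semigroup\<close>

definition unit_steps :: "(int ^ 'd) set"
  where "unit_steps = nearest_neighbours 0"

lemma finite_unit_steps [simp]: "finite unit_steps"
  by (simp add: unit_steps_def finite_nearest_neighbours)

lemma uminus_unit_steps: "- v \<in> unit_steps \<longleftrightarrow> v \<in> unit_steps"
  by (simp add: unit_steps_def nearest_neighbours_def)

lemma nearest_neighbours_eq: "nearest_neighbours x = (+) x ` unit_steps"
proof -
  have "y \<in> (+) x ` unit_steps \<longleftrightarrow> y - x \<in> unit_steps" for y
    by (auto simp: image_iff intro!: bexI[of _ "y - x"])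
  then show ?thesis
    by (auto simp: unit_steps_def nearest_neighbours_def)
qed

lemma laplacian_eq: "laplacian f x = (\<Sum>v\<in>unit_steps. f (x + v) - f x)"
  unfolding laplacian_def nearest_neighbours_eq by (subst sum.reindex) auto

text \<open>A bound for the norm of the Laplacian on bounded functions. It depends on the dimension
  only, which is handed over as a type.\<close>

definition lap_bound :: "'d::finite itself \<Rightarrow> real"
  where "lap_bound _ = 2 * card (unit_steps :: (int ^ 'd) set)"

lemma lap_bound_nonneg: "0 \<le> lap_bound TYPE('d::finite)"
  by (simp add: lap_bound_def)

lemma laplacian_bounded:
  fixes f :: "int ^ 'd \<Rightarrow> real"
  assumes "\<And>x. \<bar>f x\<bar> \<le> C"
  shows "\<bar>laplacian f x\<bar> \<le> lap_bound TYPE('d) * C"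
proof -
  have "\<bar>laplacian f x\<bar> \<le> (\<Sum>v\<in>unit_steps. \<bar>f (x + v) - f x\<bar>)"
    unfolding laplacian_eq by (rule sum_abs)
  also have "\<dots> \<le> (\<Sum>v\<in>(unit_steps :: (int ^ 'd) set). 2 * C)"
  proof (rule sum_mono)
    fix v show "\<bar>f (x + v) - f x\<bar> \<le> 2 * C" using assms[of "x + v"] assms[of x] by linarith
  qed
  finally show ?thesis by (simp add: lap_bound_def)
qed

lemma laplacian_pow_bounded:
  fixes f :: "int ^ 'd \<Rightarrow> real"
  assumes "\<And>x. \<bar>f x\<bar> \<le> C"
  shows "\<bar>(laplacian ^^ k) f x\<bar> \<le> lap_bound TYPE('d) ^ k * C"
proof (induction k arbitrary: x)
  case (Suc k)
  then show ?case using laplacian_bounded[of "(laplacian ^^ k) f", OF Suc] by (simp add: mult_ac)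
qed (use assms in simp)

lemma laplacian_add: "laplacian (\<lambda>x. f x + g x) = (\<lambda>x. laplacian f x + laplacian g x)"
  by (auto simp: laplacian_eq fun_eq_iff sum.distrib[symmetric] intro!: sum.cong)

lemma laplacian_scale: "laplacian (\<lambda>x. c * f x) = (\<lambda>x. c * laplacian f x)"
  by (auto simp: laplacian_eq fun_eq_iff sum_distrib_left algebra_simps)

lemma laplacian_pow_add: "(laplacian ^^ k) (\<lambda>x. f x + g x) = (\<lambda>x. (laplacian ^^ k) f x + (laplacian ^^ k) g x)"
  by (induction k) (auto simp: laplacian_add)

lemma laplacian_pow_scale: "(laplacian ^^ k) (\<lambda>x. c * f x) = (\<lambda>x. c * (laplacian ^^ k) f x)"
  by (induction k) (auto simp: laplacian_scale)

definition sgterm :: "real \<Rightarrow> real \<Rightarrow> nat \<Rightarrow> (int ^ 'd \<Rightarrow> real) \<Rightarrow> int ^ 'd \<Rightarrow> real"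
  where "sgterm \<nu> t k f x = (t * \<nu>) ^ k / fact k * (laplacian ^^ k) f x"

lemma srw_semigroup_eq: "srw_semigroup \<nu> t f x = (suminf (\<lambda>k. sgterm \<nu> t k f x))"
  by (simp add: srw_semigroup_def sgterm_def)

lemma sgterm_bounded:
  fixes f :: "int ^ 'd \<Rightarrow> real"
  assumes "\<And>x. \<bar>f x\<bar> \<le> C" "0 \<le> t" "0 \<le> \<nu>"
  shows "\<bar>sgterm \<nu> t k f x\<bar> \<le> (t * \<nu> * lap_bound TYPE('d)) ^ k / fact k * C"
proof -
  have "\<bar>sgterm \<nu> t k f x\<bar> = (t * \<nu>) ^ k / fact k * \<bar>(laplacian ^^ k) f x\<bar>"
    using assms by (simp add: sgterm_def abs_mult)
  also have "\<dots> \<le> (t * \<nu>) ^ k / fact k * (lap_bound TYPE('d) ^ k * C)"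
    using assms by (intro mult_left_mono laplacian_pow_bounded) auto
  finally show ?thesis by (simp only: power_mult_distrib) simp
qed

lemma exp_terms_sums: "(\<lambda>k. x ^ k / fact k * C) sums (exp x * C)" for x C :: real
  using sums_mult2[OF exp_converges[of x], of C] by (simp add: field_simps)

lemma summable_sgterm:
  fixes f :: "int ^ 'd \<Rightarrow> real"
  assumes "\<And>x. \<bar>f x\<bar> \<le> C" "0 \<le> t" "0 \<le> \<nu>"
  shows "summable (\<lambda>k. sgterm \<nu> t k f x)"
  by (rule summable_comparison_test'[OF sums_summable[OF exp_terms_sums]])
     (use sgterm_bounded[OF assms] in auto)

lemma srw_semigroup_bounded:
  fixes f :: "int ^ 'd \<Rightarrow> real"
  assumes "\<And>x. \<bar>f x\<bar> \<le> C" "0 \<le> t" "0 \<le> \<nu>"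
  shows "\<bar>srw_semigroup \<nu> t f x\<bar> \<le> exp (t * \<nu> * lap_bound TYPE('d)) * C"
proof -
  have "norm (suminf (\<lambda>k. sgterm \<nu> t k f x)) \<le> (suminf (\<lambda>k. (t * \<nu> * lap_bound TYPE('d)) ^ k / fact k * C))"
    by (rule norm_suminf_le[OF _ sums_summable[OF exp_terms_sums]])
       (use sgterm_bounded[OF assms] in auto)
  then show ?thesis using exp_terms_sums[THEN sums_unique] by (simp add: srw_semigroup_eq)
qed

lemma exp_tail_le:
  fixes x :: real assumes "0 \<le> x"
  shows "(\<lambda>k. x ^ (k + 2) / fact (k + 2) * C) sums ((exp x - 1 - x) * C)" 
    and "exp x - 1 - x \<le> x\<^sup>2 * exp x"
proof -
  show "(\<lambda>k. x ^ (k + 2) / fact (k + 2) * C) sums ((exp x - 1 - x) * C)" 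
    using sums_split_initial_segment[OF exp_terms_sums[of x C], of 2]
    by (simp add: numeral_2_eq_2 algebra_simps)
  have s: "(\<lambda>k. x ^ (k + 2) / fact (k + 2)) sums (exp x - 1 - x)"
    using sums_split_initial_segment[OF exp_terms_sums[of x 1], of 2]
    by (simp add: numeral_2_eq_2 algebra_simps)
  have s': "(\<lambda>k. x\<^sup>2 * (x ^ k / fact k)) sums (x\<^sup>2 * exp x)"
    using sums_mult[OF exp_terms_sums[of x 1], of "x\<^sup>2"] by simp
  show "exp x - 1 - x \<le> x\<^sup>2 * exp x"
  proof (rule sums_le[OF _ s s'])
    fix k
    have "(fact k :: real) \<le> fact (k + 2)" by (rule fact_mono) auto
    then have "x ^ (k + 2) / fact (k + 2) \<le> x ^ (k + 2) / fact k"
      using assms by (intro divide_left_mono) auto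
    then show "x ^ (k + 2) / fact (k + 2) \<le> x\<^sup>2 * (x ^ k / fact k)"
      by (simp add: power_add power2_eq_square mult_ac)
  qed
qed

text \<open>Taylor expansion of the exponential series with a remainder uniform in \<open>x\<close>;
  this is the consistency estimate behind the product formula.\<close>

lemma srw_semigroup_second_order:
  fixes f :: "int ^ 'd \<Rightarrow> real"
  assumes "\<And>x. \<bar>f x\<bar> \<le> C" "0 \<le> t" "0 \<le> \<nu>"
  defines "b \<equiv> t * \<nu> * lap_bound TYPE('d)"
  shows "\<bar>srw_semigroup \<nu> t f x - f x - t * (\<nu> * laplacian f x)\<bar> \<le> b\<^sup>2 * exp b * C"
proof -
  have b: "0 \<le> b" using assms by (simp add: b_def lap_bound_nonneg)
  have C: "0 \<le> C" using assms(1)[of 0] by linarith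
  have sm: "summable (\<lambda>k. sgterm \<nu> t k f x)" by (rule summable_sgterm[OF assms(1-3)])
  have "srw_semigroup \<nu> t f x - f x - t * (\<nu> * laplacian f x) = (suminf (\<lambda>k. sgterm \<nu> t (k + 2) f x))"
    unfolding srw_semigroup_eq using suminf_split_initial_segment[OF sm, of 2]
    by (simp add: numeral_2_eq_2 sgterm_def)
  also have "\<bar>\<dots>\<bar> \<le> (suminf (\<lambda>k. b ^ (k + 2) / fact (k + 2) * C))"
    unfolding real_norm_def[symmetric]
    by (rule norm_suminf_le[OF _ sums_summable[OF exp_tail_le(1)[OF b]]])
       (simp only: real_norm_def b_def sgterm_bounded[OF assms(1-3)])
  also have "\<dots> = (exp b - 1 - b) * C"
    using exp_tail_le(1)[OF b, THEN sums_unique] by simp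
  also have "\<dots> \<le> b\<^sup>2 * exp b * C"
    by (intro mult_right_mono exp_tail_le(2) b C)
  finally show ?thesis .
qed

lemma srw_semigroup_scale:
  fixes f :: "int ^ 'd \<Rightarrow> real"
  assumes "\<And>x. \<bar>f x\<bar> \<le> C" "0 \<le> t" "0 \<le> \<nu>"
  shows "srw_semigroup \<nu> t (\<lambda>x. c * f x) x = c * srw_semigroup \<nu> t f x"
  unfolding srw_semigroup_eq suminf_mult[OF summable_sgterm[OF assms], symmetric]
  by (simp add: sgterm_def laplacian_pow_scale mult_ac)

lemma srw_semigroup_add:
  fixes f :: "int ^ 'd \<Rightarrow> real"
  assumes "\<And>x. \<bar>f x\<bar> \<le> C" "\<And>x. \<bar>g x\<bar> \<le> C'" "0 \<le> t" "0 \<le> \<nu>"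
  shows "srw_semigroup \<nu> t (\<lambda>x. f x + g x) x = srw_semigroup \<nu> t f x + srw_semigroup \<nu> t g x"
  unfolding srw_semigroup_eq suminf_add[OF summable_sgterm[OF assms(1,3,4)] summable_sgterm[OF assms(2-4)]]
  by (simp add: sgterm_def laplacian_pow_add distrib_left)

lemma srw_semigroup_sum:
  fixes x :: "int ^ 'd"
  assumes "finite A" "0 \<le> t" "0 \<le> \<nu>"
  shows "srw_semigroup \<nu> t (\<lambda>x. \<Sum>z\<in>A. \<phi> z * indicator {z} x) x = (\<Sum>z\<in>A. \<phi> z * srw_transition \<nu> t x z)"
  using assms(1)
proof (induction A)
  case empty
  show ?case using srw_semigroup_scale[of "\<lambda>_. 0" 0 t \<nu> 0 x] assms by simp
next
  case (insert z A)
  have b: "\<bar>\<phi> z * indicator {z} x\<bar> \<le> \<bar>\<phi> z\<bar>" for z and x :: "int ^ 'd"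
    by (auto simp: indicator_def)
  have "\<bar>\<Sum>z\<in>A. \<phi> z * indicator {z} x\<bar> \<le> (\<Sum>z\<in>A. \<bar>\<phi> z\<bar>)" for x :: "int ^ 'd"
    using b by (intro order_trans[OF sum_abs] sum_mono) auto
  then have "srw_semigroup \<nu> t (\<lambda>x. \<phi> z * indicator {z} x + (\<Sum>z\<in>A. \<phi> z * indicator {z} x)) x
     = srw_semigroup \<nu> t (\<lambda>x. \<phi> z * indicator {z} x) x + srw_semigroup \<nu> t (\<lambda>x. \<Sum>z\<in>A. \<phi> z * indicator {z} x) x"
    by (intro srw_semigroup_add[OF b _ assms(2,3)])
  also have "srw_semigroup \<nu> t (\<lambda>x. \<phi> z * indicator {z} x) x = \<phi> z * srw_transition \<nu> t x z"
    unfolding srw_transition_def by (rule srw_semigroup_scale[of _ 1]) (use assms in \<open>auto simp: indicator_def\<close>)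
  finally show ?case unfolding insert.IH by (simp only: sum.insert[OF insert(1,2)])
qed

lemma laplacian_reflect: "laplacian (\<lambda>z. f (w - z)) = (\<lambda>z. laplacian f (w - z))"
proof
  fix z
  have "laplacian (\<lambda>z. f (w - z)) z = (\<Sum>v\<in>unit_steps. f (w - z - v) - f (w - z))"
    by (simp add: laplacian_eq diff_diff_eq)
  also have "\<dots> = (\<Sum>v\<in>unit_steps. f (w - z + v) - f (w - z))"
    by (rule sum.reindex_bij_witness[of _ uminus uminus]) (auto simp: uminus_unit_steps)
  finally show "laplacian (\<lambda>z. f (w - z)) z = laplacian f (w - z)" by (simp add: laplacian_eq)
qed

text \<open>The reflection of the lattice that exchanges \<open>x\<close> and \<open>y\<close>
  commutes with the Laplacian. This symmetry of the kernel is what allows the catalysts to be run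
  backwards in time.\<close>

lemma srw_transition_commute: "srw_transition \<nu> t x y = srw_transition \<nu> t y x"
proof -
  have "(laplacian ^^ k) (\<lambda>z. f (w - z)) = (\<lambda>z. (laplacian ^^ k) f (w - z))" for f :: "int ^ 'a \<Rightarrow> real" and w k
    by (induction k) (auto simp: laplacian_reflect)
  from this[where f = "indicator {y}" and w = "x + y"]
  have "(laplacian ^^ k) (\<lambda>z. indicator {y} (x + y - z)) y = (laplacian ^^ k) (indicator {y} :: _ \<Rightarrow> real) x" for k
    by simp
  moreover have "(\<lambda>z. indicator {y} (x + y - z)) = (indicator {x} :: _ \<Rightarrow> real)"
    by (auto simp: indicator_def fun_eq_iff algebra_simps)
  ultimately have "(laplacian ^^ k) (indicator {x}) y = (laplacian ^^ k) (indicator {y} :: _ \<Rightarrow> real) x" for k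
    by simp
  then show ?thesis by (simp add: srw_transition_def srw_semigroup_def)
qed

text \<open>Bounded pointwise convergence suffices: each power of the Laplacian at a point is a
  finite sum of values, and Tannery's theorem is dominated convergence for the exponential
  series.\<close>

lemma srw_semigroup_tendsto:
  fixes f :: "nat \<Rightarrow> int ^ 'd \<Rightarrow> real"
  assumes "\<And>n x. \<bar>f n x\<bar> \<le> C" "0 \<le> t" "0 \<le> \<nu>" and lim: "\<And>x. (\<lambda>n. f n x) \<longlonglongrightarrow> g x"
  shows "(\<lambda>n. srw_semigroup \<nu> t (f n) x) \<longlonglongrightarrow> srw_semigroup \<nu> t g x"
proof -
  have lap: "(\<lambda>n. (laplacian ^^ k) (f n) x) \<longlonglongrightarrow> (laplacian ^^ k) g x" for k x
    by (induction k arbitrary: x) (auto simp: lim laplacian_eq intro!: tendsto_sum tendsto_diff)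
  have "(\<lambda>n. (suminf (\<lambda>k. sgterm \<nu> t k (f n) x))) \<longlonglongrightarrow> (suminf (\<lambda>k. sgterm \<nu> t k g x))"
  proof (rule conjunct2[OF conjunct2[OF tannerys_theorem[where M = "\<lambda>k. (t * \<nu> * lap_bound TYPE('d)) ^ k / fact k * C"]]])
    show "(\<lambda>n. sgterm \<nu> t k (f n) x) \<longlonglongrightarrow> sgterm \<nu> t k g x" for k
      unfolding sgterm_def by (intro tendsto_intros lap)
    show "\<forall>\<^sub>F (k, n) in at_top \<times>\<^sub>F sequentially. norm (sgterm \<nu> t k (f n) x) \<le> (t * \<nu> * lap_bound TYPE('d)) ^ k / fact k * C"
      using sgterm_bounded[OF assms(1-3)] by (intro always_eventually) auto
    show "summable (\<lambda>k. (t * \<nu> * lap_bound TYPE('d)) ^ k / fact k * C)"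
      by (rule sums_summable[OF exp_terms_sums])
  qed simp
  then show ?thesis by (simp add: srw_semigroup_eq)
qed

lemma (in prob_space) laplacian_pow_expectation:
  fixes F :: "'a \<Rightarrow> int ^ 'd \<Rightarrow> real"
  assumes F [measurable]: "\<And>x. (\<lambda>\<omega>. F \<omega> x) \<in> borel_measurable M" and b: "\<And>\<omega> x. \<bar>F \<omega> x\<bar> \<le> C"
  shows "(\<lambda>\<omega>. (laplacian ^^ k) (F \<omega>) x) \<in> borel_measurable M"
    and "(laplacian ^^ k) (\<lambda>x. expectation (\<lambda>\<omega>. F \<omega> x)) x = expectation (\<lambda>\<omega>. (laplacian ^^ k) (F \<omega>) x)"
proof -
  have m [measurable]: "(\<lambda>\<omega>. (laplacian ^^ k) (F \<omega>) x) \<in> borel_measurable M" for k x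
    by (induction k arbitrary: x) (auto simp: laplacian_eq)
  have i: "integrable M (\<lambda>\<omega>. (laplacian ^^ k) (F \<omega>) x)" for k x
    by (rule integrable_const_bound[of _ "lap_bound TYPE('d) ^ k * C"])
       (use laplacian_pow_bounded[of "F _", OF b] in auto)
  show "(\<lambda>\<omega>. (laplacian ^^ k) (F \<omega>) x) \<in> borel_measurable M" by simp
  show "(laplacian ^^ k) (\<lambda>x. expectation (\<lambda>\<omega>. F \<omega> x)) x = expectation (\<lambda>\<omega>. (laplacian ^^ k) (F \<omega>) x)"
    by (induction k arbitrary: x) (auto simp: laplacian_eq i)
qed

text \<open>The semigroup series is dominated by an exponential series uniformly in \<omega>, so it
  may be integrated term by term.\<close>

lemma (in prob_space) srw_semigroup_expectation:
  fixes F :: "'a \<Rightarrow> int ^ 'd \<Rightarrow> real"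
  assumes F [measurable]: "\<And>x. (\<lambda>\<omega>. F \<omega> x) \<in> borel_measurable M" and b: "\<And>\<omega> x. \<bar>F \<omega> x\<bar> \<le> C"
    and t: "0 \<le> t" "0 \<le> \<nu>"
  shows "(\<lambda>\<omega>. srw_semigroup \<nu> t (F \<omega>) x) \<in> borel_measurable M"
    and "srw_semigroup \<nu> t (\<lambda>x. expectation (\<lambda>\<omega>. F \<omega> x)) x = expectation (\<lambda>\<omega>. srw_semigroup \<nu> t (F \<omega>) x)"
proof -
  have m [measurable]: "(\<lambda>\<omega>. sgterm \<nu> t k (F \<omega>) x) \<in> borel_measurable M" for k
    unfolding sgterm_def using laplacian_pow_expectation(1)[OF F b] by measurable
  then show "(\<lambda>\<omega>. srw_semigroup \<nu> t (F \<omega>) x) \<in> borel_measurable M"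
    unfolding srw_semigroup_eq by measurable
  let ?B = "\<lambda>k. (t * \<nu> * lap_bound TYPE('d)) ^ k / fact k * C"
  have sb: "\<bar>sgterm \<nu> t k (F \<omega>) x\<bar> \<le> ?B k" for k \<omega>
    by (rule sgterm_bounded[OF b t])
  have i: "integrable M (\<lambda>\<omega>. sgterm \<nu> t k (F \<omega>) x)" for k
    by (rule integrable_const_bound[of _ "?B k"]) (use sb in auto)
  have "expectation (\<lambda>\<omega>. suminf (\<lambda>k. sgterm \<nu> t k (F \<omega>) x)) = (suminf (\<lambda>k. expectation (\<lambda>\<omega>. sgterm \<nu> t k (F \<omega>) x)))"
  proof (rule integral_suminf[OF i])
    show "AE \<omega> in M. summable (\<lambda>k. norm (sgterm \<nu> t k (F \<omega>) x))"
      by (intro AE_I2 summable_comparison_test'[OF sums_summable[OF exp_terms_sums]]) (use sb in auto)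
    have "expectation (\<lambda>\<omega>. \<bar>sgterm \<nu> t k (F \<omega>) x\<bar>) \<le> ?B k" for k
      using integral_mono[of M "\<lambda>\<omega>. \<bar>sgterm \<nu> t k (F \<omega>) x\<bar>" "\<lambda>_. ?B k"] i sb by (simp add: prob_space)
    then show "summable (\<lambda>k. expectation (\<lambda>\<omega>. norm (sgterm \<nu> t k (F \<omega>) x)))"
      by (intro summable_comparison_test'[OF sums_summable[OF exp_terms_sums]]) auto
  qed
  then show "srw_semigroup \<nu> t (\<lambda>x. expectation (\<lambda>\<omega>. F \<omega> x)) x = expectation (\<lambda>\<omega>. srw_semigroup \<nu> t (F \<omega>) x)"
    unfolding srw_semigroup_eq
    by (simp add: sgterm_def laplacian_pow_expectation(2)[OF F b])
qed

section \<open>One-step operators, their generators and the product formula\<close>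

text \<open>First-order consistency \<open>T s = 1 + s L + O(s\<^sup>2)\<close> in the supremum
  norm, with \<open>L\<close> bounded and additive. \<open>T\<close> need not be a semigroup, so the
  notion is stable under composition of factors that do not commute.\<close>

definition generated_by :: "(real \<Rightarrow> ('s \<Rightarrow> real) \<Rightarrow> 's \<Rightarrow> real) \<Rightarrow> (('s \<Rightarrow> real) \<Rightarrow> 's \<Rightarrow> real) \<Rightarrow> bool"
  where "generated_by T L \<longleftrightarrow>
    (\<exists>B\<ge>0. \<forall>f C. (\<forall>a. \<bar>f a\<bar> \<le> C) \<longrightarrow> (\<forall>a. \<bar>L f a\<bar> \<le> B * C)) \<and>
    (\<forall>f g a. L (\<lambda>a. f a - g a) a = L f a - L g a) \<and>
    (\<exists>K\<ge>0. \<forall>s f C. 0 \<le> s \<and> s \<le> 1 \<and> (\<forall>a. \<bar>f a\<bar> \<le> C) \<longrightarrow> (\<forall>a. \<bar>T s f a - f a - s * L f a\<bar> \<le> K * s\<^sup>2 * C))"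

lemma generated_byE:
  assumes "generated_by T L"
  obtains B K where "0 \<le> B" "0 \<le> K"
    "\<forall>f C. (\<forall>a. \<bar>f a\<bar> \<le> C) \<longrightarrow> (\<forall>a. \<bar>L f a\<bar> \<le> B * C)"
    "\<forall>f g a. L (\<lambda>a. f a - g a) a = L f a - L g a"
    "\<forall>s f C. 0 \<le> s \<longrightarrow> s \<le> 1 \<longrightarrow> (\<forall>a. \<bar>f a\<bar> \<le> C) \<longrightarrow>
      (\<forall>a. \<bar>T s f a - f a - s * L f a\<bar> \<le> K * s\<^sup>2 * C)"
  using assms unfolding generated_by_def by blast

text \<open>The error consists of the second-order errors of the two factors and of
  \<open>s * (L1 (T2 s f) - L1 f)\<close>, which is of second order because
  \<open>T2 s f - f\<close> is of order \<open>s\<close>. The three summands of \<open>K\<close> are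
  these contributions.\<close>

lemma generated_by_comp:
  assumes "generated_by T1 L1" "generated_by T2 L2"
  shows "generated_by (\<lambda>s f. T1 s (T2 s f)) (\<lambda>f a. L1 f a + L2 f a)"
proof -
  obtain B1 K1 where raw1: "0 \<le> B1" "0 \<le> K1"
    "\<forall>f C. (\<forall>a. \<bar>f a\<bar> \<le> C) \<longrightarrow> (\<forall>a. \<bar>L1 f a\<bar> \<le> B1 * C)"
    "\<forall>f g a. L1 (\<lambda>a. f a - g a) a = L1 f a - L1 g a"
    "\<forall>s f C. 0 \<le> s \<longrightarrow> s \<le> 1 \<longrightarrow> (\<forall>a. \<bar>f a\<bar> \<le> C) \<longrightarrow>
      (\<forall>a. \<bar>T1 s f a - f a - s * L1 f a\<bar> \<le> K1 * s\<^sup>2 * C)"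
    by (rule generated_byE[OF assms(1)])
  note 1 = raw1[rule_format]
  obtain B2 K2 where raw2: "0 \<le> B2" "0 \<le> K2"
    "\<forall>f C. (\<forall>a. \<bar>f a\<bar> \<le> C) \<longrightarrow> (\<forall>a. \<bar>L2 f a\<bar> \<le> B2 * C)"
    "\<forall>f g a. L2 (\<lambda>a. f a - g a) a = L2 f a - L2 g a"
    "\<forall>s f C. 0 \<le> s \<longrightarrow> s \<le> 1 \<longrightarrow> (\<forall>a. \<bar>f a\<bar> \<le> C) \<longrightarrow>
      (\<forall>a. \<bar>T2 s f a - f a - s * L2 f a\<bar> \<le> K2 * s\<^sup>2 * C)"
    by (rule generated_byE[OF assms(2)])
  note 2 = raw2[rule_format]
  define K where "K = K1 * (1 + B2 + K2) + K2 + B1 * (B2 + K2)"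
  have "\<bar>T1 s (T2 s f) a - f a - s * (L1 f a + L2 f a)\<bar> \<le> K * s\<^sup>2 * C"
    if s: "0 \<le> s" "s \<le> 1" and f: "\<And>a. \<bar>f a\<bar> \<le> C" for s f C a
  proof -
    let ?g = "T2 s f"
    have C: "0 \<le> C" using f[of a] by linarith
    have s2: "s\<^sup>2 \<le> s" using s by (simp add: power2_eq_square mult_left_le)
    have gf: "\<bar>?g a - f a\<bar> \<le> s * (B2 + K2) * C" for a
    proof -
      have "\<bar>s * L2 f a\<bar> \<le> s * (B2 * C)" using s 2(3)[of f C a, OF f] by (simp add: abs_mult mult_left_mono)
      moreover have "K2 * s\<^sup>2 * C \<le> K2 * s * C" using s2 2 C by (intro mult_right_mono mult_left_mono) auto
      ultimately have "\<bar>?g a - f a\<bar> \<le> s * (B2 * C) + K2 * s * C"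
        using 2(5)[of s f C a, OF s f] by linarith
      then show ?thesis by (simp add: algebra_simps)
    qed
    have g: "\<bar>?g a\<bar> \<le> (1 + B2 + K2) * C" for a
    proof -
      have "s * (B2 + K2) * C \<le> 1 * (B2 + K2) * C" using s 2 C by (intro mult_right_mono) auto
      then show ?thesis using gf[of a] f[of a] by (simp add: algebra_simps)
    qed
    have e1: "\<bar>T1 s ?g a - ?g a - s * L1 ?g a\<bar> \<le> K1 * s\<^sup>2 * ((1 + B2 + K2) * C)"
      by (rule 1(5)[of s ?g _ a, OF s g])
    have e2: "\<bar>?g a - f a - s * L2 f a\<bar> \<le> K2 * s\<^sup>2 * C" by (rule 2(5)[of s f C a, OF s f])
    have "\<bar>L1 (\<lambda>a. ?g a - f a) a\<bar> \<le> B1 * (s * (B2 + K2) * C)" by (rule 1(3)[of "\<lambda>a. ?g a - f a" _ a, OF gf])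
    then have "s * \<bar>L1 ?g a - L1 f a\<bar> \<le> s * (B1 * (s * (B2 + K2) * C))"
      using s by (intro mult_left_mono) (simp_all add: 1(4))
    then have e3: "\<bar>s * (L1 ?g a - L1 f a)\<bar> \<le> s\<^sup>2 * (B1 * ((B2 + K2) * C))"
      using s by (simp add: abs_mult power2_eq_square mult_ac)
    have "\<bar>T1 s ?g a - f a - s * (L1 f a + L2 f a)\<bar>
       = \<bar>(T1 s ?g a - ?g a - s * L1 ?g a) + (?g a - f a - s * L2 f a) + s * (L1 ?g a - L1 f a)\<bar>"
      by (simp add: algebra_simps)
    also have "\<dots> \<le> K1 * s\<^sup>2 * ((1 + B2 + K2) * C) + K2 * s\<^sup>2 * C + s\<^sup>2 * (B1 * ((B2 + K2) * C))"
      using e1 e2 e3 by linarith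
    finally show ?thesis by (simp add: K_def algebra_simps)
  qed
  moreover have "0 \<le> K" using 1 2 by (simp add: K_def)
  moreover have "\<bar>L1 f a + L2 f a\<bar> \<le> (B1 + B2) * C" if "\<And>a. \<bar>f a\<bar> \<le> C" for f C a
    using 1(3)[of f C a, OF that] 2(3)[of f C a, OF that] by (simp add: distrib_right)
  moreover have "0 \<le> B1 + B2" using 1 2 by simp
  ultimately show ?thesis
    unfolding generated_by_def
    by (intro conjI exI[of _ "B1 + B2"] exI[of _ K]) (auto simp: 1(4) 2(4))
qed

lemma generated_by_id: "generated_by (\<lambda>s f. f) (\<lambda>f a. 0)"
  unfolding generated_by_def by auto

lemma generated_by_exp:
  fixes V :: "'s \<Rightarrow> real"
  assumes "\<And>a. 0 \<le> V a" "\<And>a. V a \<le> v"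
  shows "generated_by (\<lambda>s f a. exp (s * V a) * f a) (\<lambda>f a. V a * f a)"
proof -
  have v: "0 \<le> v" using assms order_trans by blast
  have "\<bar>exp (s * V a) * f a - f a - s * (V a * f a)\<bar> \<le> (v\<^sup>2 * exp v) * s\<^sup>2 * C"
    if s: "0 \<le> s" "s \<le> 1" and f: "\<And>a. \<bar>f a\<bar> \<le> C" for s f C a
  proof -
    let ?x = "s * V a"
    have x: "0 \<le> ?x" "?x \<le> s * v" using s assms by (auto intro: mult_left_mono)
    have xv: "s * v \<le> v" using mult_right_mono[OF s(2) v] by simp
    have "exp ?x - 1 - ?x \<le> ?x\<^sup>2 * exp ?x" by (rule exp_tail_le(2)[OF x(1)])
    also have "\<dots> \<le> (s * v)\<^sup>2 * exp v"
    proof (intro mult_mono)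
      show "?x\<^sup>2 \<le> (s * v)\<^sup>2" by (rule power_mono[OF x(2,1)])
      show "exp ?x \<le> exp v" unfolding exp_le_cancel_iff using x xv by linarith
    qed auto
    finally have "exp ?x - 1 - ?x \<le> v\<^sup>2 * exp v * s\<^sup>2" by (simp add: power_mult_distrib mult_ac)
    then have "\<bar>exp ?x - 1 - ?x\<bar> \<le> v\<^sup>2 * exp v * s\<^sup>2"
      using exp_ge_add_one_self[of ?x] by linarith
    then have "\<bar>exp ?x - 1 - ?x\<bar> * \<bar>f a\<bar> \<le> v\<^sup>2 * exp v * s\<^sup>2 * C"
      using f[of a] by (intro mult_mono) auto
    moreover have "exp ?x * f a - f a - s * (V a * f a) = (exp ?x - 1 - ?x) * f a"
      by (simp add: algebra_simps)
    ultimately show ?thesis by (simp only: abs_mult)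
  qed
  moreover have "\<bar>V a * f a\<bar> \<le> v * C" if "\<And>a. \<bar>f a\<bar> \<le> C" for f C a
    unfolding abs_mult using assms that by (intro mult_mono) (auto simp: abs_of_nonneg v)
  ultimately show ?thesis
    unfolding generated_by_def using v
    by (intro conjI exI[of _ v] exI[of _ "v\<^sup>2 * exp v"]) (auto simp: algebra_simps)
qed

definition coord_sg :: "('i \<Rightarrow> real) \<Rightarrow> 'i \<Rightarrow> real \<Rightarrow> (('i \<Rightarrow> int ^ 'd) \<Rightarrow> real) \<Rightarrow> ('i \<Rightarrow> int ^ 'd) \<Rightarrow> real"
  where "coord_sg \<nu> i s f a = srw_semigroup (\<nu> i) s (\<lambda>z. f (a(i := z))) (a i)"

definition coord_lap :: "'i \<Rightarrow> (('i \<Rightarrow> int ^ 'd) \<Rightarrow> real) \<Rightarrow> ('i \<Rightarrow> int ^ 'd) \<Rightarrow> real"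
  where "coord_lap i f a = laplacian (\<lambda>z. f (a(i := z))) (a i)"

lemma generated_by_coord_sg:
  fixes \<nu> :: "'i \<Rightarrow> real"
  assumes "0 \<le> \<nu> i"
  shows "generated_by (coord_sg \<nu> i) (\<lambda>f (a :: 'i \<Rightarrow> int ^ 'd). \<nu> i * coord_lap i f a)"
proof -
  define b where "b = \<nu> i * lap_bound TYPE('d)"
  have b: "0 \<le> b" using assms by (simp add: b_def lap_bound_nonneg)
  have "\<bar>coord_sg \<nu> i s f a - f a - s * (\<nu> i * coord_lap i f a)\<bar> \<le> (b\<^sup>2 * exp b) * s\<^sup>2 * C"
    if s: "0 \<le> s" "s \<le> 1" and f: "\<And>a. \<bar>f a\<bar> \<le> C" for s C and f :: "('i \<Rightarrow> int ^ 'd) \<Rightarrow> real" and a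
  proof -
    have C: "0 \<le> C" using f[of a] by linarith
    have "\<bar>coord_sg \<nu> i s f a - f a - s * (\<nu> i * coord_lap i f a)\<bar> \<le> (s * b)\<^sup>2 * exp (s * b) * C"
      using srw_semigroup_second_order[of "\<lambda>z. f (a(i := z))" C s "\<nu> i" "a i"] f s assms
      by (simp add: coord_sg_def coord_lap_def b_def mult.assoc)
    also have "\<dots> \<le> (s * b)\<^sup>2 * exp b * C"
      using s b mult_right_mono[OF s(2) b] C by (intro mult_right_mono mult_left_mono) auto
    finally show ?thesis by (simp add: power_mult_distrib mult_ac)
  qed
  moreover have "\<bar>\<nu> i * coord_lap i f a\<bar> \<le> b * C" if "\<And>a. \<bar>f a\<bar> \<le> C" for C and f :: "('i \<Rightarrow> int ^ 'd) \<Rightarrow> real" and a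
    using laplacian_bounded[of "\<lambda>z. f (a(i := z))" C "a i"] that assms
    by (simp add: coord_lap_def b_def abs_mult mult.assoc mult_left_mono)
  moreover have "\<nu> i * coord_lap i (\<lambda>a. f a - g a) a = \<nu> i * coord_lap i f a - \<nu> i * coord_lap i g a"
    for f g :: "('i \<Rightarrow> int ^ 'd) \<Rightarrow> real" and a
  proof -
    have "coord_lap i (\<lambda>a. f a - g a) a = coord_lap i f a - coord_lap i g a"
      by (simp add: coord_lap_def laplacian_eq sum_subtractf[symmetric] algebra_simps)
    then show ?thesis by (simp add: right_diff_distrib)
  qed
  ultimately show ?thesis
    unfolding generated_by_def using b
    by (intro conjI exI[of _ b] exI[of _ "b\<^sup>2 * exp b"]) auto
qed

definition all_sg :: "('i \<Rightarrow> real) \<Rightarrow> 'i list \<Rightarrow> real \<Rightarrow> (('i \<Rightarrow> int ^ 'd) \<Rightarrow> real) \<Rightarrow> ('i \<Rightarrow> int ^ 'd) \<Rightarrow> real"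
  where "all_sg \<nu> il s = foldr (\<lambda>i. coord_sg \<nu> i s) il"

lemma all_sg_simps [simp]:
  "all_sg \<nu> [] s f = f" "all_sg \<nu> (i # il) s f = coord_sg \<nu> i s (all_sg \<nu> il s f)"
  by (simp_all add: all_sg_def)

lemma generated_by_all_sg:
  fixes \<nu> :: "'i \<Rightarrow> real"
  assumes "\<And>i. 0 \<le> \<nu> i"
  shows "generated_by (all_sg \<nu> il) (\<lambda>f (a :: 'i \<Rightarrow> int ^ 'd). \<Sum>i\<leftarrow>il. \<nu> i * coord_lap i f a)"
proof (induction il)
  case Nil
  have "all_sg \<nu> [] = (\<lambda>s (f :: ('i \<Rightarrow> int ^ 'd) \<Rightarrow> real). f)" by (auto simp: fun_eq_iff)
  then show ?case using generated_by_id by simp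
next
  case (Cons i il)
  have "all_sg \<nu> (i # il) = (\<lambda>s f. coord_sg \<nu> i s (all_sg \<nu> il s (f :: ('i \<Rightarrow> int ^ 'd) \<Rightarrow> real)))"
    by (auto simp: fun_eq_iff)
  then show ?case using generated_by_comp[OF generated_by_coord_sg[of \<nu> i, OF assms] Cons] by simp
qed

lemma coord_sg_bounded:
  fixes f :: "('i \<Rightarrow> int ^ 'd) \<Rightarrow> real"
  assumes "\<And>a. \<bar>f a\<bar> \<le> C" "0 \<le> s" "0 \<le> \<nu> i"
  shows "\<bar>coord_sg \<nu> i s f a\<bar> \<le> exp (s * \<nu> i * lap_bound TYPE('d)) * C"
  unfolding coord_sg_def by (rule srw_semigroup_bounded) (use assms in auto)

text \<open>\<open>S\<close> is the explicit Euler scheme for \<open>L\<close>. One step of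
  \<open>T\<close> and one of \<open>S\<close> differ by \<open>O(s\<^sup>2)\<close>, and both
  increase a supremum bound by a factor at most \<open>exp (s * D)\<close>, so that after
  \<open>m\<close> steps of size \<open>t / m\<close> the difference is \<open>O(1 / m)\<close>. The
  two schemes are compared directly, without naming a limit.\<close>

lemma Chernoff_product:
  assumes "generated_by T L" and f: "\<And>a. \<bar>f a\<bar> \<le> C" and t: "0 \<le> t"
    and S: "\<And>s f a. S s f a = f a + s * L f a"
  shows "(\<lambda>m. (T (t / real m) ^^ m) f a - (S (t / real m) ^^ m) f a) \<longlonglongrightarrow> 0"
proof -
  obtain B K where raw: "0 \<le> B" "0 \<le> K"
    "\<forall>f C. (\<forall>a. \<bar>f a\<bar> \<le> C) \<longrightarrow> (\<forall>a. \<bar>L f a\<bar> \<le> B * C)"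
    "\<forall>f g a. L (\<lambda>a. f a - g a) a = L f a - L g a"
    "\<forall>s f C. 0 \<le> s \<longrightarrow> s \<le> 1 \<longrightarrow> (\<forall>a. \<bar>f a\<bar> \<le> C) \<longrightarrow>
      (\<forall>a. \<bar>T s f a - f a - s * L f a\<bar> \<le> K * s\<^sup>2 * C)"
    by (rule generated_byE[OF assms(1)])
  note BK = raw[rule_format]
  have C: "0 \<le> C" using f[of a] by linarith
  define D where "D = B + K"
  have Sb: "\<bar>S s g a\<bar> \<le> exp (s * D) * c" if s: "0 \<le> s" and g: "\<And>a. \<bar>g a\<bar> \<le> c" for s g c a
  proof -
    have c: "0 \<le> c" using g[of a] by linarith
    have "\<bar>s * L g a\<bar> \<le> s * (B * c)" using s BK(3)[of g c a, OF g] by (simp add: abs_mult mult_left_mono)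
    then have "\<bar>S s g a\<bar> \<le> c + s * (B * c)" using g[of a] S[of s g a] by linarith
    also have "\<dots> \<le> (1 + s * D) * c" using BK s c by (simp add: D_def algebra_simps)
    also have "\<dots> \<le> exp (s * D) * c" using c by (intro mult_right_mono exp_ge_add_one_self)
    finally show ?thesis .
  qed
  have Tb: "\<bar>T s g a\<bar> \<le> exp (s * D) * c" if s: "0 \<le> s" "s \<le> 1" and g: "\<And>a. \<bar>g a\<bar> \<le> c" for s g c a
  proof -
    have c: "0 \<le> c" using g[of a] by linarith
    have "s\<^sup>2 \<le> s" using s by (simp add: power2_eq_square mult_left_le)
    then have "K * s\<^sup>2 * c \<le> K * s * c" using BK c by (intro mult_right_mono mult_left_mono) auto
    moreover have "\<bar>s * L g a\<bar> \<le> s * (B * c)" using s BK(3)[of g c a, OF g] by (simp add: abs_mult mult_left_mono)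
    ultimately have "\<bar>T s g a\<bar> \<le> c + s * (B * c) + K * s * c" using g[of a] BK(5)[of s g c a, OF s g] by linarith
    also have "\<dots> = (1 + s * D) * c" by (simp add: D_def algebra_simps)
    also have "\<dots> \<le> exp (s * D) * c" using c by (intro mult_right_mono exp_ge_add_one_self)
    finally show ?thesis .
  qed
  have exp_Suc: "exp x * exp (real k * x) = exp (real (Suc k) * x)" for x :: real and k
    by (simp add: mult_exp_exp distrib_right)
  have Tpow: "\<bar>(T s ^^ k) f a\<bar> \<le> exp (real k * (s * D)) * C" if s: "0 \<le> s" "s \<le> 1" for s k a
  proof (induction k arbitrary: a)
    case (Suc k)
    have "\<bar>T s ((T s ^^ k) f) a\<bar> \<le> exp (s * D) * (exp (real k * (s * D)) * C)" by (rule Tb[OF s Suc])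
    also have "\<dots> = exp (real (Suc k) * (s * D)) * C" 
      unfolding exp_Suc[symmetric] by (simp only: mult.assoc)
    finally show ?case by simp
  qed (use f in simp)
  have diff: "\<bar>(T s ^^ k) f a - (S s ^^ k) f a\<bar> \<le> k * K * s\<^sup>2 * exp (k * (s * D)) * C"
    if s: "0 \<le> s" "s \<le> 1" for s k a
  proof (induction k arbitrary: a)
    case (Suc k)
    let ?u = "(T s ^^ k) f" and ?v = "(S s ^^ k) f" and ?e = "exp (k * (s * D))"
    have "\<bar>T s ?u a - S s ?u a\<bar> \<le> K * s\<^sup>2 * (?e * C)"
      using BK(5)[of s "(T s ^^ k) f" _ a, OF s Tpow[OF s, of k]] by (simp add: S algebra_simps)
    also have "\<dots> \<le> K * s\<^sup>2 * (exp (s * D) * ?e * C)"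
      using BK s C one_le_exp_iff[of "s * D"] by (intro mult_left_mono mult_right_mono) (auto simp: D_def)
    finally have e1: "\<bar>T s ?u a - S s ?u a\<bar> \<le> K * s\<^sup>2 * (exp (s * D) * ?e * C)" .
    have "S s ?u a - S s ?v a = S s (\<lambda>a. ?u a - ?v a) a"
      by (simp add: S BK(4) algebra_simps)
    also have "\<bar>\<dots>\<bar> \<le> exp (s * D) * (k * K * s\<^sup>2 * ?e * C)"
      by (rule Sb[OF s(1) Suc])
    finally have "\<bar>T s ?u a - S s ?v a\<bar> \<le> K * s\<^sup>2 * (exp (s * D) * ?e * C) + exp (s * D) * (k * K * s\<^sup>2 * ?e * C)"
      using e1 by linarith
    also have "\<dots> = Suc k * K * s\<^sup>2 * (exp (s * D) * ?e) * C" by (simp add: algebra_simps)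
    also have "exp (s * D) * ?e = exp (Suc k * (s * D))" by (rule exp_Suc)
    finally show ?case by simp
  qed simp
  have "(\<lambda>m. K * t\<^sup>2 * exp (t * D) * C / real m) \<longlonglongrightarrow> 0"
    by (rule lim_const_over_n)
  then show ?thesis
  proof (rule Lim_null_comparison[rotated])
    show "\<forall>\<^sub>F m in sequentially. norm ((T (t / real m) ^^ m) f a - (S (t / real m) ^^ m) f a)
        \<le> K * t\<^sup>2 * exp (t * D) * C / real m"
      \<comment> \<open>The consistency estimate holds for step sizes up to 1, hence
        \<open>m \<ge> t\<close>.\<close>
      using eventually_ge_at_top[of "Suc (nat \<lceil>t\<rceil>)"]
    proof eventually_elim
      case (elim m)
      then have m: "real m > 0" "t \<le> m" by linarith+
      then have "0 \<le> t / m" "t / m \<le> 1" using t by auto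
      from diff[OF this, of m a] m show ?case
        by (simp add: power_divide power2_eq_square mult_ac)
    qed
  qed
qed

lemma (in prob_space) coord_sg_expectation:
  fixes F :: "'a \<Rightarrow> ('i \<Rightarrow> int ^ 'd) \<Rightarrow> real"
  assumes F [measurable]: "\<And>a. (\<lambda>\<omega>. F \<omega> a) \<in> borel_measurable M" and b: "\<And>\<omega> a. \<bar>F \<omega> a\<bar> \<le> C"
    and t: "0 \<le> t" "0 \<le> \<nu> i"
  shows "(\<lambda>\<omega>. coord_sg \<nu> i t (F \<omega>) a) \<in> borel_measurable M"
    and "coord_sg \<nu> i t (\<lambda>a. expectation (\<lambda>\<omega>. F \<omega> a)) a = expectation (\<lambda>\<omega>. coord_sg \<nu> i t (F \<omega>) a)"
  unfolding coord_sg_def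
  using srw_semigroup_expectation[of "\<lambda>\<omega> z. F \<omega> (a(i := z))" C t "\<nu> i" "a i"] assms by auto

lemma (in prob_space) all_sg_expectation:
  fixes F :: "'a \<Rightarrow> ('i \<Rightarrow> int ^ 'd) \<Rightarrow> real"
  assumes F [measurable]: "\<And>a. (\<lambda>\<omega>. F \<omega> a) \<in> borel_measurable M" and b: "\<And>\<omega> a. \<bar>F \<omega> a\<bar> \<le> C"
    and t: "0 \<le> t" "\<And>i. 0 \<le> \<nu> i"
  shows "(\<lambda>\<omega>. all_sg \<nu> il t (F \<omega>) a) \<in> borel_measurable M"
    and "all_sg \<nu> il t (\<lambda>a. expectation (\<lambda>\<omega>. F \<omega> a)) a = expectation (\<lambda>\<omega>. all_sg \<nu> il t (F \<omega>) a)"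
proof -
  have "(\<forall>a. (\<lambda>\<omega>. all_sg \<nu> il t (F \<omega>) a) \<in> borel_measurable M) \<and> (\<exists>C'. \<forall>\<omega> a. \<bar>all_sg \<nu> il t (F \<omega>) a\<bar> \<le> C') \<and>
    (\<forall>a. all_sg \<nu> il t (\<lambda>a. expectation (\<lambda>\<omega>. F \<omega> a)) a = expectation (\<lambda>\<omega>. all_sg \<nu> il t (F \<omega>) a))"
  proof (induction il)
    case Nil
    then show ?case using F b by auto
  next
    case (Cons i il)
    then obtain C' where C': "\<And>\<omega> a. \<bar>all_sg \<nu> il t (F \<omega>) a\<bar> \<le> C'" by blast
    have eq: "all_sg \<nu> il t (\<lambda>a. expectation (\<lambda>\<omega>. F \<omega> a)) = (\<lambda>a. expectation (\<lambda>\<omega>. all_sg \<nu> il t (F \<omega>) a))"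
      using Cons by auto
    have "\<And>\<omega> a. \<bar>coord_sg \<nu> i t (all_sg \<nu> il t (F \<omega>)) a\<bar> \<le> exp (t * \<nu> i * lap_bound TYPE('d)) * C'"
      using C' t by (intro coord_sg_bounded) auto
    moreover have "(\<lambda>\<omega>. coord_sg \<nu> i t (all_sg \<nu> il t (F \<omega>)) a) \<in> borel_measurable M" for a
      using Cons C' t by (intro coord_sg_expectation(1)[where C = C']) auto
    moreover have "coord_sg \<nu> i t (\<lambda>a. expectation (\<lambda>\<omega>. all_sg \<nu> il t (F \<omega>) a)) a
       = expectation (\<lambda>\<omega>. coord_sg \<nu> i t (all_sg \<nu> il t (F \<omega>)) a)" for a
      using Cons C' t by (intro coord_sg_expectation(2)[where C = C']) auto
    ultimately show ?case by (auto simp: eq)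
  qed
  then show "(\<lambda>\<omega>. all_sg \<nu> il t (F \<omega>) a) \<in> borel_measurable M"
    and "all_sg \<nu> il t (\<lambda>a. expectation (\<lambda>\<omega>. F \<omega> a)) a = expectation (\<lambda>\<omega>. all_sg \<nu> il t (F \<omega>) a)"
    by auto
qed

text \<open>Each coordinate semigroup acts on its own factor and treats the others as constants;
  factors of \<open>J\<close> not listed in \<open>il\<close> stay as they are.\<close>

lemma all_sg_prod:
  fixes h :: "'i \<Rightarrow> int ^ 'd \<Rightarrow> real"
  assumes "finite J" "distinct il" "set il \<subseteq> J" and h: "\<And>i z. \<bar>h i z\<bar> \<le> C" and t: "0 \<le> t" "\<And>i. 0 \<le> \<nu> i"
  shows "all_sg \<nu> il t (\<lambda>a. \<Prod>i\<in>J. h i (a i)) a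
    = (\<Prod>i\<in>J. if i \<in> set il then srw_semigroup (\<nu> i) t (h i) (a i) else h i (a i))"
  using assms(2,3)
proof (induction il arbitrary: a)
  case (Cons i il)
  define k where "k j z = (if j \<in> set il then srw_semigroup (\<nu> j) t (h j) z else h j z)" for j z
  have IH: "all_sg \<nu> il t (\<lambda>a. \<Prod>i\<in>J. h i (a i)) = (\<lambda>a. \<Prod>j\<in>J. k j (a j))"
    using Cons by (auto simp: k_def)
  have i: "i \<in> J" "i \<notin> set il" using Cons by auto
  have split: "(\<Prod>j\<in>J. k j ((a(i := z)) j)) = (\<Prod>j\<in>J - {i}. k j (a j)) * h i z" for z
    using i assms(1) by (subst prod.remove[of J i]) (auto simp: k_def intro!: prod.cong)
  have "all_sg \<nu> (i # il) t (\<lambda>a. \<Prod>i\<in>J. h i (a i)) a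
     = srw_semigroup (\<nu> i) t (\<lambda>z. (\<Prod>j\<in>J - {i}. k j (a j)) * h i z) (a i)"
    by (simp only: all_sg_simps IH coord_sg_def split)
  also have "\<dots> = (\<Prod>j\<in>J - {i}. k j (a j)) * srw_semigroup (\<nu> i) t (h i) (a i)"
    by (rule srw_semigroup_scale[OF h t])
  also have "\<dots> = (\<Prod>j\<in>J. if j \<in> set (i # il) then srw_semigroup (\<nu> j) t (h j) (a j) else h j (a j))"
    using i assms(1) by (subst prod.remove[of J i]) (auto simp: k_def mult.commute intro!: prod.cong)
  finally show ?case .
qed simp

section \<open>Riemann sums along the paths\<close>

text \<open>
  \<open>s \<mapsto> Y(t - s)\<close> is left-continuous while \<open>X\<close> is right-continuous, so only one-sided local constancy
  is available; the discontinuities are isolated, hence countable.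
\<close>

lemma Riemann_sum_tendsto:
  fixes h :: "real \<Rightarrow> real"
  assumes t: "0 < t"
    and left: "\<And>r. 0 < r \<Longrightarrow> r < t \<Longrightarrow> \<exists>l. \<forall>\<^sub>F s in at_left r. h s = l"
    and right: "\<And>r. 0 < r \<Longrightarrow> r < t \<Longrightarrow> \<exists>l. \<forall>\<^sub>F s in at_right r. h s = l"
    and bound: "\<And>r. \<bar>h r\<bar> \<le> C"
  shows "(\<lambda>m. \<Sum>i=1..m. t / real m * h (real i * (t / real m))) \<longlonglongrightarrow> (LINT r:{0..t}|lborel. h r)"
proof -
  have C: "0 \<le> C" using bound[of 0] by linarith
  \<comment> \<open>The points around which \<open>h\<close> is not constant. One-sided constancy
    isolates them from both sides within the open interval, so they are countably many
    there.\<close>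
  define D where "D = {r. \<not> (\<forall>\<^sub>F s in nhds r. h s = h r)}"
  have notin: "\<forall>\<^sub>F s in F. s \<notin> D" if "open S" "\<forall>\<^sub>F s in F. s \<in> S" "\<And>s. s \<in> S \<Longrightarrow> h s = l" for F S l
    using that(2)
  proof eventually_elim
    case (elim s)
    have "\<forall>\<^sub>F r in nhds s. r \<in> S" by (rule eventually_nhds_in_open[OF that(1) elim])
    then have "\<forall>\<^sub>F r in nhds s. h r = h s" by eventually_elim (use that(3) elim in auto)
    then show ?case by (simp add: D_def)
  qed
  have "D sparse_in {0<..<t}"
    unfolding sparse_in_eventually_iff[OF open_greaterThanLessThan] eventually_at_split
  proof (intro ballI conjI)
    fix r assume "r \<in> {0<..<t}"
    then have r: "0 < r" "r < t" by auto
    from left[OF r] obtain l b where b: "b < r" "\<And>s. b < s \<Longrightarrow> s < r \<Longrightarrow> h s = l"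
      unfolding eventually_at_left_field by blast
    show "\<forall>\<^sub>F s in at_left r. s \<notin> D"
      by (rule notin[of "{b<..<r}" _ l]) (use b eventually_at_left_field in \<open>auto\<close>)
    from right[OF r] obtain l b where b: "b > r" "\<And>s. r < s \<Longrightarrow> s < b \<Longrightarrow> h s = l"
      unfolding eventually_at_right_field by blast
    show "\<forall>\<^sub>F s in at_right r. s \<notin> D"
      by (rule notin[of "{r<..<b}" _ l]) (use b eventually_at_right_field in \<open>auto\<close>)
  qed
  then have "countable ({0<..<t} \<inter> D)" by (intro sparse_imp_countable) auto
  then have cD: "countable (({0<..<t} \<inter> D) \<union> {0, t})" (is "countable ?X") by simp
  \<comment> \<open>The Riemann sum is the integral of this step function, which takes on each cell
    the value of \<open>h\<close> at the right end.\<close>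
  define g where "g m r = (\<Sum>i=1..m. h (real i * (t / real m)) * indicator {real (i - 1) * (t / real m)<..real i * (t / real m)} r)" for m r
  have g_eq: "g m r = h (of_int \<lceil>r * m / t\<rceil> * (t / m))" if r: "0 < r" "r \<le> t" and m: "m > 0" for m r
  proof -
    define k where "k = nat \<lceil>r * m / t\<rceil>"
    have pos: "0 < r * m / t" using r m t by simp
    have "r * m / t \<le> m" using r m t by (simp add: field_simps)
    then have k: "k \<in> {1..m}" "real k = of_int \<lceil>r * m / t\<rceil>" using pos by (auto simp: k_def) linarith+
    have "indicator {real (i - 1) * (t / real m)<..real i * (t / real m)} r = (if i = k then 1 else 0 :: real)" if "i \<in> {1..m}" for i
    proof -
      have "(real (i - 1) * (t / real m) < r \<and> r \<le> real i * (t / real m)) \<longleftrightarrow> (real (i - 1) < r * m / t \<and> r * m / t \<le> real i)"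
        using t m by (simp add: field_simps)
      also have "\<dots> \<longleftrightarrow> \<lceil>r * m / t\<rceil> = int i" using that by (auto simp: ceiling_eq_iff of_nat_diff)
      also have "\<dots> \<longleftrightarrow> i = k" using k by (metis nat_int k_def of_int_of_nat_eq of_int_eq_iff)
      finally show ?thesis by (auto simp: indicator_def)
    qed
    then have "g m r = (\<Sum>i=1..m. if i = k then h (real i * (t / real m)) else 0)"
      unfolding g_def by (intro sum.cong) auto
    then show ?thesis using k by (simp add: sum.delta')
  qed
  have g_0: "g m r = 0" if "\<not> (0 < r \<and> r \<le> t)" for m r
    unfolding g_def
  proof (intro sum.neutral ballI)
    fix i assume i: "i \<in> {1..m}"
    have "real i * (t / m) \<le> t" using i t by (simp add: field_simps)
    moreover have "0 \<le> real (i - 1) * (t / m)" using t by simp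
    ultimately show "h (real i * (t / real m)) * indicator {real (i - 1) * (t / real m)<..real i * (t / real m)} r = 0"
      using that by (auto simp: indicator_def simp del: of_nat_diff)
  qed
  have lim: "(\<lambda>m. g m r) \<longlonglongrightarrow> indicator {0..t} r * h r" if "r \<notin> ?X" for r
  proof (cases "0 < r \<and> r < t")
    case True
    have "(\<lambda>m. of_int \<lceil>r * real m / t\<rceil> * (t / real m)) \<longlonglongrightarrow> r"
    proof (rule tendsto_sandwich[where f = "\<lambda>m. r" and h = "\<lambda>m. r + t / real m"])
      show "\<forall>\<^sub>F m in sequentially. r \<le> of_int \<lceil>r * real m / t\<rceil> * (t / real m)"
        using eventually_gt_at_top[of 0]
      proof eventually_elim
        case (elim m)
        have "r = (r * m / t) * (t / m)" using elim t by simp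
        also have "\<dots> \<le> of_int \<lceil>r * real m / t\<rceil> * (t / real m)" using t by (intro mult_right_mono) auto
        finally show ?case .
      qed
      show "\<forall>\<^sub>F m in sequentially. of_int \<lceil>r * real m / t\<rceil> * (t / real m) \<le> r + t / real m"
        using eventually_gt_at_top[of 0]
      proof eventually_elim
        case (elim m)
        have "of_int \<lceil>r * real m / t\<rceil> * (t / real m) \<le> (r * m / t + 1) * (t / m)" using t by (intro mult_right_mono) auto
        also have "\<dots> = r + t / m" using elim t by (simp add: field_simps)
        finally show ?case .
      qed
      have "(\<lambda>m. t / real m) \<longlonglongrightarrow> 0" by (rule lim_const_over_n)
      then show "(\<lambda>m. r + t / real m) \<longlonglongrightarrow> r" using tendsto_add[OF tendsto_const] by fastforce
    qed simp
    moreover have "\<forall>\<^sub>F s in nhds r. h s = h r" using that True by (auto simp: D_def)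
    ultimately have "\<forall>\<^sub>F m in sequentially. h (of_int \<lceil>r * real m / t\<rceil> * (t / real m)) = h r"
      by (rule eventually_compose_filterlim[rotated])
    then have "\<forall>\<^sub>F m in sequentially. g m r = h r"
      using eventually_gt_at_top[of 0] by eventually_elim (use g_eq True in auto)
    then show ?thesis using True by (simp add: tendsto_eventually)
  next
    case False
    then have "\<not> (0 < r \<and> r \<le> t)" "r \<notin> {0..t}" using that by auto
    then show ?thesis using g_0[of r] by simp
  qed
  have gm [measurable]: "g m \<in> borel_measurable borel" for m
    unfolding g_def by measurable
  \<comment> \<open>\<open>h\<close> is not known to be measurable beforehand; outside the countable
    set \<open>?X\<close> the cut-off function is a limit of measurable step functions.\<close>
  have fm: "(\<lambda>r. indicator {0..t} r * h r) \<in> borel_measurable lborel"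
  proof (rule measurable_discrete_difference[where X = ?X])
    show "(\<lambda>r. lim (\<lambda>m. g m r)) \<in> borel_measurable lborel" by measurable
    show "lim (\<lambda>m. g m r) = indicator {0..t} r * h r" if "r \<notin> ?X" for r
      using lim[OF that] by (rule limI)
  qed (use cD in auto)
  have AE: "AE r in lborel. r \<notin> ?X"
    by (rule AE_not_in[OF countable_imp_null_set_lborel[OF cD]])
  have "(\<lambda>m. integral\<^sup>L lborel (g m)) \<longlonglongrightarrow> integral\<^sup>L lborel (\<lambda>r. indicator {0..t} r * h r)"
  proof (rule integral_dominated_convergence[where w = "\<lambda>r. C * indicator {0..t} r"])
    show "AE r in lborel. (\<lambda>m. g m r) \<longlonglongrightarrow> indicator {0..t} r * h r"
      using AE by eventually_elim (rule lim)
    show "AE r in lborel. norm (g m r) \<le> C * indicator {0..t} r" for m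
    proof (rule AE_I2)
      fix r
      show "norm (g m r) \<le> C * indicator {0..t} r"
      proof (cases "0 < r \<and> r \<le> t \<and> m > 0")
        case True
        then show ?thesis using g_eq[of r m] bound by auto
      next
        case False
        then have "g m r = 0" using g_0[of r m] by (cases "m = 0") (auto simp: g_def)
        then show ?thesis using C by (simp add: indicator_def)
      qed
    qed
    show "integrable lborel (\<lambda>r. C * indicator {0..t} r)"
      by (intro integrable_mult_right integrable_real_indicator) (auto simp: emeasure_lborel_Icc_eq)
  qed (use fm in auto)
  moreover have "integral\<^sup>L lborel (g m) = (\<Sum>i=1..m. t / real m * h (real i * (t / real m)))" for m
  proof -
    have int: "integrable lborel (\<lambda>r. c * indicator {a<..b} r)" for a b c :: real
      by (cases "a \<le> b") (auto intro!: integrable_mult_right integrable_real_indicator)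
    have "integral\<^sup>L lborel (g m) = (\<Sum>i=1..m. h (real i * (t / real m)) * measure lborel {real (i - 1) * (t / real m)<..real i * (t / real m)})"
      unfolding g_def by (subst Bochner_Integration.integral_sum[OF int]) simp
    also have "\<dots> = (\<Sum>i=1..m. t / real m * h (real i * (t / real m)))"
    proof (intro sum.cong refl)
      fix i assume i: "i \<in> {1..m}"
      have "real (i - 1) * (t / m) \<le> real i * (t / m)" using t by (intro mult_right_mono) auto
      then have "measure lborel {real (i - 1) * (t / real m)<..real i * (t / real m)} = t / m"
        using i by (simp add: of_nat_diff left_diff_distrib diff_divide_distrib)
      then show "h (real i * (t / real m)) * measure lborel {real (i - 1) * (t / real m)<..real i * (t / real m)} = t / real m * h (real i * (t / real m))"
        by simp
    qed
    finally show ?thesis .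
  qed
  ultimately show ?thesis by (simp add: set_lebesgue_integral_def)
qed

lemma eventually_at_right_reflect:
  fixes r t :: real
  assumes "\<forall>\<^sub>F s in at_left (t - r). P s"
  shows "\<forall>\<^sub>F s in at_right r. P (t - s)"
proof -
  obtain b where b: "b < t - r" "\<And>y. b < y \<Longrightarrow> y < t - r \<Longrightarrow> P y"
    using assms unfolding eventually_at_left_field by blast
  then show ?thesis unfolding eventually_at_right_field by (intro exI[of _ "t - b"]) auto
qed

lemma eventually_at_left_reflect:
  fixes r t :: real
  assumes "\<forall>\<^sub>F s in at_right (t - r). P s"
  shows "\<forall>\<^sub>F s in at_left r. P (t - s)"
proof -
  obtain b where b: "b > t - r" "\<And>y. t - r < y \<Longrightarrow> y < b \<Longrightarrow> P y"
    using assms unfolding eventually_at_right_field by blast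
  then show ?thesis unfolding eventually_at_left_field by (intro exI[of _ "t - b"]) auto
qed

text \<open>On either side of an inner point both \<open>X s\<close> and \<open>Y k (t - s)\<close>
  are locally constant: the reflection turns left limits of \<open>Y k\<close> into limits from the
  right and right-continuity into constancy on the left. The values on the two sides may
  differ.\<close>

lemma Riemann_sum_catalyst:
  fixes Y :: "nat \<Rightarrow> real \<Rightarrow> 'a \<Rightarrow> int ^ 'd"
  assumes t: "0 < t" and Y: "\<And>k. k \<in> {1..n} \<Longrightarrow> simple_random_walk M \<rho> y (Y k)" and \<omega>: "\<omega> \<in> space M"
    and X: "simple_random_walk P \<kappa> x X" and w: "w \<in> space P"
  shows "(\<lambda>m. \<Sum>i=1..m. t / real m * catalyst n Y \<omega> (X (real i * (t / real m)) w) (t - real i * (t / real m)))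
    \<longlonglongrightarrow> (LINT s:{0..t}|lborel. catalyst n Y \<omega> (X s w) (t - s))"
proof (rule Riemann_sum_tendsto[OF t])
  have Xr: "\<forall>\<^sub>F s in at_right r. X s w = X r w" and Xl: "\<exists>z. \<forall>\<^sub>F s in at_left r. X s w = z" if "0 < r" for r
    using X w that unfolding simple_random_walk_def by (auto simp: less_imp_le)
  have Yr: "\<forall>\<^sub>F s in at_right r. Y k s \<omega> = Y k r \<omega>" and Yl: "\<exists>z. \<forall>\<^sub>F s in at_left r. Y k s \<omega> = z"
    if "k \<in> {1..n}" "0 < r" for k r
    using Y[OF that(1)] \<omega> that unfolding simple_random_walk_def by (auto simp: less_imp_le)
  show "\<bar>catalyst n Y \<omega> (X r w) (t - r)\<bar> \<le> real n" for r
  proof -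
    have "\<bar>catalyst n Y \<omega> (X r w) (t - r)\<bar> \<le> (\<Sum>k=1..n. 1)"
      unfolding catalyst_def by (intro order_trans[OF sum_abs] sum_mono) (auto simp: indicator_def)
    then show ?thesis by simp
  qed
  fix r assume r: "0 < r" "r < t"
  show "\<exists>l. \<forall>\<^sub>F s in at_left r. catalyst n Y \<omega> (X s w) (t - s) = l"
  proof -
    obtain z where z: "\<forall>\<^sub>F s in at_left r. X s w = z" using Xl r by blast
    have "\<forall>\<^sub>F s in at_left r. \<forall>k\<in>{1..n}. Y k (t - s) \<omega> = Y k (t - r) \<omega>"
      using r by (intro eventually_ball_finite ballI eventually_at_left_reflect Yr) auto
    with z have "\<forall>\<^sub>F s in at_left r. catalyst n Y \<omega> (X s w) (t - s) = (\<Sum>k=1..n. indicator {z} (Y k (t - r) \<omega>))"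
      by eventually_elim (auto simp: catalyst_def intro!: sum.cong)
    then show ?thesis by blast
  qed
  show "\<exists>l. \<forall>\<^sub>F s in at_right r. catalyst n Y \<omega> (X s w) (t - s) = l"
  proof -
    have "\<forall>k\<in>{1..n}. \<exists>z. \<forall>\<^sub>F s in at_left (t - r). Y k s \<omega> = z" using Yl r by auto
    then obtain z where z: "\<And>k. k \<in> {1..n} \<Longrightarrow> \<forall>\<^sub>F s in at_left (t - r). Y k s \<omega> = z k" by metis
    have "\<forall>\<^sub>F s in at_right r. \<forall>k\<in>{1..n}. Y k (t - s) \<omega> = z k"
      by (intro eventually_ball_finite ballI eventually_at_right_reflect z) auto
    with Xr[OF r(1)] have "\<forall>\<^sub>F s in at_right r. catalyst n Y \<omega> (X s w) (t - s) = (\<Sum>k=1..n. indicator {X r w} (z k))"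
      by eventually_elim (auto simp: catalyst_def intro!: sum.cong)
    then show ?thesis by blast
  qed
qed

section \<open>Markov property and Feynman--Kac recursion\<close>

lemma measurable_map_count_space:
  fixes Z :: "nat \<Rightarrow> 'a \<Rightarrow> 'c :: countable"
  assumes [measurable]: "\<And>i. Z i \<in> M \<rightarrow>\<^sub>M count_space UNIV"
  shows "(\<lambda>\<omega>. map (\<lambda>i. Z i \<omega>) xs) \<in> M \<rightarrow>\<^sub>M count_space UNIV"
proof (rule measurableI)
  fix A :: "'c list set"
  define H where "H \<omega> = map (\<lambda>i. Z i \<omega>) xs" for \<omega>
  have "H \<omega> = h \<longleftrightarrow> length h = length xs \<and> (\<forall>i<length xs. Z (xs ! i) \<omega> = h ! i)" for \<omega> h
    by (auto simp: H_def list_eq_iff_nth_eq)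
  then have "{\<omega>\<in>space M. H \<omega> = h} \<in> sets M" for h
    by simp
  moreover have "H -` A \<inter> space M = (\<Union>h\<in>A. {\<omega>\<in>space M. H \<omega> = h})" by auto
  ultimately have "H -` A \<inter> space M \<in> sets M" by (auto intro!: sets.countable_UN')
  then show "(\<lambda>\<omega>. map (\<lambda>i. Z i \<omega>) xs) -` A \<inter> space M \<in> sets M" by (simp add: H_def[abs_def])
qed simp

text \<open>The Markov property of a chain known only through its finite-dimensional distributions.
  The history takes countably many values, so two weighted laws of it that agree on singletons are
  equal, and \<open>G\<close> has the same integral under both.\<close>

lemma (in prob_space) markov_step:
  fixes Z :: "nat \<Rightarrow> 'a \<Rightarrow> 'c :: countable" and G :: "'c list \<Rightarrow> real"
  assumes Z [measurable]: "\<And>i. Z i \<in> M \<rightarrow>\<^sub>M count_space UNIV"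
    and fdd: "\<And>l c. prob {\<omega>\<in>space M. \<forall>i\<le>l. Z i \<omega> = c i} = indicator {z0} (c 0) * (\<Prod>i<l. q (c i) (c (Suc i)))"
    and q: "\<And>c c'. 0 \<le> q c c'" and qb: "\<And>c c'. q c c' \<le> Kq"
    and G: "\<And>h. \<bar>G h\<bar> \<le> C"
  shows "expectation (\<lambda>\<omega>. G (map (\<lambda>i. Z i \<omega>) [0..<Suc l]) * indicator {c} (Z (Suc l) \<omega>))
    = expectation (\<lambda>\<omega>. G (map (\<lambda>i. Z i \<omega>) [0..<Suc l]) * q (Z l \<omega>) c)"
proof -
  define H where "H \<omega> = map (\<lambda>i. Z i \<omega>) [0..<Suc l]" for \<omega>
  have H_eq: "H \<omega> = h \<longleftrightarrow> length h = Suc l \<and> (\<forall>i\<le>l. Z i \<omega> = h ! i)" for \<omega> h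
    by (auto simp: H_def list_eq_iff_nth_eq less_Suc_eq_le simp del: upt_Suc)
  have H_sets [measurable]: "{\<omega>\<in>space M. H \<omega> = h} \<in> sets M" for h
    unfolding H_eq by measurable
  have Hm [measurable]: "H \<in> M \<rightarrow>\<^sub>M count_space UNIV"
    unfolding H_def by (rule measurable_map_count_space[OF Z])
  define W1 :: "'a \<Rightarrow> real" where "W1 \<omega> = indicator {c} (Z (Suc l) \<omega>)" for \<omega>
  define W2 where "W2 \<omega> = q (Z l \<omega>) c" for \<omega>
  have [measurable]: "W1 \<in> borel_measurable M" unfolding W1_def by measurable
  have [measurable]: "W2 \<in> borel_measurable M"
    unfolding W2_def by (rule measurable_compose[OF Z]) simp
  have dens: "emeasure (distr (density M (\<lambda>\<omega>. ennreal (W \<omega>))) (count_space UNIV) H) {h}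
      = (\<integral>\<^sup>+\<omega>. ennreal (W \<omega>) * indicator {\<omega>\<in>space M. H \<omega> = h} \<omega> \<partial>M)" 
    if [measurable]: "W \<in> borel_measurable M" for W :: "'a \<Rightarrow> real" and h
  proof -
    have eq: "H -` {h} \<inter> space M = {\<omega>\<in>space M. H \<omega> = h}" by auto
    have "emeasure (distr (density M (\<lambda>\<omega>. ennreal (W \<omega>))) (count_space UNIV) H) {h}
        = emeasure (density M (\<lambda>\<omega>. ennreal (W \<omega>))) {\<omega>\<in>space M. H \<omega> = h}"
      by (subst emeasure_distr) (auto simp: eq)
    then show ?thesis by (simp add: emeasure_density)
  qed
  have "distr (density M (\<lambda>\<omega>. ennreal (W1 \<omega>))) (count_space UNIV) H
     = distr (density M (\<lambda>\<omega>. ennreal (W2 \<omega>))) (count_space UNIV) H" (is "?M1 = ?M2")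
  proof (rule measure_eqI_countable[of _ UNIV])
    fix h :: "'c list"
    show "emeasure ?M1 {h} = emeasure ?M2 {h}"
    proof (cases "length h = Suc l")
      case False
      then have "H \<omega> \<noteq> h" for \<omega> by (auto simp: H_eq)
      then show ?thesis by (simp add: dens)
    next
      case True
      \<comment> \<open>The history \<open>h\<close>, continued by the prescribed next
        state.\<close>
      define c' where "c' i = (if i \<le> l then h ! i else c)" for i
      have "emeasure ?M1 {h} = (\<integral>\<^sup>+\<omega>. indicator {\<omega>\<in>space M. \<forall>i\<le>Suc l. Z i \<omega> = c' i} \<omega> \<partial>M)"
        unfolding dens[OF \<open>W1 \<in> borel_measurable M\<close>]
      proof (rule nn_integral_cong)
        fix \<omega> assume "\<omega> \<in> space M"
        have "(\<forall>i\<le>Suc l. Z i \<omega> = c' i) \<longleftrightarrow> H \<omega> = h \<and> Z (Suc l) \<omega> = c"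
          using True by (auto simp: H_eq c'_def le_Suc_eq)
        then show "ennreal (W1 \<omega>) * indicator {\<omega> \<in> space M. H \<omega> = h} \<omega>
          = indicator {\<omega> \<in> space M. \<forall>i\<le>Suc l. Z i \<omega> = c' i} \<omega>"
          by (auto simp: W1_def indicator_def)
      qed
      also have "\<dots> = ennreal (prob {\<omega>\<in>space M. \<forall>i\<le>Suc l. Z i \<omega> = c' i})"
        by (subst nn_integral_indicator) (auto simp: emeasure_eq_measure)
      also have "\<dots> = ennreal (q (h ! l) c * (indicator {z0} (h ! 0) * (\<Prod>i<l. q (h ! i) (h ! Suc i))))"
        unfolding fdd by (auto simp: c'_def mult_ac intro!: prod.cong arg_cong[where f = ennreal])
      also have "indicator {z0} (h ! 0) * (\<Prod>i<l. q (h ! i) (h ! Suc i)) = prob {\<omega>\<in>space M. H \<omega> = h}"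
        using fdd[of l "\<lambda>i. h ! i"] True by (simp add: H_eq)
      also have "ennreal (q (h ! l) c * prob {\<omega>\<in>space M. H \<omega> = h})
          = (\<integral>\<^sup>+\<omega>. ennreal (q (h ! l) c) * indicator {\<omega>\<in>space M. H \<omega> = h} \<omega> \<partial>M)"
        by (subst nn_integral_cmult_indicator) (auto simp: emeasure_eq_measure ennreal_mult q)
      also have "\<dots> = emeasure ?M2 {h}"
        unfolding dens[OF \<open>W2 \<in> borel_measurable M\<close>]
        by (rule nn_integral_cong) (auto simp: W2_def H_eq indicator_def)
      finally show ?thesis .
    qed
  qed auto
  then have "integral\<^sup>L ?M1 G = integral\<^sup>L ?M2 G" by simp
  moreover have "integral\<^sup>L (distr (density M (\<lambda>\<omega>. ennreal (W \<omega>))) (count_space UNIV) H) G = expectation (\<lambda>\<omega>. G (H \<omega>) * W \<omega>)"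
    if [measurable]: "W \<in> borel_measurable M" and W: "\<And>\<omega>. 0 \<le> W \<omega>" for W :: "'a \<Rightarrow> real"
  proof -
    have [measurable]: "(\<lambda>\<omega>. G (H \<omega>)) \<in> borel_measurable M"
      by (rule measurable_compose[OF Hm]) simp
    show ?thesis
      by (subst integral_distr) (auto simp: integral_density W mult.commute)
  qed
  ultimately show ?thesis
    unfolding H_def[symmetric] W1_def[symmetric] W2_def[symmetric]
    by (simp add: W1_def[abs_def] W2_def[abs_def] q)
qed

text \<open>\<open>X\<close> meets the catalysts in reversed time: its last step sees the weight \<open>\<psi> 0\<close>.\<close>

definition fk_rec :: "real \<Rightarrow> real \<Rightarrow> (nat \<Rightarrow> int ^ 'd \<Rightarrow> real) \<Rightarrow> nat \<Rightarrow> int ^ 'd \<Rightarrow> real"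
  where "fk_rec \<nu> s \<psi> m = rec_nat (\<lambda>_. 1) (\<lambda>j u. srw_semigroup \<nu> s (\<lambda>z. \<psi> j z * u z)) m"

lemma fk_rec_simps [simp]:
  "fk_rec \<nu> s \<psi> 0 = (\<lambda>_. 1)"
  "fk_rec \<nu> s \<psi> (Suc j) = srw_semigroup \<nu> s (\<lambda>z. \<psi> j z * fk_rec \<nu> s \<psi> j z)"
  by (simp_all add: fk_rec_def)

lemma fk_rec_cong:
  "(\<And>i z. i < j \<Longrightarrow> \<psi> i z = \<psi>' i z) \<Longrightarrow> fk_rec \<nu> s \<psi> j = fk_rec \<nu> s \<psi>' j"
  by (induction j) auto

lemma fk_rec_bounded:
  fixes \<psi> :: "nat \<Rightarrow> int ^ 'd \<Rightarrow> real"
  assumes "\<And>j z. \<bar>\<psi> j z\<bar> \<le> C" "0 \<le> s" "0 \<le> \<nu>"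
  shows "\<bar>fk_rec \<nu> s \<psi> j z\<bar> \<le> (exp (s * \<nu> * lap_bound TYPE('d)) * C) ^ j"
proof (induction j arbitrary: z)
  case (Suc j)
  have "\<bar>\<psi> j z * fk_rec \<nu> s \<psi> j z\<bar> \<le> C * (exp (s * \<nu> * lap_bound TYPE('d)) * C) ^ j" for z
    unfolding abs_mult using assms(1) Suc order_trans[OF abs_ge_zero assms(1)] by (intro mult_mono) auto
  then have "\<bar>fk_rec \<nu> s \<psi> (Suc j) z\<bar> \<le> exp (s * \<nu> * lap_bound TYPE('d)) * (C * (exp (s * \<nu> * lap_bound TYPE('d)) * C) ^ j)"
    unfolding fk_rec_simps using assms by (intro srw_semigroup_bounded) auto
  then show ?case by (simp add: mult_ac)
qed simp

lemma srw_measurable: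
  assumes "simple_random_walk M \<nu> x Z" "0 \<le> t"
  shows "Z t \<in> M \<rightarrow>\<^sub>M count_space UNIV"
  using assms by (simp add: simple_random_walk_def)

text \<open>The finite-dimensional distributions on an equidistant grid that includes time 0. The
  walk starts at \<open>x\<close> only almost surely, so the events are compared up to null
  sets.\<close>

lemma srw_fdd:
  assumes Z: "simple_random_walk M \<nu> x Z" and s: "0 \<le> s"
  shows "measure M {\<omega>\<in>space M. \<forall>i\<le>l. Z (real i * s) \<omega> = c i}
    = indicator {x} (c 0) * (\<Prod>i<l. srw_transition \<nu> s (c i) (c (Suc i)))"
proof -
  interpret prob_space M using Z by (simp add: simple_random_walk_def)
  note [measurable] = srw_measurable[OF Z]
  have Z0: "AE \<omega> in M. Z 0 \<omega> = x" using Z by (simp add: simple_random_walk_def)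
  have zs: "0 \<le> real i * s" for i using s by simp
  have [measurable]: "Z (real i * s) \<in> M \<rightarrow>\<^sub>M count_space UNIV" for i by (rule srw_measurable[OF Z zs])
  show ?thesis
  proof (cases "c 0 = x")
    case True
    have "measure M {\<omega>\<in>space M. \<forall>i\<le>l. Z (real i * s) \<omega> = c i} = measure M {\<omega>\<in>space M. \<forall>i\<in>{1..l}. Z (real i * s) \<omega> = c i}"
    proof (rule finite_measure_eq_AE)
      show "AE \<omega> in M. (\<omega> \<in> {\<omega>\<in>space M. \<forall>i\<le>l. Z (real i * s) \<omega> = c i}) = (\<omega> \<in> {\<omega>\<in>space M. \<forall>i\<in>{1..l}. Z (real i * s) \<omega> = c i})"
        using Z0
      proof eventually_elim
        case (elim \<omega>)
        have "(\<forall>i\<le>l. Z (real i * s) \<omega> = c i) \<longleftrightarrow> (\<forall>i\<in>{1..l}. Z (real i * s) \<omega> = c i)"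
        proof safe
          fix i assume *: "\<forall>i\<in>{1..l}. Z (real i * s) \<omega> = c i" "i \<le> l"
          show "Z (real i * s) \<omega> = c i" using * elim True by (cases "i = 0") auto
        qed auto
        then show ?case by simp
      qed
    qed measurable
    also have "\<dots> = (\<Prod>i<l. srw_transition \<nu> (real (Suc i) * s - real i * s) (c i) (c (Suc i)))"
    proof -
      have "(\<lambda>i. real i * s) 0 = 0 \<and> (\<forall>i<l. real i * s \<le> real (Suc i) * s) \<and> c 0 = x"
        using s True by (auto intro: mult_right_mono)
      moreover have "\<forall>m t z. t 0 = 0 \<and> (\<forall>i<m. t i \<le> t (Suc i)) \<and> z 0 = x \<longrightarrow>
         measure M {\<omega> \<in> space M. \<forall>i\<in>{1..m}. Z (t i) \<omega> = z i} =
         (\<Prod>i<m. srw_transition \<nu> (t (Suc i) - t i) (z i) (z (Suc i)))"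
        using Z unfolding simple_random_walk_def by (elim conjE) assumption
      ultimately show ?thesis by (elim allE[of _ l] allE[of _ "\<lambda>i. real i * s"] allE[of _ c] impE)
    qed
    finally show ?thesis using True by (simp add: algebra_simps)
  next
    case False
    have "measure M {\<omega>\<in>space M. \<forall>i\<le>l. Z (real i * s) \<omega> = c i} = measure M {}"
    proof (rule finite_measure_eq_AE)
      show "AE \<omega> in M. (\<omega> \<in> {\<omega>\<in>space M. \<forall>i\<le>l. Z (real i * s) \<omega> = c i}) = (\<omega> \<in> {})"
        using Z0
      proof eventually_elim
        case (elim \<omega>)
        then show ?case using False by (force intro: exI[of _ 0])
      qed
    qed measurable
    then show ?thesis using False by simp
  qed
qed

lemma srw_transition_eq_prob:
  assumes Z: "simple_random_walk M \<nu> x Z" and s: "0 \<le> s"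
  shows "srw_transition \<nu> s x y = measure M {\<omega>\<in>space M. \<forall>i\<le>1. Z (real i * s) \<omega> = (if i = 0 then x else y)}"
  by (subst srw_fdd[OF Z s, of 1 "\<lambda>i. if i = 0 then x else y"]) simp

text \<open>The series defining the kernel can have terms of both signs, so positivity cannot be
  read off from it; it comes from a process that has the kernel as its transition
  probability.\<close>

lemma srw_transition_nonneg:
  assumes "simple_random_walk M \<nu> x Z" "0 \<le> s"
  shows "0 \<le> srw_transition \<nu> s x y"
  unfolding srw_transition_eq_prob[OF assms] by simp

lemma srw_transition_le:
  fixes x :: "int ^ 'd"
  assumes "0 \<le> s" "0 \<le> \<nu>"
  shows "srw_transition \<nu> s x y \<le> exp (s * \<nu> * lap_bound TYPE('d))"
  unfolding srw_transition_def using srw_semigroup_bounded[of "indicator {y}" 1 s \<nu> x] assms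
  by (auto simp: indicator_def)

text \<open>\<open>markov_step\<close> covers indicators; linear combinations and bounded pointwise
  limits extend the identity to every bounded \<phi>.\<close>

lemma srw_step:
  fixes x :: "int ^ 'd"
  assumes Z: "simple_random_walk M \<nu> x Z" and s: "0 \<le> s" "0 \<le> \<nu>"
    and p: "\<And>x y :: int ^ 'd. 0 \<le> srw_transition \<nu> s x y"
    and G: "\<And>h. \<bar>G h\<bar> \<le> C" and \<phi>: "\<And>z. \<bar>\<phi> z\<bar> \<le> D"
  shows "(\<integral>\<omega>. G (map (\<lambda>i. Z (real i * s) \<omega>) [0..<Suc l]) * \<phi> (Z (real (Suc l) * s) \<omega>) \<partial>M)
    = (\<integral>\<omega>. G (map (\<lambda>i. Z (real i * s) \<omega>) [0..<Suc l]) * srw_semigroup \<nu> s \<phi> (Z (real l * s) \<omega>) \<partial>M)"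
proof -
  interpret prob_space M using Z by (simp add: simple_random_walk_def)
  have zs: "0 \<le> real i * s" for i using s by simp
  have [measurable]: "Z (real i * s) \<in> M \<rightarrow>\<^sub>M count_space UNIV" for i by (rule srw_measurable[OF Z zs])
  have fm [measurable]: "(\<lambda>\<omega>. f (Z (real i * s) \<omega>)) \<in> borel_measurable M" for i and f :: "int ^ 'd \<Rightarrow> real"
    by (rule measurable_compose[OF \<open>Z (real i * s) \<in> _\<close>]) simp
  define H where "H \<omega> = map (\<lambda>i. Z (real i * s) \<omega>) [0..<Suc l]" for \<omega>
  have C: "0 \<le> C" using G[of undefined] by linarith
  have D: "0 \<le> D" using \<phi>[of 0] by linarith
  have Gm [measurable]: "(\<lambda>\<omega>. G (H \<omega>)) \<in> borel_measurable M"
    unfolding H_def by (rule measurable_compose[OF measurable_map_count_space]) auto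
  have step: "expectation (\<lambda>\<omega>. G (H \<omega>) * indicator {c} (Z (real (Suc l) * s) \<omega>))
    = expectation (\<lambda>\<omega>. G (H \<omega>) * srw_transition \<nu> s (Z (real l * s) \<omega>) c)" for c
    unfolding H_def
    by (rule markov_step[where Z = "\<lambda>i. Z (real i * s)" and q = "srw_transition \<nu> s"])
       (use srw_fdd[OF Z s(1)] p srw_transition_le[OF s] G in auto)
  \<comment> \<open>Finite sets that exhaust the lattice along an enumeration.\<close>
  define B where "B R = (from_nat :: nat \<Rightarrow> int ^ 'd) ` {..<R}" for R
  define \<phi>' where "\<phi>' R z = (\<Sum>c\<in>B R. \<phi> c * indicator {c} z)" for R z
  have fB: "finite (B R)" for R by (simp add: B_def)
  have \<phi>'_eq: "\<phi>' R z = (if z \<in> B R then \<phi> z else 0)" for R z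
    using fB by (auto simp: \<phi>'_def indicator_def if_distrib[of "\<lambda>x. _ * x"] cong: if_cong)
  have \<phi>'b: "\<bar>\<phi>' R z\<bar> \<le> D" for R z using \<phi>[of z] D by (simp add: \<phi>'_eq)
  have \<phi>'lim: "(\<lambda>R. \<phi>' R z) \<longlonglongrightarrow> \<phi> z" for z
  proof (rule tendsto_eventually, rule eventually_sequentiallyI)
    fix R assume "Suc (to_nat z) \<le> R"
    then have "z \<in> B R" by (auto simp: B_def image_iff intro!: bexI[of _ "to_nat z"])
    then show "\<phi>' R z = \<phi> z" by (simp add: \<phi>'_eq)
  qed
  have int: "integrable M (\<lambda>\<omega>. G (H \<omega>) * f (Z (real i * s) \<omega>))" if "\<And>z. \<bar>f z\<bar> \<le> K" for i K and f :: "int ^ 'd \<Rightarrow> real"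
  proof (rule integrable_const_bound[of _ "C * K"])
    show "AE \<omega> in M. norm (G (H \<omega>) * f (Z (real i * s) \<omega>)) \<le> C * K"
      using G that C by (intro AE_I2) (auto simp: abs_mult intro!: mult_mono)
  qed measurable
  have eqR: "expectation (\<lambda>\<omega>. G (H \<omega>) * \<phi>' R (Z (real (Suc l) * s) \<omega>))
    = expectation (\<lambda>\<omega>. G (H \<omega>) * srw_semigroup \<nu> s (\<phi>' R) (Z (real l * s) \<omega>))" for R
  proof -
    have i1: "integrable M (\<lambda>\<omega>. \<phi> c * (G (H \<omega>) * indicator {c} (Z (real (Suc l) * s) \<omega>)))" for c
      by (intro integrable_mult_right int[of _ 1]) (auto simp: indicator_def)
    have i2: "integrable M (\<lambda>\<omega>. \<phi> c * (G (H \<omega>) * srw_transition \<nu> s (Z (real l * s) \<omega>) c))" for c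
      by (intro integrable_mult_right int[of "\<lambda>z. srw_transition \<nu> s z c"])
         (use p srw_transition_le[OF s] in auto)
    have "expectation (\<lambda>\<omega>. G (H \<omega>) * \<phi>' R (Z (real (Suc l) * s) \<omega>))
      = expectation (\<lambda>\<omega>. \<Sum>c\<in>B R. \<phi> c * (G (H \<omega>) * indicator {c} (Z (real (Suc l) * s) \<omega>)))"
      by (simp add: \<phi>'_def sum_distrib_left mult_ac)
    also have "\<dots> = (\<Sum>c\<in>B R. \<phi> c * expectation (\<lambda>\<omega>. G (H \<omega>) * indicator {c} (Z (real (Suc l) * s) \<omega>)))"
      by (subst Bochner_Integration.integral_sum[OF i1]) simp
    also have "\<dots> = (\<Sum>c\<in>B R. \<phi> c * expectation (\<lambda>\<omega>. G (H \<omega>) * srw_transition \<nu> s (Z (real l * s) \<omega>) c))"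
      by (simp only: step)
    also have "\<dots> = expectation (\<lambda>\<omega>. \<Sum>c\<in>B R. \<phi> c * (G (H \<omega>) * srw_transition \<nu> s (Z (real l * s) \<omega>) c))"
      by (subst Bochner_Integration.integral_sum[OF i2]) simp
    also have "\<dots> = expectation (\<lambda>\<omega>. G (H \<omega>) * srw_semigroup \<nu> s (\<phi>' R) (Z (real l * s) \<omega>))"
      unfolding \<phi>'_def by (simp only: srw_semigroup_sum[OF fB s]) (simp add: sum_distrib_left mult_ac)
    finally show ?thesis .
  qed
  have sgb: "\<bar>srw_semigroup \<nu> s f z\<bar> \<le> exp (s * \<nu> * lap_bound TYPE('d)) * D" if "\<And>z. \<bar>f z\<bar> \<le> D" for f and z :: "int ^ 'd"
    using that s by (intro srw_semigroup_bounded) auto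
  have lim: "(\<lambda>R. expectation (\<lambda>\<omega>. G (H \<omega>) * f R (Z (real i * s) \<omega>))) \<longlonglongrightarrow> expectation (\<lambda>\<omega>. G (H \<omega>) * g (Z (real i * s) \<omega>))"
    if f: "\<And>R z. \<bar>f R z\<bar> \<le> K" and fg: "\<And>z. (\<lambda>R. f R z) \<longlonglongrightarrow> g z" for f g K i
  proof (rule integral_dominated_convergence[where w = "\<lambda>_. C * K"])
    show "AE \<omega> in M. (\<lambda>R. G (H \<omega>) * f R (Z (real i * s) \<omega>)) \<longlonglongrightarrow> G (H \<omega>) * g (Z (real i * s) \<omega>)"
      by (intro AE_I2 tendsto_mult tendsto_const fg)
    show "AE \<omega> in M. norm (G (H \<omega>) * f R (Z (real i * s) \<omega>)) \<le> C * K" for R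
      unfolding real_norm_def abs_mult by (intro AE_I2 mult_mono G f C) simp
  qed simp_all
  have lim1: "(\<lambda>R. expectation (\<lambda>\<omega>. G (H \<omega>) * \<phi>' R (Z (real (Suc l) * s) \<omega>)))
      \<longlonglongrightarrow> expectation (\<lambda>\<omega>. G (H \<omega>) * \<phi> (Z (real (Suc l) * s) \<omega>))"
    by (rule lim) (rule \<phi>'b, rule \<phi>'lim)
  have lim2: "(\<lambda>R. expectation (\<lambda>\<omega>. G (H \<omega>) * srw_semigroup \<nu> s (\<phi>' R) (Z (real l * s) \<omega>)))
      \<longlonglongrightarrow> expectation (\<lambda>\<omega>. G (H \<omega>) * srw_semigroup \<nu> s \<phi> (Z (real l * s) \<omega>))"
    by (rule lim) (rule sgb, rule \<phi>'b, rule srw_semigroup_tendsto[OF \<phi>'b s \<phi>'lim])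
  show ?thesis using LIMSEQ_unique[OF lim1 lim2[folded eqR]] by (simp only: H_def)
qed

text \<open>The steps are integrated out from the last to the first, each adding one level to
  \<open>fk_rec\<close>. The index \<open>m - i\<close> is the catalyst time, in units of
  \<open>s\<close>, that the walk sees at its step \<open>i\<close>.\<close>

lemma srw_expectation_prod:
  fixes x :: "int ^ 'd"
  assumes Z: "simple_random_walk M \<nu> x Z" and s: "0 \<le> s" "0 \<le> \<nu>"
    and p: "\<And>x y :: int ^ 'd. 0 \<le> srw_transition \<nu> s x y"
    and \<psi>: "\<And>j z. \<bar>\<psi> j z\<bar> \<le> C"
  shows "(\<integral>\<omega>. (\<Prod>i=1..m. \<psi> (m - i) (Z (real i * s) \<omega>)) \<partial>M) = fk_rec \<nu> s \<psi> m x"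
proof -
  interpret prob_space M using Z by (simp add: simple_random_walk_def)
  have C: "0 \<le> C" using \<psi>[of 0 0] by linarith
  have "expectation (\<lambda>\<omega>. \<Prod>i=1..m. \<psi> (m - i) (Z (real i * s) \<omega>))
     = expectation (\<lambda>\<omega>. (\<Prod>i=1..m-j. \<psi> (m - i) (Z (real i * s) \<omega>)) * fk_rec \<nu> s \<psi> j (Z (real (m - j) * s) \<omega>))"
    if "j \<le> m" for j
    using that
  proof (induction j)
    case (Suc j)
    define l where "l = m - Suc j"
    have l: "m - j = Suc l" "m - Suc l = j" "m - Suc j = l" using Suc.prems by (auto simp: l_def)
    define G where "G h = (\<Prod>i=1..l. \<psi> (m - i) (h ! i))" for h
    have G: "\<bar>G h\<bar> \<le> C ^ l" for h
    proof -
      have "\<bar>G h\<bar> \<le> (\<Prod>i=1..l. C)" unfolding G_def abs_prod by (intro prod_mono) (use \<psi> in auto)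
      then show ?thesis by simp
    qed
    have GH: "G (map (\<lambda>i. Z (real i * s) \<omega>) [0..<Suc l]) = (\<Prod>i=1..l. \<psi> (m - i) (Z (real i * s) \<omega>))" for \<omega>
      unfolding G_def by (intro prod.cong refl) (auto simp: nth_append)
    have b: "\<bar>\<psi> j z * fk_rec \<nu> s \<psi> j z\<bar> \<le> C * (exp (s * \<nu> * lap_bound TYPE('d)) * C) ^ j" for z
      unfolding abs_mult using \<psi> fk_rec_bounded[OF \<psi> s] C by (intro mult_mono) auto
    have "expectation (\<lambda>\<omega>. \<Prod>i=1..m. \<psi> (m - i) (Z (real i * s) \<omega>))
      = expectation (\<lambda>\<omega>. (\<Prod>i=1..l. \<psi> (m - i) (Z (real i * s) \<omega>)) * (\<psi> j (Z (real (Suc l) * s) \<omega>) * fk_rec \<nu> s \<psi> j (Z (real (Suc l) * s) \<omega>)))"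
      using Suc by (simp add: l mult.assoc)
    also have "\<dots> = expectation (\<lambda>\<omega>. (\<Prod>i=1..l. \<psi> (m - i) (Z (real i * s) \<omega>)) * fk_rec \<nu> s \<psi> (Suc j) (Z (real l * s) \<omega>))"
      using srw_step[OF Z s p, where G = G and \<phi> = "\<lambda>z. \<psi> j z * fk_rec \<nu> s \<psi> j z" and l = l, OF G b]
      unfolding GH fk_rec_simps .
    finally show ?case by (simp only: l)
  qed simp
  from this[of m] have "expectation (\<lambda>\<omega>. \<Prod>i=1..m. \<psi> (m - i) (Z (real i * s) \<omega>)) = expectation (\<lambda>\<omega>. fk_rec \<nu> s \<psi> m (Z 0 \<omega>))"
    by simp
  also have "\<dots> = expectation (\<lambda>\<omega>. fk_rec \<nu> s \<psi> m x)"
  proof (rule integral_cong_AE)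
    show "(\<lambda>\<omega>. fk_rec \<nu> s \<psi> m (Z 0 \<omega>)) \<in> borel_measurable M"
      by (rule measurable_compose[OF srw_measurable[OF Z order_refl]]) simp
    have "AE \<omega> in M. Z 0 \<omega> = x" using Z by (simp add: simple_random_walk_def)
    then show "AE \<omega> in M. fk_rec \<nu> s \<psi> m (Z 0 \<omega>) = fk_rec \<nu> s \<psi> m x" by eventually_elim simp
  qed simp
  finally show ?thesis by (simp add: prob_space)
qed

section \<open>Joint law of the catalysts on a time grid\<close>

text \<open>Lists of lattice points form a countable type, as \<open>markov_step\<close> requires.
  Entry \<open>k - 1\<close> belongs to catalyst \<open>k\<close>.\<close>

definition joint_pos :: "nat \<Rightarrow> (nat \<Rightarrow> real \<Rightarrow> 'a \<Rightarrow> int ^ 'd) \<Rightarrow> real \<Rightarrow> nat \<Rightarrow> 'a \<Rightarrow> (int ^ 'd) list"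
  where "joint_pos n Y s i \<omega> = map (\<lambda>k. Y k (real i * s) \<omega>) [1..<Suc n]"

text \<open>The value 0 for lists of a wrong length makes the product formula for the joint law
  valid for all sequences of lists.\<close>

definition joint_transition :: "nat \<Rightarrow> real \<Rightarrow> real \<Rightarrow> (int ^ 'd) list \<Rightarrow> (int ^ 'd) list \<Rightarrow> real"
  where "joint_transition n \<rho> s c c' = (if length c = n \<and> length c' = n
    then \<Prod>k=1..n. srw_transition \<rho> s (c ! (k - 1)) (c' ! (k - 1)) else 0)"

lemma joint_pos_eq_iff:
  "joint_pos n Y s i \<omega> = c \<longleftrightarrow> length c = n \<and> (\<forall>k\<in>{1..n}. Y k (real i * s) \<omega> = c ! (k - 1))"
proof -
  have "joint_pos n Y s i \<omega> = c \<longleftrightarrow> length c = n \<and> (\<forall>j<n. Y (Suc j) (real i * s) \<omega> = c ! j)"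
    by (auto simp: joint_pos_def list_eq_iff_nth_eq nth_append simp del: upt_Suc)
  also have "(\<forall>j<n. Y (Suc j) (real i * s) \<omega> = c ! j) \<longleftrightarrow> (\<forall>k\<in>{1..n}. Y k (real i * s) \<omega> = c ! (k - 1))"
  proof safe
    fix k assume "\<forall>j<n. Y (Suc j) (real i * s) \<omega> = c ! j" "k \<in> {1..n}"
    then show "Y k (real i * s) \<omega> = c ! (k - 1)" by (cases k) auto
  next
    fix j assume "\<forall>k\<in>{1..n}. Y k (real i * s) \<omega> = c ! (k - 1)" "j < n"
    then show "Y (Suc j) (real i * s) \<omega> = c ! j" by force
  qed
  finally show ?thesis .
qed

lemma joint_pos_nth:
  "k \<in> {1..n} \<Longrightarrow> joint_pos n Y s i \<omega> ! (k - 1) = Y k (real i * s) \<omega>"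
  using joint_pos_eq_iff[of n Y s i \<omega> "joint_pos n Y s i \<omega>"] by simp

text \<open>Independence is stated for whole paths. The grid events are intersections of the
  cylinder events \<open>A k\<close> of the single paths, so the joint law is a product of laws of
  single walks.\<close>

lemma joint_pos_fdd:
  fixes Y :: "nat \<Rightarrow> real \<Rightarrow> 'a \<Rightarrow> int ^ 'd"
  assumes Y: "independent_srws M n \<rho> 0 Y" and n: "1 \<le> n" and s: "0 \<le> s"
  shows "measure M {\<omega>\<in>space M. \<forall>i\<le>l. joint_pos n Y s i \<omega> = c i}
    = indicator {replicate n 0} (c 0) * (\<Prod>i<l. joint_transition n \<rho> s (c i) (c (Suc i)))"
proof -
  have srw: "simple_random_walk M \<rho> 0 (Y k)" if "k \<in> {1..n}" for k
    using Y that by (simp add: independent_srws_def)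
  then interpret prob_space M using n by (auto simp: simple_random_walk_def)
  show ?thesis
  proof (cases "\<forall>i\<le>l. length (c i) = n")
    case len: True
    define A :: "nat \<Rightarrow> (real \<Rightarrow> int ^ 'd) set" where
      "A k = {f\<in>space (\<Pi>\<^sub>M t\<in>{0..}. count_space UNIV). \<forall>i\<le>l. f (real i * s) = c i ! (k - 1)}" for k
    have As: "A k \<in> sets (\<Pi>\<^sub>M t\<in>{0..}. count_space UNIV)" for k
    proof -
      have [measurable]: "(\<lambda>f. f (real i * s)) \<in> (\<Pi>\<^sub>M t\<in>{0..}. count_space UNIV) \<rightarrow>\<^sub>M count_space (UNIV :: (int ^ 'd) set)" for i
        using s by (intro measurable_component_singleton) auto
      show ?thesis unfolding A_def by measurable
    qed
    have vim: "(\<lambda>\<omega>. \<lambda>t\<in>{0..}. Y k t \<omega>) -` A k \<inter> space M = {\<omega>\<in>space M. \<forall>i\<le>l. Y k (real i * s) \<omega> = c i ! (k - 1)}" for k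
      using s by (auto simp: A_def space_PiM)
    have "{\<omega>\<in>space M. \<forall>i\<le>l. joint_pos n Y s i \<omega> = c i}
        = (\<Inter>k\<in>{1..n}. (\<lambda>\<omega>. \<lambda>t\<in>{0..}. Y k t \<omega>) -` A k \<inter> space M)"
      unfolding vim joint_pos_eq_iff using len n by auto
    also have "prob \<dots> = (\<Prod>k=1..n. prob ((\<lambda>\<omega>. \<lambda>t\<in>{0..}. Y k t \<omega>) -` A k \<inter> space M))"
    proof (rule indep_varsD)
      show "indep_vars (\<lambda>k. \<Pi>\<^sub>M t\<in>{0..}. count_space UNIV) (\<lambda>k \<omega>. \<lambda>t\<in>{0..}. Y k t \<omega>) {1..n}"
        using Y by (simp add: independent_srws_def)
    qed (use n As in auto)
    also have "\<dots> = (\<Prod>k=1..n. indicator {0} (c 0 ! (k - 1)) * (\<Prod>i<l. srw_transition \<rho> s (c i ! (k - 1)) (c (Suc i) ! (k - 1))))"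
      unfolding vim by (intro prod.cong refl srw_fdd srw s)
    also have "\<dots> = (\<Prod>k=1..n. indicator {0} (c 0 ! (k - 1))) * (\<Prod>i<l. \<Prod>k=1..n. srw_transition \<rho> s (c i ! (k - 1)) (c (Suc i) ! (k - 1)))"
      by (subst prod.swap) (rule prod.distrib)
    also have "(\<Prod>i<l. \<Prod>k=1..n. srw_transition \<rho> s (c i ! (k - 1)) (c (Suc i) ! (k - 1))) = (\<Prod>i<l. joint_transition n \<rho> s (c i) (c (Suc i)))"
      using len by (intro prod.cong refl) (simp add: joint_transition_def)
    also have "(\<Prod>k=1..n. indicator {0} (c 0 ! (k - 1))) = (indicator {replicate n 0} (c 0) :: real)"
    proof -
      have "c 0 = replicate n 0 \<longleftrightarrow> (\<forall>k\<in>{1..n}. c 0 ! (k - 1) = 0)"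
      proof safe
        fix k assume "c 0 = replicate n 0" "k \<in> {1..n}"
        then show "c 0 ! (k - 1) = 0" using nth_replicate[of "k - 1" n 0] by auto
      next
        assume *: "\<forall>k\<in>{1..n}. c 0 ! (k - 1) = 0"
        show "c 0 = replicate n 0"
        proof (rule nth_equalityI)
          fix j assume "j < length (c 0)"
          then show "c 0 ! j = replicate n 0 ! j" using *[rule_format, of "Suc j"] len by auto
        qed (use len in simp)
      qed
      then show ?thesis by (cases "c 0 = replicate n 0") (auto simp: indicator_def)
    qed
    finally show ?thesis .
  next
    case False
    then obtain i where i: "i \<le> l" "length (c i) \<noteq> n" by blast
    then have "{\<omega>\<in>space M. \<forall>i\<le>l. joint_pos n Y s i \<omega> = c i} = {}"
      by (auto simp: joint_pos_eq_iff)
    moreover have "indicator {replicate n 0} (c 0) * (\<Prod>i<l. joint_transition n \<rho> s (c i) (c (Suc i))) = 0"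
    proof (cases i)
      case 0
      then have "c 0 \<noteq> replicate n 0" using i by auto
      then show ?thesis by simp
    next
      case (Suc j)
      then have "j < l" "joint_transition n \<rho> s (c j) (c (Suc j)) = 0" using i by (auto simp: joint_transition_def)
      then show ?thesis by (auto intro!: prod_zero)
    qed
    ultimately show ?thesis by (simp only: measure_empty)
  qed
qed

lemma joint_pos_step:
  fixes Y :: "nat \<Rightarrow> real \<Rightarrow> 'a \<Rightarrow> int ^ 'd"
  assumes Y: "independent_srws M n \<rho> 0 Y" and n: "1 \<le> n" and s: "0 \<le> s" "0 \<le> \<rho>"
    and p: "\<And>x y :: int ^ 'd. 0 \<le> srw_transition \<rho> s x y" and G: "\<And>h. \<bar>G h\<bar> \<le> C"
  shows "(\<integral>\<omega>. G (map (\<lambda>i. joint_pos n Y s i \<omega>) [0..<Suc l]) * (\<Prod>k=1..n. indicator {y k} (Y k (real (Suc l) * s) \<omega>)) \<partial>M)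
    = (\<integral>\<omega>. G (map (\<lambda>i. joint_pos n Y s i \<omega>) [0..<Suc l]) * (\<Prod>k=1..n. srw_transition \<rho> s (Y k (real l * s) \<omega>) (y k)) \<partial>M)"
proof -
  have srw: "simple_random_walk M \<rho> 0 (Y k)" if "k \<in> {1..n}" for k
    using Y that by (simp add: independent_srws_def)
  then interpret prob_space M using n by (auto simp: simple_random_walk_def)
  define c where "c = map y [1..<Suc n]"
  have c: "length c = n" "k \<in> {1..n} \<Longrightarrow> c ! (k - 1) = y k" for k
    by (auto simp: c_def nth_append simp del: upt_Suc)
  have Ym: "Y k (real i * s) \<in> M \<rightarrow>\<^sub>M count_space UNIV" if "k \<in> {1..n}" for k i
    using srw_measurable[OF srw[OF that]] s by simp
  have "joint_pos n Y s i \<in> M \<rightarrow>\<^sub>M count_space UNIV" for i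
  proof -
    have "(\<lambda>\<omega>. map (\<lambda>k. (if k \<in> {1..n} then Y k (real i * s) else (\<lambda>_. 0)) \<omega>) [1..<Suc n]) \<in> M \<rightarrow>\<^sub>M count_space UNIV"
      by (rule measurable_map_count_space) (use Ym in auto)
    also have "(\<lambda>\<omega>. map (\<lambda>k. (if k \<in> {1..n} then Y k (real i * s) else (\<lambda>_. 0)) \<omega>) [1..<Suc n]) = joint_pos n Y s i"
      by (auto simp: joint_pos_def fun_eq_iff simp del: upt_Suc)
    finally show ?thesis .
  qed
  moreover have "0 \<le> joint_transition n \<rho> s c c'" for c c' :: "(int ^ 'd) list"
    by (auto simp: joint_transition_def intro!: prod_nonneg p)
  moreover have "joint_transition n \<rho> s c c' \<le> exp (s * \<rho> * lap_bound TYPE('d)) ^ n" for c c' :: "(int ^ 'd) list"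
  proof -
    have "(\<Prod>k=1..n. srw_transition \<rho> s (c ! (k - 1)) (c' ! (k - 1))) \<le> (\<Prod>k=1..n. exp (s * \<rho> * lap_bound TYPE('d)))"
      by (intro prod_mono) (auto intro!: p srw_transition_le s)
    then show ?thesis by (simp add: joint_transition_def)
  qed
  ultimately have "expectation (\<lambda>\<omega>. G (map (\<lambda>i. joint_pos n Y s i \<omega>) [0..<Suc l]) * indicator {c} (joint_pos n Y s (Suc l) \<omega>))
    = expectation (\<lambda>\<omega>. G (map (\<lambda>i. joint_pos n Y s i \<omega>) [0..<Suc l]) * joint_transition n \<rho> s (joint_pos n Y s l \<omega>) c)"
    using joint_pos_fdd[OF Y n s(1)] G by (intro markov_step) auto
  moreover have "indicator {c} (joint_pos n Y s (Suc l) \<omega>) = (\<Prod>k=1..n. indicator {y k} (Y k (real (Suc l) * s) \<omega>) :: real)" for \<omega>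
  proof -
    have "joint_pos n Y s (Suc l) \<omega> = c \<longleftrightarrow> (\<forall>k\<in>{1..n}. Y k (real (Suc l) * s) \<omega> = y k)"
      unfolding joint_pos_eq_iff using c by auto
    then show ?thesis
      by (cases "joint_pos n Y s (Suc l) \<omega> = c") (auto simp: indicator_def simp del: of_nat_Suc)
  qed
  moreover have "joint_transition n \<rho> s (joint_pos n Y s l \<omega>) c = (\<Prod>k=1..n. srw_transition \<rho> s (Y k (real l * s) \<omega>) (y k))" for \<omega>
  proof -
    have "(\<Prod>k=1..n. srw_transition \<rho> s (joint_pos n Y s l \<omega> ! (k - 1)) (c ! (k - 1)))
      = (\<Prod>k=1..n. srw_transition \<rho> s (Y k (real l * s) \<omega>) (y k))"
      by (intro prod.cong refl) (simp only: joint_pos_nth c(2))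
    then show ?thesis by (simp add: joint_transition_def joint_pos_def c(1) del: upt_Suc)
  qed
  ultimately show ?thesis by simp
qed


text \<open>
  A configuration \<open>a :: nat + nat \<Rightarrow> int ^ 'd\<close> holds the position of the \<open>j\<close>-th copy of \<open>X\<close> at \<open>Inl j\<close> and
  that of the time-reversed catalyst \<open>Y\<^sub>k\<close> at \<open>Inr k\<close>; other indices never move.
\<close>

definition interaction :: "nat \<Rightarrow> nat \<Rightarrow> (nat + nat \<Rightarrow> int ^ 'd) \<Rightarrow> real"
  where "interaction n p a = (\<Sum>j=1..p. \<Sum>k=1..n. indicator {a (Inl j)} (a (Inr k)))"

definition rates :: "real \<Rightarrow> real \<Rightarrow> nat + nat \<Rightarrow> real"
  where "rates \<kappa> \<rho> = case_sum (\<lambda>_. \<kappa>) (\<lambda>_. \<rho>)"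

lemma rates_simps [simp]: "rates \<kappa> \<rho> (Inl j) = \<kappa>" "rates \<kappa> \<rho> (Inr k) = \<rho>"
  by (simp_all add: rates_def)

lemma rates_nonneg: "0 \<le> \<kappa> \<Longrightarrow> 0 \<le> \<rho> \<Longrightarrow> 0 \<le> rates \<kappa> \<rho> i"
  by (cases i) auto

definition particles :: "nat \<Rightarrow> nat \<Rightarrow> (nat + nat) list"
  where "particles n p = map Inl [1..<Suc p] @ map Inr [1..<Suc n]"

lemma set_particles: "set (particles n p) = {1..p} <+> {1..n}"
  by (auto simp: particles_def Plus_def)

lemma distinct_particles: "distinct (particles n p)"
  by (auto simp: particles_def distinct_map simp del: upt_Suc)

section \<open>The time-discrete moment as an iterated splitting scheme\<close>

definition Trotter_step :: "nat \<Rightarrow> nat \<Rightarrow> real \<Rightarrow> real \<Rightarrow> real \<Rightarrow> ((nat + nat \<Rightarrow> int ^ 'd) \<Rightarrow> real) \<Rightarrow> (nat + nat \<Rightarrow> int ^ 'd) \<Rightarrow> real"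
  where "Trotter_step n p \<kappa> \<rho> s f = all_sg (rates \<kappa> \<rho>) (particles n p) s (\<lambda>b. exp (s * interaction n p b) * f b)"

text \<open>Reversing time turns the start of the catalysts at 0 into the function to which the
  operators are applied; the copies of \<open>X\<close> end anywhere, so their coordinates are left
  free.\<close>

definition start_weight :: "nat \<Rightarrow> (nat + nat \<Rightarrow> int ^ 'd) \<Rightarrow> real"
  where "start_weight n a = (\<Prod>k=1..n. indicator {0} (a (Inr k)))"

text \<open>The moment after \<open>l\<close> steps of size \<open>s\<close>, restricted to the
  event that the catalysts sit at the \<open>Inr\<close> coordinates of \<open>a\<close>. For fixed
  catalysts the product over the copies is the expectation for \<open>p\<close> independent walks
  started at the \<open>Inl\<close> coordinates. As \<open>fk_rec\<close> reads the catalysts at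
  time \<open>j * s\<close> in its level \<open>j\<close>, the recursion in \<open>l\<close> follows
  the catalysts forward in time.\<close>

definition tilted_law :: "nat \<Rightarrow> nat \<Rightarrow> real \<Rightarrow> real \<Rightarrow> 'a measure \<Rightarrow> (nat \<Rightarrow> real \<Rightarrow> 'a \<Rightarrow> int ^ 'd) \<Rightarrow> nat \<Rightarrow> (nat + nat \<Rightarrow> int ^ 'd) \<Rightarrow> real"
  where "tilted_law n p \<kappa> s M Y l a = (\<integral>\<omega>. (\<Prod>j=1..p. fk_rec \<kappa> s (\<lambda>j z. exp (s * catalyst n Y \<omega> z (real j * s))) l (a (Inl j)))
    * (\<Prod>k=1..n. indicator {a (Inr k)} (Y k (real l * s) \<omega>)) \<partial>M)"

lemma catalyst_bounded: "\<bar>catalyst n Y \<omega> z t\<bar> \<le> real n"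
proof -
  have "\<bar>catalyst n Y \<omega> z t\<bar> \<le> (\<Sum>k=1..n. 1)"
    unfolding catalyst_def by (intro order_trans[OF sum_abs] sum_mono) (auto simp: indicator_def)
  then show ?thesis by simp
qed

lemma exp_catalyst_bounded: "0 \<le> s \<Longrightarrow> \<bar>exp (s * catalyst n Y \<omega> z t)\<bar> \<le> exp (s * real n)"
  using catalyst_bounded[of n Y \<omega> z t] by (auto intro: mult_left_mono)

lemma catalyst_measurable:
  fixes Y :: "nat \<Rightarrow> real \<Rightarrow> 'a \<Rightarrow> int ^ 'd"
  assumes "independent_srws M n \<rho> 0 Y" "0 \<le> t"
  shows "(\<lambda>\<omega>. catalyst n Y \<omega> z t) \<in> borel_measurable M"
  unfolding catalyst_def
proof (intro borel_measurable_sum)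
  fix k assume "k \<in> {1..n}"
  then have "Y k t \<in> M \<rightarrow>\<^sub>M count_space UNIV"
    using assms srw_measurable[of M \<rho> 0 "Y k" t] by (auto simp: independent_srws_def)
  then show "(\<lambda>\<omega>. indicator {z} (Y k t \<omega>) :: real) \<in> borel_measurable M"
    by (rule measurable_compose) simp
qed

lemma independent_srws_prob_space:
  assumes "independent_srws M n \<rho> x Y" "1 \<le> n"
  shows "prob_space M"
  using assms by (force simp: independent_srws_def simple_random_walk_def)

lemma fk_rec_measurable:
  fixes Y :: "nat \<Rightarrow> real \<Rightarrow> 'a \<Rightarrow> int ^ 'd"
  assumes Y: "independent_srws M n \<rho> 0 Y" and n: "1 \<le> n" and s: "0 \<le> s" "0 \<le> \<kappa>"
  shows "(\<lambda>\<omega>. fk_rec \<kappa> s (\<lambda>j z. exp (s * catalyst n Y \<omega> z (real j * s))) l z) \<in> borel_measurable M"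
proof (induction l arbitrary: z)
  case (Suc l)
  interpret prob_space M by (rule independent_srws_prob_space[OF Y n])
  show ?case
    unfolding fk_rec_simps
  proof (rule srw_semigroup_expectation(1)[OF _ _ s])
    show "(\<lambda>\<omega>. exp (s * catalyst n Y \<omega> z (real l * s)) * fk_rec \<kappa> s (\<lambda>j z. exp (s * catalyst n Y \<omega> z (real j * s))) l z) \<in> borel_measurable M" for z
      using catalyst_measurable[OF Y, of "real l * s"] s Suc by (intro borel_measurable_times measurable_compose[OF _ borel_measurable_exp]) auto
    show "\<bar>exp (s * catalyst n Y \<omega> z (real l * s)) * fk_rec \<kappa> s (\<lambda>j z. exp (s * catalyst n Y \<omega> z (real j * s))) l z\<bar>
        \<le> exp (s * real n) * (exp (s * \<kappa> * lap_bound TYPE('d)) * exp (s * real n)) ^ l" for \<omega> z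
      unfolding abs_mult[of "exp _"]
      by (intro mult_mono fk_rec_bounded exp_catalyst_bounded s) auto
  qed
qed simp

text \<open>If the catalysts are at \<open>b\<close>, the weights of the copies of \<open>X\<close>
  multiply to \<open>exp (s * interaction n p b)\<close>. The semigroups of the copies raise
  \<open>fk_rec\<close> by one level; those of the catalysts, by symmetry of the kernel, give the
  probability of going from the current positions to the prescribed ones. The Markov property then
  places the catalysts there one step later.\<close>

lemma tilted_law_Suc:
  fixes Y :: "nat \<Rightarrow> real \<Rightarrow> 'a \<Rightarrow> int ^ 'd"
  assumes Y: "independent_srws M n \<rho> 0 Y" and n: "1 \<le> n" and s: "0 \<le> s" "0 \<le> \<rho>" "0 \<le> \<kappa>"
    and p: "\<And>x y :: int ^ 'd. 0 \<le> srw_transition \<rho> s x y"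
  shows "tilted_law n p \<kappa> s M Y (Suc l) = Trotter_step n p \<kappa> \<rho> s (tilted_law n p \<kappa> s M Y l)"
proof
  fix a :: "nat + nat \<Rightarrow> int ^ 'd"
  interpret prob_space M by (rule independent_srws_prob_space[OF Y n])
  define \<psi> where "\<psi> \<omega> j z = exp (s * catalyst n Y \<omega> z (real j * s))" for \<omega> j z
  define fk where "fk \<omega> l = fk_rec \<kappa> s (\<psi> \<omega>) l" for \<omega> l
  define c1 where "c1 = exp (s * real n)"
  define c2 where "c2 = exp (s * \<kappa> * lap_bound TYPE('d)) * c1"
  have \<psi>b: "\<bar>\<psi> \<omega> j z\<bar> \<le> c1" for \<omega> j z
    unfolding \<psi>_def c1_def by (rule exp_catalyst_bounded[OF s(1)])
  have fkb: "\<bar>fk \<omega> l z\<bar> \<le> c2 ^ l" for \<omega> l z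
    unfolding fk_def c2_def by (intro fk_rec_bounded \<psi>b s)
  have fkm [measurable]: "(\<lambda>\<omega>. fk \<omega> l z) \<in> borel_measurable M" for l z
    unfolding fk_def \<psi>_def by (rule fk_rec_measurable[OF Y n s(1,3)])
  have \<psi>m [measurable]: "(\<lambda>\<omega>. \<psi> \<omega> l z) \<in> borel_measurable M" for l z
    unfolding \<psi>_def using catalyst_measurable[OF Y, of "real l * s"] s 
    by (intro measurable_compose[OF _ borel_measurable_exp] borel_measurable_times) auto
  let ?I = "{1..p} <+> {1..n}"
  \<comment> \<open>The integrand is arranged as a product of functions of single coordinates, to
    which \<open>all_sg_prod\<close> applies. The value 0 for catalyst indices outside
    \<open>{1..n}\<close> makes \<open>h\<close> measurable at every index.\<close>
  define h where "h \<omega> i z = (case i of Inl j \<Rightarrow> \<psi> \<omega> l z * fk \<omega> l z | Inr k \<Rightarrow> if k \<in> {1..n} then indicator {Y k (real l * s) \<omega>} z else 0)" for \<omega> and i :: "nat + nat" and z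
  define C where "C = max 1 (c1 * c2 ^ l)"
  have hb: "\<bar>h \<omega> i z\<bar> \<le> C" for \<omega> i z
  proof (cases i)
    case (Inl j)
    have "\<bar>\<psi> \<omega> l z\<bar> * \<bar>fk \<omega> l z\<bar> \<le> c1 * c2 ^ l" by (intro mult_mono \<psi>b fkb) (auto simp: c1_def)
    then show ?thesis using Inl by (simp add: h_def C_def abs_mult le_max_iff_disj)
  next
    case (Inr k)
    then show ?thesis by (auto simp: h_def C_def le_max_iff_disj indicator_def)
  qed
  have hm [measurable]: "(\<lambda>\<omega>. h \<omega> i z) \<in> borel_measurable M" for i z
  proof (cases i)
    case (Inr k)
    have "(\<lambda>\<omega>. indicator {Y k (real l * s) \<omega>} z :: real) \<in> borel_measurable M" if "k \<in> {1..n}"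
    proof -
      have "Y k (real l * s) \<in> M \<rightarrow>\<^sub>M count_space UNIV"
        using Y that s srw_measurable[of M \<rho> 0 "Y k"] by (auto simp: independent_srws_def)
      then show ?thesis by (rule measurable_compose) simp
    qed
    moreover have "(\<lambda>\<omega>. h \<omega> i z) = (if k \<in> {1..n} then (\<lambda>\<omega>. indicator {Y k (real l * s) \<omega>} z) else (\<lambda>_. 0))"
      using Inr by (auto simp: h_def fun_eq_iff)
    ultimately show ?thesis by (simp only: split: if_split) simp
  qed (simp add: h_def)
  have Cp: "1 \<le> C" by (simp add: C_def)
  have prodb: "\<bar>\<Prod>i\<in>?I. h \<omega> i (b i)\<bar> \<le> C ^ card ?I" for \<omega> b
  proof -
    have "\<bar>\<Prod>i\<in>?I. h \<omega> i (b i)\<bar> \<le> (\<Prod>i\<in>?I. C)" unfolding abs_prod by (intro prod_mono) (use hb in auto)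
    then show ?thesis by simp
  qed
  have prod_h: "(\<Prod>i\<in>?I. h \<omega> i (b i)) = exp (s * interaction n p b) * ((\<Prod>j=1..p. fk \<omega> l (b (Inl j)))
      * (\<Prod>k=1..n. indicator {b (Inr k)} (Y k (real l * s) \<omega>)))" for \<omega> b
  proof -
    have "(\<Prod>i\<in>?I. h \<omega> i (b i)) = (\<Prod>j=1..p. \<psi> \<omega> l (b (Inl j))) * (\<Prod>j=1..p. fk \<omega> l (b (Inl j)))
      * (\<Prod>k=1..n. indicator {b (Inr k)} (Y k (real l * s) \<omega>))"
    proof -
      have "(\<Prod>i\<in>?I. h \<omega> i (b i)) = (\<Prod>j=1..p. h \<omega> (Inl j) (b (Inl j))) * (\<Prod>k=1..n. h \<omega> (Inr k) (b (Inr k)))"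
        by (simp add: prod.Plus)
      also have "(\<Prod>j=1..p. h \<omega> (Inl j) (b (Inl j))) = (\<Prod>j=1..p. \<psi> \<omega> l (b (Inl j))) * (\<Prod>j=1..p. fk \<omega> l (b (Inl j)))"
        by (simp add: h_def prod.distrib)
      also have "(\<Prod>k=1..n. h \<omega> (Inr k) (b (Inr k))) = (\<Prod>k=1..n. indicator {b (Inr k)} (Y k (real l * s) \<omega>))"
        by (intro prod.cong refl) (auto simp: h_def indicator_def)
      finally show ?thesis .
    qed
    \<comment> \<open>The random potential becomes a function of \<open>b\<close> because the
      indicators vanish unless the catalysts sit at \<open>b\<close>.\<close>
    moreover have "(\<Prod>j=1..p. \<psi> \<omega> l (b (Inl j))) = exp (s * interaction n p b)"
      if "\<forall>k\<in>{1..n}. Y k (real l * s) \<omega> = b (Inr k)"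
      using that by (simp add: \<psi>_def exp_sum[symmetric] interaction_def catalyst_def sum_distrib_left)
    moreover have "(\<Prod>k=1..n. indicator {b (Inr k)} (Y k (real l * s) \<omega>)) = (0 :: real)"
      if "\<not> (\<forall>k\<in>{1..n}. Y k (real l * s) \<omega> = b (Inr k))"
      using that by (auto simp: indicator_def intro!: prod_zero)
    ultimately show ?thesis by (cases "\<forall>k\<in>{1..n}. Y k (real l * s) \<omega> = b (Inr k)") simp_all
  qed
  have E: "expectation (\<lambda>\<omega>. \<Prod>i\<in>?I. h \<omega> i (b i)) = exp (s * interaction n p b) * tilted_law n p \<kappa> s M Y l b" for b
    unfolding prod_h tilted_law_def fk_def \<psi>_def by simp
  have "Trotter_step n p \<kappa> \<rho> s (tilted_law n p \<kappa> s M Y l) a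
     = all_sg (rates \<kappa> \<rho>) (particles n p) s (\<lambda>b. expectation (\<lambda>\<omega>. \<Prod>i\<in>?I. h \<omega> i (b i))) a"
    unfolding Trotter_step_def E ..
  also have "\<dots> = expectation (\<lambda>\<omega>. all_sg (rates \<kappa> \<rho>) (particles n p) s (\<lambda>b. \<Prod>i\<in>?I. h \<omega> i (b i)) a)"
    by (rule all_sg_expectation(2)[OF _ prodb]) (use s rates_nonneg in auto)
  also have "\<dots> = expectation (\<lambda>\<omega>. \<Prod>i\<in>?I. srw_semigroup (rates \<kappa> \<rho> i) s (h \<omega> i) (a i))"
    using s rates_nonneg
    by (subst all_sg_prod[OF _ distinct_particles _ hb]) (auto simp: set_particles intro!: Bochner_Integration.integral_cong prod.cong)
  also have "\<dots> = expectation (\<lambda>\<omega>. (\<Prod>j=1..p. fk \<omega> (Suc l) (a (Inl j))) * (\<Prod>k=1..n. srw_transition \<rho> s (Y k (real l * s) \<omega>) (a (Inr k))))"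
  proof (rule Bochner_Integration.integral_cong[OF refl])
    fix \<omega>
    have "srw_semigroup \<rho> s (h \<omega> (Inr k)) (a (Inr k)) = srw_transition \<rho> s (Y k (real l * s) \<omega>) (a (Inr k))" if "k \<in> {1..n}" for k
    proof -
      have "h \<omega> (Inr k) = indicator {Y k (real l * s) \<omega>}" using that by (auto simp: h_def)
      then show ?thesis by (simp add: srw_transition_def[symmetric] srw_transition_commute)
    qed
    then have "(\<Prod>k=1..n. srw_semigroup \<rho> s (h \<omega> (Inr k)) (a (Inr k))) = (\<Prod>k=1..n. srw_transition \<rho> s (Y k (real l * s) \<omega>) (a (Inr k)))"
      by (rule prod.cong[OF refl])
    moreover have "srw_semigroup \<kappa> s (h \<omega> (Inl j)) = fk \<omega> (Suc l)" for j
    proof -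
      have "h \<omega> (Inl j) = (\<lambda>z. \<psi> \<omega> l z * fk_rec \<kappa> s (\<psi> \<omega>) l z)" by (auto simp: h_def fk_def)
      then show ?thesis by (simp only: fk_def fk_rec_simps)
    qed
    ultimately show "(\<Prod>i\<in>?I. srw_semigroup (rates \<kappa> \<rho> i) s (h \<omega> i) (a i))
      = (\<Prod>j=1..p. fk \<omega> (Suc l) (a (Inl j))) * (\<Prod>k=1..n. srw_transition \<rho> s (Y k (real l * s) \<omega>) (a (Inr k)))"
      by (simp add: prod.Plus)
  qed
  also have "\<dots> = expectation (\<lambda>\<omega>. (\<Prod>j=1..p. fk \<omega> (Suc l) (a (Inl j))) * (\<Prod>k=1..n. indicator {a (Inr k)} (Y k (real (Suc l) * s) \<omega>)))"
  proof -
    \<comment> \<open>Level \<open>Suc l\<close> of \<open>fk\<close> reads the catalysts at times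
      up to \<open>l * s\<close> only, so it is a function \<open>G\<close> of their
      history.\<close>
    define \<psi>' where "\<psi>' hist j z = exp (s * (\<Sum>k=1..n. indicator {z} (hist ! j ! (k - 1))))" for hist :: "(int ^ 'd) list list" and j z
    define G where "G hist = (\<Prod>j=1..p. fk_rec \<kappa> s (\<psi>' hist) (Suc l) (a (Inl j)))" for hist
    have \<psi>'b: "\<bar>\<psi>' hist j z\<bar> \<le> c1" for hist j z
    proof -
      have "(\<Sum>k=1..n. indicator {z} (hist ! j ! (k - 1))) \<le> real (card {1..n}) * 1"
        by (rule sum_bounded_above) (simp add: indicator_def)
      then have "(\<Sum>k=1..n. indicator {z} (hist ! j ! (k - 1))) \<le> real n"
        by (simp only: card_atLeastAtMost diff_Suc_1 mult_1_right)
      from mult_left_mono[OF this s(1)]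
      have "s * (\<Sum>k=1..n. indicator {z} (hist ! j ! (k - 1))) \<le> s * real n" .
      then show ?thesis by (simp only: \<psi>'_def c1_def abs_exp_cancel exp_le_cancel_iff)
    qed
    have Gb: "\<bar>G hist\<bar> \<le> (c2 ^ Suc l) ^ p" for hist
    proof -
      have "\<bar>G hist\<bar> \<le> (\<Prod>j=1..p. c2 ^ Suc l)"
        unfolding G_def abs_prod c2_def by (intro prod_mono conjI fk_rec_bounded \<psi>'b s) auto
      then show ?thesis by simp
    qed
    have "G (map (\<lambda>i. joint_pos n Y s i \<omega>) [0..<Suc l]) = (\<Prod>j=1..p. fk \<omega> (Suc l) (a (Inl j)))" for \<omega>
    proof -
      have "\<psi>' (map (\<lambda>i. joint_pos n Y s i \<omega>) [0..<Suc l]) i z = \<psi> \<omega> i z" if "i < Suc l" for i z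
      proof -
        have "map (\<lambda>i. joint_pos n Y s i \<omega>) [0..<Suc l] ! i = joint_pos n Y s i \<omega>"
          using that by (simp del: upt_Suc)
        then show ?thesis unfolding \<psi>'_def \<psi>_def catalyst_def by (simp only: joint_pos_nth cong: sum.cong)
      qed
      then have "fk_rec \<kappa> s (\<psi>' (map (\<lambda>i. joint_pos n Y s i \<omega>) [0..<Suc l])) (Suc l) = fk_rec \<kappa> s (\<psi> \<omega>) (Suc l)"
        by (rule fk_rec_cong)
      then show ?thesis by (simp only: G_def fk_def)
    qed
    note GH = this
    show ?thesis
      using joint_pos_step[OF Y n s(1,2) p, where G = G and l = l and y = "\<lambda>k. a (Inr k)", OF Gb, symmetric]
      unfolding GH .
  qed
  also have "\<dots> = tilted_law n p \<kappa> s M Y (Suc l) a"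
    unfolding tilted_law_def fk_def \<psi>_def ..
  finally show "tilted_law n p \<kappa> s M Y (Suc l) a = Trotter_step n p \<kappa> \<rho> s (tilted_law n p \<kappa> s M Y l) a" ..
qed

lemma tilted_law_0:
  fixes Y :: "nat \<Rightarrow> real \<Rightarrow> 'a \<Rightarrow> int ^ 'd"
  assumes Y: "independent_srws M n \<rho> 0 Y" and n: "1 \<le> n"
  shows "tilted_law n p \<kappa> s M Y 0 = start_weight n"
proof
  fix a :: "nat + nat \<Rightarrow> int ^ 'd"
  interpret prob_space M by (rule independent_srws_prob_space[OF Y n])
  have srw: "simple_random_walk M \<rho> 0 (Y k)" if "k \<in> {1..n}" for k
    using Y that by (simp add: independent_srws_def)
  have "AE \<omega> in M. \<forall>k\<in>{1..n}. Y k 0 \<omega> = 0"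
    using srw by (intro AE_finite_allI) (auto simp: simple_random_walk_def)
  then have "AE \<omega> in M. (\<Prod>k=1..n. indicator {a (Inr k)} (Y k 0 \<omega>)) = start_weight n a"
    by eventually_elim (auto simp: start_weight_def indicator_def intro!: prod.cong)
  moreover have "(\<lambda>\<omega>. \<Prod>k=1..n. indicator {a (Inr k)} (Y k 0 \<omega>) :: real) \<in> borel_measurable M"
  proof (intro borel_measurable_prod)
    fix k assume "k \<in> {1..n}"
    then show "(\<lambda>\<omega>. indicator {a (Inr k)} (Y k 0 \<omega>) :: real) \<in> borel_measurable M"
      by (intro measurable_compose[OF srw_measurable[OF srw]]) auto
  qed
  ultimately have "expectation (\<lambda>\<omega>. \<Prod>k=1..n. indicator {a (Inr k)} (Y k 0 \<omega>)) = expectation (\<lambda>\<omega>. start_weight n a)"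
    by (intro integral_cong_AE) auto
  then show "tilted_law n p \<kappa> s M Y 0 a = start_weight n a"
    by (simp add: tilted_law_def prob_space)
qed

lemma tilted_law_eq_Trotter:
  fixes Y :: "nat \<Rightarrow> real \<Rightarrow> 'a \<Rightarrow> int ^ 'd"
  assumes Y: "independent_srws M n \<rho> 0 Y" and n: "1 \<le> n" and s: "0 \<le> s" "0 \<le> \<rho>" "0 \<le> \<kappa>"
    and p: "\<And>x y :: int ^ 'd. 0 \<le> srw_transition \<rho> s x y"
  shows "tilted_law n p \<kappa> s M Y m = (Trotter_step n p \<kappa> \<rho> s ^^ m) (start_weight n)"
  by (induction m) (simp_all add: tilted_law_0[OF Y n] tilted_law_Suc[OF assms])

section \<open>The parabolic Anderson model as a limit of hopping operators\<close>

definition pam_edges :: "nat \<Rightarrow> nat \<Rightarrow> ((nat + nat) \<times> (int ^ 'd)) set"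
  where "pam_edges n p = ({1..p} <+> {1..n}) \<times> unit_steps"

definition pam_move :: "'i \<times> (int ^ 'd) \<Rightarrow> ('i \<Rightarrow> int ^ 'd) \<Rightarrow> 'i \<Rightarrow> int ^ 'd"
  where "pam_move e a = a(fst e := a (fst e) + snd e)"

definition pam_inverse :: "'i \<times> (int ^ 'd) \<Rightarrow> 'i \<times> (int ^ 'd)"
  where "pam_inverse e = (fst e, - snd e)"

definition pam_rate :: "real \<Rightarrow> real \<Rightarrow> (nat + nat) \<times> (int ^ 'd) \<Rightarrow> real"
  where "pam_rate \<kappa> \<rho> e = rates \<kappa> \<rho> (fst e)"

lemma interaction_nonneg: "0 \<le> interaction n p a"
  unfolding interaction_def by (intro sum_nonneg) auto

lemma interaction_le: "interaction n p a \<le> real (p * n)"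
proof -
  have "interaction n p a \<le> (\<Sum>j=1..p. \<Sum>k=1..n. 1)"
    unfolding interaction_def by (intro sum_mono) (auto simp: indicator_def)
  then show ?thesis by simp
qed

lemma hopping_pam:
  assumes "0 \<le> \<kappa>" "0 \<le> \<rho>"
  shows "hopping (pam_edges n p) pam_move pam_inverse (pam_rate \<kappa> \<rho>)
    (interaction n p :: (nat + nat \<Rightarrow> int ^ 'd) \<Rightarrow> real) (real (p * n))"
proof
  show "finite (pam_edges n p :: ((nat + nat) \<times> (int ^ 'd)) set)" by (simp add: pam_edges_def)
  show "0 \<le> pam_rate \<kappa> \<rho> e" for e :: "(nat + nat) \<times> (int ^ 'd)"
    using assms by (simp add: pam_rate_def rates_nonneg)
qed (auto simp: pam_edges_def pam_inverse_def pam_move_def pam_rate_def uminus_unit_steps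
       interaction_nonneg interaction_le simp del: of_nat_mult)

abbreviation "pam_H n p \<kappa> \<rho> \<equiv> hopping.H (pam_edges n p) pam_move (pam_rate \<kappa> \<rho>) (interaction n p)"
abbreviation "pam_Q n p \<kappa> \<rho> \<equiv> hopping.Q (pam_edges n p) pam_move (pam_rate \<kappa> \<rho>) (interaction n p)"

text \<open>The coordinate Laplacians add up to the hopping part of \<open>H\<close>, and the
  exponential factor contributes the potential.\<close>

lemma generated_by_Trotter_step:
  assumes "0 \<le> \<kappa>" "0 \<le> \<rho>"
  shows "generated_by (Trotter_step n p \<kappa> \<rho>) (pam_H n p \<kappa> \<rho> :: _ \<Rightarrow> (nat + nat \<Rightarrow> int ^ 'd) \<Rightarrow> real)"
proof -
  interpret hopping "pam_edges n p" pam_move pam_inverse "pam_rate \<kappa> \<rho>"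
    "interaction n p :: (nat + nat \<Rightarrow> int ^ 'd) \<Rightarrow> real" "real (p * n)"
    by (rule hopping_pam[OF assms])
  have H_eq: "H f a = (\<Sum>i\<leftarrow>particles n p. rates \<kappa> \<rho> i * coord_lap i f a) + interaction n p a * f a" for f a
  proof -
    have "(\<Sum>e\<in>pam_edges n p. pam_rate \<kappa> \<rho> e * (f (pam_move e a) - f a))
      = (\<Sum>i\<in>{1..p} <+> {1..n}. \<Sum>v\<in>unit_steps. rates \<kappa> \<rho> i * (f (a(i := a i + v)) - f a))"
      unfolding pam_edges_def sum.cartesian_product by (rule sum.cong) (auto simp: pam_rate_def pam_move_def)
    also have "\<dots> = (\<Sum>i\<in>{1..p} <+> {1..n}. rates \<kappa> \<rho> i * coord_lap i f a)"
      by (simp add: coord_lap_def laplacian_eq sum_distrib_left)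
    also have "\<dots> = (\<Sum>i\<leftarrow>particles n p. rates \<kappa> \<rho> i * coord_lap i f a)"
      by (simp add: sum_list_distinct_conv_sum_set[OF distinct_particles] set_particles)
    finally show ?thesis by (simp add: H_def)
  qed
  have "H = (\<lambda>f a. (\<Sum>i\<leftarrow>particles n p. rates \<kappa> \<rho> i * coord_lap i f a) + interaction n p a * f a)"
    by (intro ext H_eq)
  moreover have "Trotter_step n p \<kappa> \<rho> = (\<lambda>s f. all_sg (rates \<kappa> \<rho>) (particles n p) s
      (\<lambda>b. exp (s * interaction n p b) * (f :: (nat + nat \<Rightarrow> int ^ 'd) \<Rightarrow> real) b))"
    by (auto simp: Trotter_step_def fun_eq_iff)
  moreover have "generated_by \<dots> (\<lambda>f a. (\<Sum>i\<leftarrow>particles n p. rates \<kappa> \<rho> i * coord_lap i f a) + interaction n p a * f a)"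
    by (rule generated_by_comp[OF generated_by_all_sg[OF rates_nonneg[OF assms]]
          generated_by_exp[OF interaction_nonneg interaction_le]])
  ultimately show ?thesis by simp
qed

lemma start_weight_cases: "start_weight n a = (if \<forall>k\<in>{1..n}. a (Inr k) = 0 then 1 else 0)"
  by (auto simp: start_weight_def indicator_def intro!: prod_zero)

text \<open>Positivity of both kernels is recorded as an assumption: it is obtained from walks with
  arbitrary starting points, whereas the catalysts of this locale start at 0.\<close>

locale parabolic_anderson =
  fixes n p :: nat and \<kappa> \<rho> :: real and M :: "'a measure" and Y :: "nat \<Rightarrow> real \<Rightarrow> 'a \<Rightarrow> int ^ 'd"
    and P :: "int ^ 'd \<Rightarrow> 'b measure" and X :: "real \<Rightarrow> 'b \<Rightarrow> int ^ 'd"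
  assumes n: "1 \<le> n" and nonneg: "0 \<le> \<kappa>" "0 \<le> \<rho>"
    and Y: "independent_srws M n \<rho> 0 Y"
    and X: "\<And>x. simple_random_walk (P x) \<kappa> x X"
    and pk: "\<And>s x y :: int ^ 'd. 0 \<le> s \<Longrightarrow> 0 \<le> srw_transition \<kappa> s x y"
    and pr: "\<And>s x y :: int ^ 'd. 0 \<le> s \<Longrightarrow> 0 \<le> srw_transition \<rho> s x y"
begin

lemma Y_srw: "k \<in> {1..n} \<Longrightarrow> simple_random_walk M \<rho> 0 (Y k)"
  using Y by (simp add: independent_srws_def)

text \<open>For fixed catalysts \<open>fk_rec\<close> is the expectation of the exponential of a
  Riemann sum, and dominated convergence leads to the Feynman-Kac formula. At most \<open>n\<close>
  catalysts occupy a site, hence the bound \<open>exp (t * n)\<close>.\<close>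

lemma fk_rec_tendsto_feynman_kac:
  assumes t: "0 < t" and \<omega>: "\<omega> \<in> space M"
  shows "(\<lambda>m. fk_rec \<kappa> (t / real m) (\<lambda>j z. exp (t / real m * catalyst n Y \<omega> z (real j * (t / real m)))) m x)
      \<longlonglongrightarrow> feynman_kac P X (catalyst n Y \<omega>) x t" (is "?u \<longlonglongrightarrow> _")
    and "\<bar>fk_rec \<kappa> (t / real m) (\<lambda>j z. exp (t / real m * catalyst n Y \<omega> z (real j * (t / real m)))) m x\<bar> \<le> exp (t * real n)"
proof -
  interpret X: prob_space "P x" using X[of x] by (simp add: simple_random_walk_def)
  define R where "R m w = (\<Sum>i=1..m. t / real m * catalyst n Y \<omega> (X (real i * (t / real m)) w) (t - real i * (t / real m)))" for m w
  have Xm: "X (real i * (t / real m)) \<in> P x \<rightarrow>\<^sub>M count_space UNIV" for i m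
    using srw_measurable[OF X[of x]] t by simp
  have Rm [measurable]: "R m \<in> borel_measurable (P x)" for m
    unfolding R_def by (intro borel_measurable_sum borel_measurable_times borel_measurable_const measurable_compose[OF Xm]) simp
  have Rb: "R m w \<le> t * real n" for m w
  proof -
    have "R m w \<le> (\<Sum>i=1..m. t / real m * real n)"
      unfolding R_def using t catalyst_bounded[of n Y \<omega>] by (intro sum_mono mult_left_mono) (auto simp: abs_le_iff)
    also have "\<dots> \<le> t * real n" using t by simp
    finally show ?thesis .
  qed
  have u_eq: "?u m = X.expectation (\<lambda>w. exp (R m w))" for m
  proof -
    let ?\<psi> = "\<lambda>j z. exp (t / real m * catalyst n Y \<omega> z (real j * (t / real m)))"
    have tm: "0 \<le> t / real m" using t by simp
    have "?u m = X.expectation (\<lambda>w. \<Prod>i=1..m. ?\<psi> (m - i) (X (real i * (t / real m)) w))"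
      by (rule srw_expectation_prod[OF X tm nonneg(1) pk[OF tm] exp_catalyst_bounded[OF tm], symmetric])
    also have "\<dots> = X.expectation (\<lambda>w. exp (R m w))"
    proof (rule Bochner_Integration.integral_cong[OF refl])
      fix w
      have "real (m - i) * (t / real m) = t - real i * (t / real m)" if "i \<in> {1..m}" for i
        using that by (simp add: of_nat_diff left_diff_distrib diff_divide_distrib)
      then have "(\<Prod>i=1..m. ?\<psi> (m - i) (X (real i * (t / real m)) w))
        = (\<Prod>i=1..m. exp (t / real m * catalyst n Y \<omega> (X (real i * (t / real m)) w) (t - real i * (t / real m))))"
        by (intro prod.cong refl) simp
      then show "(\<Prod>i=1..m. ?\<psi> (m - i) (X (real i * (t / real m)) w)) = exp (R m w)"
        by (simp add: R_def exp_sum)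
    qed
    finally show ?thesis .
  qed
  have Rlim: "(\<lambda>m. R m w) \<longlonglongrightarrow> (LINT s:{0..t}|lborel. catalyst n Y \<omega> (X s w) (t - s))" if "w \<in> space (P x)" for w
    unfolding R_def by (rule Riemann_sum_catalyst[OF t Y_srw \<omega> X that])
  have "(\<lambda>m. X.expectation (\<lambda>w. exp (R m w))) \<longlonglongrightarrow> feynman_kac P X (catalyst n Y \<omega>) x t"
    unfolding feynman_kac_def
  proof (rule integral_dominated_convergence[where w = "\<lambda>_. exp (t * real n)"])
    show "(\<lambda>w. exp (LINT s:{0..t}|lborel. catalyst n Y \<omega> (X s w) (t - s))) \<in> borel_measurable (P x)"
      by (rule borel_measurable_LIMSEQ_real[where u = "\<lambda>m w. exp (R m w)"]) (auto intro!: tendsto_exp Rlim)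
    show "AE w in P x. (\<lambda>m. exp (R m w)) \<longlonglongrightarrow> exp (LINT s:{0..t}|lborel. catalyst n Y \<omega> (X s w) (t - s))"
      by (intro AE_I2 tendsto_exp Rlim)
    show "AE w in P x. norm (exp (R m w)) \<le> exp (t * real n)" for m
      using Rb by simp
  qed simp_all
  then show "?u \<longlonglongrightarrow> feynman_kac P X (catalyst n Y \<omega>) x t" by (simp only: u_eq)
  have "\<bar>X.expectation (\<lambda>w. exp (R m w))\<bar> \<le> exp (t * real n)"
  proof -
    have "X.expectation (\<lambda>w. exp (R m w)) \<le> X.expectation (\<lambda>w. exp (t * real n))"
      using Rb by (intro Bochner_Integration.integral_mono X.integrable_const_bound[of _ "exp (t * real n)"]) auto
    moreover have "0 \<le> X.expectation (\<lambda>w. exp (R m w))" by (intro Bochner_Integration.integral_nonneg) simp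
    ultimately show ?thesis by (simp add: X.prob_space)
  qed
  then show "\<bar>?u m\<bar> \<le> exp (t * real n)" by (simp only: u_eq)
qed

text \<open>The path functional is a limit of functions of the catalysts at finitely many
  times.\<close>

lemma feynman_kac_measurable:
  assumes t: "0 < t"
  shows "(\<lambda>\<omega>. feynman_kac P X (catalyst n Y \<omega>) x t) \<in> borel_measurable M"
proof (rule borel_measurable_LIMSEQ_real)
  show "(\<lambda>\<omega>. fk_rec \<kappa> (t / real m) (\<lambda>j z. exp (t / real m * catalyst n Y \<omega> z (real j * (t / real m)))) m x) \<in> borel_measurable M" for m
    by (rule fk_rec_measurable[OF Y n _ nonneg(1)]) (use t in simp)
qed (rule fk_rec_tendsto_feynman_kac(1)[OF t])

lemma feynman_kac_bounds:
  assumes t: "0 < t" and \<omega>: "\<omega> \<in> space M"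
  shows "0 \<le> feynman_kac P X (catalyst n Y \<omega>) x t" "feynman_kac P X (catalyst n Y \<omega>) x t \<le> exp (t * real n)"
proof -
  show "0 \<le> feynman_kac P X (catalyst n Y \<omega>) x t"
    unfolding feynman_kac_def by (intro Bochner_Integration.integral_nonneg) simp
  show "feynman_kac P X (catalyst n Y \<omega>) x t \<le> exp (t * real n)"
    by (rule LIMSEQ_le_const2[OF fk_rec_tendsto_feynman_kac(1)[OF t \<omega>]])
       (use fk_rec_tendsto_feynman_kac(2)[OF t \<omega>] in \<open>auto simp: abs_le_iff\<close>)
qed

lemma indicator_prod_measurable:
  assumes "0 \<le> t"
  shows "(\<lambda>\<omega>. \<Prod>k=1..n. indicator {y k} (Y k t \<omega>) :: real) \<in> borel_measurable M"
proof (intro borel_measurable_prod)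
  fix k assume "k \<in> {1..n}"
  then show "(\<lambda>\<omega>. indicator {y k} (Y k t \<omega>) :: real) \<in> borel_measurable M"
    by (intro measurable_compose[OF srw_measurable[OF Y_srw assms]]) auto
qed

lemma indicator_prod_bounded: "\<bar>\<Prod>k=1..n. indicator {y k} (Y k t \<omega>) :: real\<bar> \<le> 1"
  unfolding abs_prod by (intro prod_le_1) (auto simp: indicator_def)

lemma tilted_law_tendsto:
  assumes t: "0 < t"
  shows "(\<lambda>m. tilted_law n p \<kappa> (t / real m) M Y m (case_sum (\<lambda>_. x) y))
    \<longlonglongrightarrow> (\<integral>\<omega>. feynman_kac P X (catalyst n Y \<omega>) x t ^ p * (\<Prod>k=1..n. indicator {y k} (Y k t \<omega>)) \<partial>M)"
proof -
  interpret prob_space M by (rule independent_srws_prob_space[OF Y n])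
  define u where "u m \<omega> = fk_rec \<kappa> (t / real m) (\<lambda>j z. exp (t / real m * catalyst n Y \<omega> z (real j * (t / real m)))) m x" for m \<omega>
  note lim = fk_rec_tendsto_feynman_kac[OF t, where x = x, folded u_def]
  have um: "u m \<in> borel_measurable M" for m
    unfolding u_def using t by (intro fk_rec_measurable[OF Y n] nonneg) auto
  note meas = borel_measurable_times[OF borel_measurable_power indicator_prod_measurable[OF less_imp_le[OF t], of y]]
  have "(\<lambda>m. expectation (\<lambda>\<omega>. u m \<omega> ^ p * (\<Prod>k=1..n. indicator {y k} (Y k t \<omega>))))
    \<longlonglongrightarrow> expectation (\<lambda>\<omega>. feynman_kac P X (catalyst n Y \<omega>) x t ^ p * (\<Prod>k=1..n. indicator {y k} (Y k t \<omega>)))"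
  proof (rule integral_dominated_convergence[where w = "\<lambda>_. exp (t * real n) ^ p * 1"])
    show "AE \<omega> in M. (\<lambda>m. u m \<omega> ^ p * (\<Prod>k=1..n. indicator {y k} (Y k t \<omega>)))
      \<longlonglongrightarrow> feynman_kac P X (catalyst n Y \<omega>) x t ^ p * (\<Prod>k=1..n. indicator {y k} (Y k t \<omega>))"
      by (intro AE_I2 tendsto_mult tendsto_power tendsto_const lim)
    show "AE \<omega> in M. norm (u m \<omega> ^ p * (\<Prod>k=1..n. indicator {y k} (Y k t \<omega>))) \<le> exp (t * real n) ^ p * 1" for m
    proof (rule AE_I2)
      fix \<omega> assume "\<omega> \<in> space M"
      then show "norm (u m \<omega> ^ p * (\<Prod>k=1..n. indicator {y k} (Y k t \<omega>))) \<le> exp (t * real n) ^ p * 1"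
        unfolding real_norm_def abs_mult power_abs
        by (intro mult_mono power_mono lim(2) indicator_prod_bounded) auto
    qed
  qed (rule meas feynman_kac_measurable[OF t] um integrable_const)+
  then show ?thesis
  proof (rule Lim_transform_eventually)
    show "\<forall>\<^sub>F m in sequentially. expectation (\<lambda>\<omega>. u m \<omega> ^ p * (\<Prod>k=1..n. indicator {y k} (Y k t \<omega>)))
        = tilted_law n p \<kappa> (t / real m) M Y m (case_sum (\<lambda>_. x) y)"
      using eventually_gt_at_top[of 0] by eventually_elim (simp add: tilted_law_def u_def)
  qed
qed

text \<open>The bridge from probability to operators: \<open>tilted_law\<close> converges to the
  moment with prescribed catalyst endpoint and equals a power of the Trotter step, which by the
  product formula has the same limit as the power of \<open>Q\<close>.\<close>

lemma pam_Q_pow_tendsto: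
  assumes t: "0 < t"
  shows "(\<lambda>m. (pam_Q n p \<kappa> \<rho> (t / real m) ^^ m) (start_weight n) (case_sum (\<lambda>_. x) y))
    \<longlonglongrightarrow> (\<integral>\<omega>. feynman_kac P X (catalyst n Y \<omega>) x t ^ p * (\<Prod>k=1..n. indicator {y k} (Y k t \<omega>)) \<partial>M)" (is "?q \<longlonglongrightarrow> ?l")
proof -
  interpret hopping "pam_edges n p" pam_move pam_inverse "pam_rate \<kappa> \<rho>"
    "interaction n p :: (nat + nat \<Rightarrow> int ^ 'd) \<Rightarrow> real" "real (p * n)"
    by (rule hopping_pam[OF nonneg])
  let ?T = "\<lambda>m. (Trotter_step n p \<kappa> \<rho> (t / real m) ^^ m) (start_weight n) (case_sum (\<lambda>_. x) y)"
  have "(\<lambda>m. ?T m - ?q m) \<longlonglongrightarrow> 0"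
    by (rule Chernoff_product[OF generated_by_Trotter_step[OF nonneg], where C = 1])
       (use t in \<open>auto simp: start_weight_cases Q_def\<close>)
  moreover have "?T \<longlonglongrightarrow> ?l"
    using tilted_law_tendsto[OF t, of x y] tilted_law_eq_Trotter[OF Y n _ nonneg(2,1) pr, of "t / real _"] t
    by simp
  ultimately have "(\<lambda>m. ?T m - (?T m - ?q m)) \<longlonglongrightarrow> ?l - 0" by (intro tendsto_diff)
  then show ?thesis by simp
qed

end

section \<open>Upper bound\<close>

definition l1norm :: "int ^ 'd \<Rightarrow> nat"
  where "l1norm v = (\<Sum>c\<in>UNIV. nat \<bar>v $ c\<bar>)"

lemma l1norm_zero [simp]: "l1norm 0 = 0"
  by (simp add: l1norm_def)

lemma l1norm_add_unit_step:
  assumes "v \<in> unit_steps" shows "l1norm (x + v) \<le> Suc (l1norm x)"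
proof -
  have "int (\<Sum>c\<in>UNIV. nat \<bar>v $ c\<bar>) = 1"
    using assms by (simp add: unit_steps_def nearest_neighbours_def)
  then have v: "(\<Sum>c\<in>UNIV. nat \<bar>v $ c\<bar>) = 1" by linarith
  have "l1norm (x + v) \<le> (\<Sum>c\<in>UNIV. nat \<bar>x $ c\<bar> + nat \<bar>v $ c\<bar>)"
    unfolding l1norm_def by (intro sum_mono) auto
  then show ?thesis using v by (simp add: l1norm_def sum.distrib)
qed

lemma sum_exp_abs_le:
  fixes \<epsilon> :: real
  assumes "0 < \<epsilon>" "finite F"
  shows "(\<Sum>k\<in>F. exp (- \<epsilon> * \<bar>real_of_int k\<bar>)) \<le> 2 / (1 - exp (- \<epsilon>))"
proof -
  have q: "0 < exp (- \<epsilon>)" "exp (- \<epsilon>) < 1" using assms by auto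
  have geo: "(\<Sum>k\<in>G. exp (- \<epsilon>) ^ k) \<le> 1 / (1 - exp (- \<epsilon>))" if "finite G" for G :: "nat set"
  proof -
    have "(\<Sum>k\<in>G. exp (- \<epsilon>) ^ k) \<le> suminf (\<lambda>k. exp (- \<epsilon>) ^ k)"
      using q that by (intro sum_le_suminf summable_geometric) auto
    then show ?thesis using q by (simp add: suminf_geometric)
  qed
  have pw: "exp (- \<epsilon> * \<bar>real_of_int k\<bar>) = exp (- \<epsilon>) ^ nat \<bar>k\<bar>" for k
    by (simp add: exp_of_nat_mult[symmetric] mult.commute)
  have part: "(\<Sum>k\<in>G. exp (- \<epsilon> * \<bar>real_of_int k\<bar>)) \<le> 1 / (1 - exp (- \<epsilon>))"
    if "finite G" "inj_on (\<lambda>k. nat \<bar>k\<bar>) G" for G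
  proof -
    have "(\<Sum>k\<in>G. exp (- \<epsilon> * \<bar>real_of_int k\<bar>)) = (\<Sum>k\<in>(\<lambda>k. nat \<bar>k\<bar>) ` G. exp (- \<epsilon>) ^ k)"
      unfolding pw by (subst sum.reindex[OF that(2)]) simp
    then show ?thesis using geo[of "(\<lambda>k. nat \<bar>k\<bar>) ` G"] that(1) by simp
  qed
  have "(\<Sum>k\<in>F. exp (- \<epsilon> * \<bar>real_of_int k\<bar>)) = (\<Sum>k\<in>{k\<in>F. 0 \<le> k} \<union> {k\<in>F. k < 0}. exp (- \<epsilon> * \<bar>real_of_int k\<bar>))"
    by (rule sum.cong) auto
  also have "\<dots> = (\<Sum>k\<in>{k\<in>F. 0 \<le> k}. exp (- \<epsilon> * \<bar>real_of_int k\<bar>)) + (\<Sum>k\<in>{k\<in>F. k < 0}. exp (- \<epsilon> * \<bar>real_of_int k\<bar>))"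
    using assms by (intro sum.union_disjoint) auto
  also have "\<dots> \<le> 1 / (1 - exp (- \<epsilon>)) + 1 / (1 - exp (- \<epsilon>))"
    using assms by (intro add_mono part) (auto simp: inj_on_def)
  finally show ?thesis by simp
qed

text \<open>The exponential factorises over all scalar coordinates, and \<open>T\<close> embeds in a
  finite box, over which the sum of products is a product of sums bounded by geometric series.
  Indices outside \<open>J\<close> are fixed by \<open>z0\<close>, so a configuration is determined
  by its values on \<open>J\<close>. The bound is uniform in \<open>T\<close>.\<close>

lemma sum_exp_l1norm_le:
  fixes J :: "'i set" and z0 :: "'i \<Rightarrow> int ^ 'd"
  assumes "0 < \<epsilon>" "finite J"
  shows "\<exists>K\<ge>0. \<forall>T. finite T \<longrightarrow> (\<forall>a\<in>T. \<forall>i. i \<notin> J \<longrightarrow> a i = z0 i) \<longrightarrow>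
    (\<Sum>a\<in>T. exp (- \<epsilon> * real (\<Sum>i\<in>J. l1norm (a i)))) \<le> K"
proof (intro exI conjI allI impI)
  let ?c = "2 / (1 - exp (- \<epsilon>))"
  let ?P = "J \<times> (UNIV :: 'd set)"
  have c: "0 \<le> ?c" using assms by simp
  show "0 \<le> ?c ^ card ?P" using c by simp
  fix T :: "('i \<Rightarrow> int ^ 'd) set"
  assume T: "finite T" "\<forall>a\<in>T. \<forall>i. i \<notin> J \<longrightarrow> a i = z0 i"
  define G where "G a = (\<lambda>(i, c)\<in>?P. a i $ c)" for a :: "'i \<Rightarrow> int ^ 'd"
  define F where "F = (\<lambda>(a, i, c). a i $ c) ` (T \<times> ?P)"
  have F: "finite F" using T assms by (simp add: F_def)
  have inj: "inj_on G T"
  proof (rule inj_onI)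
    fix a b assume ab: "a \<in> T" "b \<in> T" "G a = G b"
    show "a = b"
    proof
      fix i show "a i = b i"
      proof (cases "i \<in> J")
        case True
        have "a i $ c = b i $ c" for c
          using fun_cong[OF ab(3), of "(i, c)"] True by (simp add: G_def)
        then show ?thesis by (simp add: vec_eq_iff)
      next
        case False
        then show ?thesis using T(2) ab(1,2) by metis
      qed
    qed
  qed
  have "(\<Sum>a\<in>T. exp (- \<epsilon> * real (\<Sum>i\<in>J. l1norm (a i)))) = (\<Sum>a\<in>T. \<Prod>x\<in>?P. exp (- \<epsilon> * \<bar>real_of_int (G a x)\<bar>))"
  proof (rule sum.cong[OF refl])
    fix a
    have "(\<Prod>x\<in>?P. exp (- \<epsilon> * \<bar>real_of_int (G a x)\<bar>)) = exp (\<Sum>x\<in>?P. - \<epsilon> * \<bar>real_of_int (G a x)\<bar>)"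
      using assms by (simp add: exp_sum)
    also have "(\<Sum>x\<in>?P. - \<epsilon> * \<bar>real_of_int (G a x)\<bar>) = (\<Sum>(i, c)\<in>?P. - \<epsilon> * real (nat \<bar>a i $ c\<bar>))"
      by (rule sum.cong) (auto simp: G_def)
    also have "\<dots> = - \<epsilon> * real (\<Sum>i\<in>J. l1norm (a i))"
      by (simp only: sum.cartesian_product[symmetric] l1norm_def of_nat_sum sum_distrib_left)
    finally show "exp (- \<epsilon> * real (\<Sum>i\<in>J. l1norm (a i))) = (\<Prod>x\<in>?P. exp (- \<epsilon> * \<bar>real_of_int (G a x)\<bar>))" ..
  qed
  also have "\<dots> = (\<Sum>g\<in>G ` T. \<Prod>x\<in>?P. exp (- \<epsilon> * \<bar>real_of_int (g x)\<bar>))"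
    by (simp add: sum.reindex[OF inj])
  also have "\<dots> \<le> (\<Sum>g\<in>PiE ?P (\<lambda>_. F). \<Prod>x\<in>?P. exp (- \<epsilon> * \<bar>real_of_int (g x)\<bar>))"
  proof (rule sum_mono2)
    show "finite (PiE ?P (\<lambda>_. F))" using assms F by (intro finite_PiE) auto
    show "G ` T \<subseteq> PiE ?P (\<lambda>_. F)"
    proof (intro image_subsetI PiE_I)
      fix a x assume "a \<in> T" "x \<in> ?P"
      then show "G a x \<in> F" unfolding F_def by (intro image_eqI[of _ _ "(a, fst x, snd x)"]) (auto simp: G_def)
    qed (auto simp: G_def)
  qed (auto intro: prod_nonneg)
  also have "\<dots> = (\<Prod>x\<in>?P. \<Sum>k\<in>F. exp (- \<epsilon> * \<bar>real_of_int k\<bar>))"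
    using assms F by (subst prod_sum_PiE) auto
  also have "\<dots> \<le> (\<Prod>x\<in>?P. ?c)"
    using sum_exp_abs_le[OF assms(1) F] by (intro prod_mono) (auto intro: sum_nonneg)
  finally show "(\<Sum>a\<in>T. exp (- \<epsilon> * real (\<Sum>i\<in>J. l1norm (a i)))) \<le> ?c ^ card ?P" by simp
qed

lemma finite_l1norm_le: "finite {v :: int ^ 'd. l1norm v \<le> N}"
proof -
  have "{v :: int ^ 'd. l1norm v \<le> N} \<subseteq> vec_lambda ` (PiE UNIV (\<lambda>_. {- int N..int N}))"
  proof
    fix v :: "int ^ 'd" assume v: "v \<in> {v. l1norm v \<le> N}"
    have "nat \<bar>v $ c\<bar> \<le> l1norm v" for c unfolding l1norm_def by (intro member_le_sum) auto
    then have "nat \<bar>v $ c\<bar> \<le> N" for c using v order_trans by blast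
    then have "v $ c \<in> {- int N..int N}" for c by (simp add: nat_le_iff abs_le_iff minus_le_iff)
    then have "vec_nth v \<in> PiE UNIV (\<lambda>_. {- int N..int N})" by auto
    then show "v \<in> vec_lambda ` (PiE UNIV (\<lambda>_. {- int N..int N}))" by (metis image_eqI vec_nth_inverse)
  qed
  then show ?thesis by (rule finite_subset) (intro finite_imageI finite_PiE; simp)
qed

lemma finite_configurations:
  fixes z0 :: "'i \<Rightarrow> int ^ 'd"
  assumes "finite J"
  shows "finite {a. (\<forall>i. i \<notin> J \<longrightarrow> a i = z0 i) \<and> (\<Sum>i\<in>J. l1norm (a i)) \<le> N}"
proof -
  have "{a. (\<forall>i. i \<notin> J \<longrightarrow> a i = z0 i) \<and> (\<Sum>i\<in>J. l1norm (a i)) \<le> N}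
    \<subseteq> (\<lambda>g i. if i \<in> J then g i else z0 i) ` (PiE J (\<lambda>_. {v. l1norm v \<le> N}))"
  proof
    fix a assume a: "a \<in> {a. (\<forall>i. i \<notin> J \<longrightarrow> a i = z0 i) \<and> (\<Sum>i\<in>J. l1norm (a i)) \<le> N}"
    have "l1norm (a i) \<le> N" if "i \<in> J" for i
      using member_le_sum[of i J "\<lambda>i. l1norm (a i)"] that assms a by simp
    then have "restrict a J \<in> PiE J (\<lambda>_. {v. l1norm v \<le> N})" by auto
    moreover have "a = (\<lambda>i. if i \<in> J then restrict a J i else z0 i)" using a by auto
    ultimately show "a \<in> (\<lambda>g i. if i \<in> J then g i else z0 i) ` (PiE J (\<lambda>_. {v. l1norm v \<le> N}))" by blast
  qed
  then show ?thesis by (rule finite_subset) (intro finite_imageI finite_PiE assms finite_l1norm_le)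
qed

definition pam_Lam :: "'d::finite itself \<Rightarrow> nat \<Rightarrow> nat \<Rightarrow> real \<Rightarrow> real \<Rightarrow> real"
  where "pam_Lam _ n p \<kappa> \<rho> =
    hopping.Lam (pam_edges n p) pam_move (pam_rate \<kappa> \<rho>) (interaction n p :: (nat + nat \<Rightarrow> int ^ 'd) \<Rightarrow> real)"

context parabolic_anderson
begin

definition endpoint_moment :: "int ^ 'd \<Rightarrow> (nat \<Rightarrow> int ^ 'd) \<Rightarrow> real \<Rightarrow> real"
  where "endpoint_moment x y t = (\<integral>\<omega>. feynman_kac P X (catalyst n Y \<omega>) x t ^ p * (\<Prod>k=1..n. indicator {y k} (Y k t \<omega>)) \<partial>M)"

text \<open>The weight decays in the coordinates of the walks, which makes the start weight square
  summable, and grows in those of the catalysts, which makes the bound decay in the endpoint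
  \<open>y\<close>. Letting the number of steps tend to infinity removes the second-order
  constant.\<close>

lemma endpoint_moment_upper:
  assumes \<epsilon>: "0 < \<epsilon>"
  shows "\<exists>C\<ge>0. \<exists>c. \<forall>y t. 0 < t \<longrightarrow> (\<forall>k. k \<notin> {1..n} \<longrightarrow> y k = 0) \<longrightarrow>
    endpoint_moment x y t \<le> C * exp (- \<epsilon> * real (\<Sum>k=1..n. l1norm (y k)))
      * exp (t * (pam_Lam TYPE('d) n p \<kappa> \<rho> + (exp \<epsilon> - 1) * (\<Sum>e\<in>(pam_edges n p :: ((nat + nat) \<times> (int ^ 'd)) set). pam_rate \<kappa> \<rho> e)))"
proof -
  interpret hopping "pam_edges n p" pam_move pam_inverse "pam_rate \<kappa> \<rho>"
    "interaction n p :: (nat + nat \<Rightarrow> int ^ 'd) \<Rightarrow> real" "real (p * n)"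
    by (rule hopping_pam[OF nonneg])
  let ?I = "{1..p} <+> {1..n}"
  define w where "w a = exp (\<epsilon> * (real (\<Sum>k=1..n. l1norm (a (Inr k))) - real (\<Sum>j=1..p. l1norm (a (Inl j)))))"
    for a :: "nat + nat \<Rightarrow> int ^ 'd"
  \<comment> \<open>Indices that are not particles are pinned at the values they have in the
    configuration of interest; otherwise there would be infinitely many configurations of bounded
    rank.\<close>
  define z0 :: "nat + nat \<Rightarrow> int ^ 'd" where "z0 = case_sum (\<lambda>_. x) (\<lambda>_. 0)"
  define S where "S = {a. \<forall>i. i \<notin> ?I \<longrightarrow> a i = z0 i}"
  define rk where "rk a = (\<Sum>i\<in>?I. l1norm (a i))" for a :: "nat + nat \<Rightarrow> int ^ 'd"
  have split: "(\<Sum>i\<in>?I. l1norm (a i)) = (\<Sum>j=1..p. l1norm (a (Inl j))) + (\<Sum>k=1..n. l1norm (a (Inr k)))"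
    for a :: "nat + nat \<Rightarrow> int ^ 'd" by (simp add: sum.Plus)
  have change: "(\<Sum>i\<in>J. l1norm (pam_move e a i)) \<le> Suc (\<Sum>i\<in>J. l1norm (a i))"
    if "e \<in> pam_edges n p" "finite J" for e J and a :: "nat + nat \<Rightarrow> int ^ 'd"
  proof (cases "fst e \<in> J")
    case True
    have "(\<Sum>i\<in>J. l1norm (pam_move e a i)) = l1norm (a (fst e) + snd e) + (\<Sum>i\<in>J - {fst e}. l1norm (a i))"
      using that True by (subst sum.remove[of J "fst e"]) (auto simp: pam_move_def intro!: sum.cong)
    also have "\<dots> \<le> Suc (l1norm (a (fst e))) + (\<Sum>i\<in>J - {fst e}. l1norm (a i))"
      using that by (intro add_right_mono l1norm_add_unit_step) (auto simp: pam_edges_def)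
    also have "\<dots> = Suc (\<Sum>i\<in>J. l1norm (a i))"
      using that True by (subst sum.remove[of J "fst e"]) auto
    finally show ?thesis .
  next
    case False
    then have "(\<Sum>i\<in>J. l1norm (pam_move e a i)) = (\<Sum>i\<in>J. l1norm (a i))"
      by (intro sum.cong) (auto simp: pam_move_def)
    then show ?thesis by simp
  qed
  have w_mv: "w a \<le> exp \<epsilon> * w (pam_move e a)" if e: "e \<in> pam_edges n p" for e a
  proof -
    let ?b = "pam_move e a"
    have back_eq: "a = pam_move (pam_inverse e) ?b" by (simp add: mv_inv)
    have "real (\<Sum>k=1..n. l1norm (a (Inr k))) - real (\<Sum>j=1..p. l1norm (a (Inl j)))
      \<le> 1 + (real (\<Sum>k=1..n. l1norm (?b (Inr k))) - real (\<Sum>j=1..p. l1norm (?b (Inl j))))"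
    proof (cases "fst e")
      case (Inl j)
      have "(\<Sum>k=1..n. l1norm (a (Inr k))) = (\<Sum>k=1..n. l1norm (?b (Inr k)))"
        using Inl by (simp add: pam_move_def)
      moreover have "(\<Sum>j=1..p. l1norm (?b (Inl j))) \<le> Suc (\<Sum>j=1..p. l1norm (a (Inl j)))"
        using change[OF e, of "Inl ` {1..p}" a] by (simp add: sum.reindex)
      ultimately show ?thesis by linarith
    next
      case (Inr k)
      have "(\<Sum>j=1..p. l1norm (a (Inl j))) = (\<Sum>j=1..p. l1norm (?b (Inl j)))"
        using Inr by (simp add: pam_move_def)
      moreover have "(\<Sum>k=1..n. l1norm (a (Inr k))) \<le> Suc (\<Sum>k=1..n. l1norm (?b (Inr k)))"
        using change[OF inv_in[OF e], of "Inr ` {1..n}" ?b] by (simp add: sum.reindex back_eq[symmetric])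
      ultimately show ?thesis by linarith
    qed
    then have "\<epsilon> * (real (\<Sum>k=1..n. l1norm (a (Inr k))) - real (\<Sum>j=1..p. l1norm (a (Inl j))))
      \<le> \<epsilon> * (1 + (real (\<Sum>k=1..n. l1norm (?b (Inr k))) - real (\<Sum>j=1..p. l1norm (?b (Inl j)))))"
      using \<epsilon> by (intro mult_left_mono) auto
    then show ?thesis by (simp add: w_def exp_add[symmetric] distrib_left)
  qed
  have S_mv: "pam_move e a \<in> S" if "e \<in> pam_edges n p" "a \<in> S" for e a
    using that by (auto simp: S_def pam_move_def pam_edges_def)
  have rk_mv: "rk (pam_move e a) \<le> Suc (rk a)" if "e \<in> pam_edges n p" for e a
    unfolding rk_def using that by (intro change) auto
  have fin: "finite {b\<in>S. rk b \<le> N}" for N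
    using finite_configurations[of ?I z0 N] by (simp add: S_def rk_def)
  obtain K where K: "0 \<le> K" "\<And>T. finite T \<Longrightarrow> (\<forall>a\<in>T. \<forall>i. i \<notin> Inl ` {1..p} \<longrightarrow> a i = z0 i) \<Longrightarrow>
    (\<Sum>a\<in>T. exp (- (2 * \<epsilon>) * real (\<Sum>i\<in>Inl ` {1..p}. l1norm (a i)))) \<le> K"
    using sum_exp_l1norm_le[of "2 * \<epsilon>" "Inl ` {1..p}" z0] \<epsilon> by auto
  have C: "(\<Sum>b\<in>A. (w b * start_weight n b)\<^sup>2) \<le> (sqrt K)\<^sup>2" if A: "finite A" "A \<subseteq> S" for A
  proof -
    let ?T = "{b\<in>A. \<forall>k\<in>{1..n}. b (Inr k) = 0}"
    have "(\<Sum>b\<in>A. (w b * start_weight n b)\<^sup>2) = (\<Sum>b\<in>?T. (w b * start_weight n b)\<^sup>2)"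
      using A by (intro sum.mono_neutral_right) (auto simp: start_weight_cases)
    also have "\<dots> = (\<Sum>a\<in>?T. exp (- (2 * \<epsilon>) * real (\<Sum>i\<in>Inl ` {1..p}. l1norm (a i))))"
    proof (rule sum.cong[OF refl])
      fix a assume a: "a \<in> ?T"
      then have "(\<Sum>k=1..n. l1norm (a (Inr k))) = 0" by simp
      then have "w a = exp (- \<epsilon> * real (\<Sum>j=1..p. l1norm (a (Inl j))))" by (simp add: w_def)
      moreover have "start_weight n a = 1" using a by (simp add: start_weight_cases)
      moreover have "(\<Sum>i\<in>Inl ` {1..p}. l1norm (a i)) = (\<Sum>j=1..p. l1norm (a (Inl j)))" by (simp add: sum.reindex)
      ultimately show "(w a * start_weight n a)\<^sup>2 = exp (- (2 * \<epsilon>) * real (\<Sum>i\<in>Inl ` {1..p}. l1norm (a i)))"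
        by (simp add: power2_eq_square exp_add[symmetric])
    qed
    also have "\<dots> \<le> K"
    proof (rule K(2))
      show "\<forall>a\<in>?T. \<forall>i. i \<notin> Inl ` {1..p} \<longrightarrow> a i = z0 i"
      proof (intro ballI allI impI)
        fix a and i :: "nat + nat" assume a: "a \<in> ?T" "i \<notin> Inl ` {1..p}"
        show "a i = z0 i"
        proof (cases "i \<in> Inr ` {1..n}")
          case True
          then show ?thesis using a by (auto simp: z0_def)
        next
          case False
          then have "i \<notin> ?I" using a by (auto simp: Plus_def)
          then show ?thesis using a A by (auto simp: S_def)
        qed
      qed
    qed (use A in simp)
    finally show ?thesis using K by simp
  qed
  \<comment> \<open>\<open>sqrt K\<close> bounds the weighted norm of the start weight; the other
    factor is what the \<open>p\<close> copies of \<open>X\<close> at \<open>x\<close> contribute to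
    \<open>1 / w\<close>.\<close>
  define C where "C = sqrt K * exp (\<epsilon> * real (p * l1norm x))"
  have "endpoint_moment x y t \<le> C * exp (- \<epsilon> * real (\<Sum>k=1..n. l1norm (y k))) * exp (t * (Lam + (exp \<epsilon> - 1) * R))"
    if t: "0 < t" and y: "\<forall>k. k \<notin> {1..n} \<longrightarrow> y k = 0" for y t
  proof (rule LIMSEQ_le)
    define a :: "nat + nat \<Rightarrow> int ^ 'd" where "a = case_sum (\<lambda>_. x) y"
    define K' where "K' = (exp \<epsilon> * R + R + real (p * n))\<^sup>2 * (card (pam_edges n p :: ((nat + nat) \<times> (int ^ 'd)) set) + 1)\<^sup>2"
    show "(\<lambda>m. (Q (t / real m) ^^ m) (start_weight n) a) \<longlonglongrightarrow> endpoint_moment x y t"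
      unfolding a_def endpoint_moment_def by (rule pam_Q_pow_tendsto[OF t])
    have "(\<lambda>m. t / real m) \<longlonglongrightarrow> 0" by (rule lim_const_over_n)
    then have "(\<lambda>m. sqrt K / w a * exp (t * (Lam + (exp \<epsilon> - 1) * R + (t / real m) * K' / 2)))
      \<longlonglongrightarrow> sqrt K / w a * exp (t * (Lam + (exp \<epsilon> - 1) * R + 0 * K' / 2))"
      by (intro tendsto_intros) simp
    moreover have "sqrt K / w a = C * exp (- \<epsilon> * real (\<Sum>k=1..n. l1norm (y k)))"
      by (simp add: w_def a_def C_def exp_minus[symmetric] exp_add[symmetric] divide_inverse algebra_simps)
    ultimately show "(\<lambda>m. sqrt K / w a * exp (t * (Lam + (exp \<epsilon> - 1) * R + (t / real m) * K' / 2)))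
      \<longlonglongrightarrow> C * exp (- \<epsilon> * real (\<Sum>k=1..n. l1norm (y k))) * exp (t * (Lam + (exp \<epsilon> - 1) * R))"
      by simp
    have aS: "a \<in> S"
    proof -
      have "a i = z0 i" if "i \<notin> ?I" for i
        using that y by (cases i) (auto simp: a_def z0_def)
      then show ?thesis by (simp add: S_def)
    qed
    have "(Q (t / real m) ^^ m) (start_weight n) a \<le> sqrt K / w a * exp (t * (Lam + (exp \<epsilon> - 1) * R + (t / real m) * K' / 2))"
      if "1 \<le> m" for m
    proof -
      have "\<bar>(Q (t / real m) ^^ m) (start_weight n) a\<bar>
        \<le> sqrt K / w a * exp (real m * (t / real m) * (Lam + (exp \<epsilon> - 1) * R + (t / real m) * K' / 2))"
        unfolding K'_def
        by (rule Q_pow_upper[where S = S and rk = rk, OF _ _ _ w_mv S_mv rk_mv fin C]) (use t \<epsilon> K aS in \<open>auto simp: w_def\<close>)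
      then show ?thesis using that by (simp add: abs_le_iff)
    qed
    then show "\<exists>N. \<forall>m\<ge>N. (Q (t / real m) ^^ m) (start_weight n) a \<le> sqrt K / w a * exp (t * (Lam + (exp \<epsilon> - 1) * R + (t / real m) * K' / 2))"
      by blast
  qed
  moreover have "0 \<le> C" using K by (simp add: C_def)
  ultimately show ?thesis
    unfolding pam_Lam_def R_def by blast
qed

definition moment :: "int ^ 'd \<Rightarrow> real \<Rightarrow> real"
  where "moment x t = (\<integral>\<omega>. feynman_kac P X (catalyst n Y \<omega>) x t ^ p \<partial>M)"

text \<open>Summation over the catalyst endpoints, which are exhausted by the finite sets
  \<open>T N\<close>; the prefactors add up to at most \<open>C * K\<close> on each of them. The
  added 1 makes the constant positive.\<close>

lemma moment_le_of_endpoint_moment_le: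
  assumes \<epsilon>: "0 < \<epsilon>" and C: "0 \<le> C" "\<And>y t. 0 < t \<Longrightarrow> (\<forall>k. k \<notin> {1..n} \<longrightarrow> y k = 0) \<Longrightarrow>
    endpoint_moment x y t \<le> C * exp (- \<epsilon> * real (\<Sum>k=1..n. l1norm (y k))) * exp (t * L)"
  shows "\<exists>C>0. \<forall>t>0. moment x t \<le> C * exp (t * L)"
proof -
  interpret prob_space M by (rule independent_srws_prob_space[OF Y n])
  obtain K where K: "0 \<le> K" "\<And>T :: (nat \<Rightarrow> int ^ 'd) set. finite T \<Longrightarrow> (\<forall>a\<in>T. \<forall>i. i \<notin> {1..n} \<longrightarrow> a i = 0) \<Longrightarrow>
    (\<Sum>a\<in>T. exp (- \<epsilon> * real (\<Sum>i=1..n. l1norm (a i)))) \<le> K"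
    using sum_exp_l1norm_le[OF \<epsilon>, of "{1..n}" "\<lambda>_. 0"] by auto
  have "moment x t \<le> (C * K + 1) * exp (t * L)" if t: "0 < t" for t
  proof (rule LIMSEQ_le_const2)
    define T where "T N = {y :: nat \<Rightarrow> int ^ 'd. (\<forall>k. k \<notin> {1..n} \<longrightarrow> y k = 0) \<and> (\<Sum>k=1..n. l1norm (y k)) \<le> N}" for N
    define g where "g y \<omega> = feynman_kac P X (catalyst n Y \<omega>) x t ^ p * (\<Prod>k=1..n. indicator {y k} (Y k t \<omega>))" for y \<omega>
    have fT: "finite (T N)" for N
      using finite_configurations[of "{1..n}" "\<lambda>_. 0" N] by (simp add: T_def)
    have gm [measurable]: "g y \<in> borel_measurable M" for y
      unfolding g_def using t feynman_kac_measurable[OF t] indicator_prod_measurable[of t y]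
      by (intro borel_measurable_times borel_measurable_power) auto
    have fb: "0 \<le> feynman_kac P X (catalyst n Y \<omega>) x t ^ p" "feynman_kac P X (catalyst n Y \<omega>) x t ^ p \<le> exp (t * real n) ^ p"
      if "\<omega> \<in> space M" for \<omega>
      using feynman_kac_bounds[OF t that, of x] by (auto intro: power_mono)
    have gb: "\<bar>g y \<omega>\<bar> \<le> exp (t * real n) ^ p" if "\<omega> \<in> space M" for y \<omega>
      using mult_mono[OF _ indicator_prod_bounded[of y t \<omega>], of "\<bar>feynman_kac P X (catalyst n Y \<omega>) x t ^ p\<bar>" "exp (t * real n) ^ p"] fb[OF that]
      by (simp add: g_def abs_mult)
    have gi: "integrable M (g y)" for y
      by (rule integrable_const_bound[of _ "exp (t * real n) ^ p"]) (use gb in auto)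
    have sum_g: "(\<Sum>y\<in>T N. g y \<omega>) = (if (\<Sum>k=1..n. l1norm (Y k t \<omega>)) \<le> N then feynman_kac P X (catalyst n Y \<omega>) x t ^ p else 0)" for N \<omega>
    proof -
      define y0 where "y0 k = (if k \<in> {1..n} then Y k t \<omega> else 0)" for k
      have "(\<Prod>k=1..n. indicator {y k} (Y k t \<omega>)) = (if y = y0 then 1 else 0 :: real)" if "y \<in> T N" for y
      proof (cases "y = y0")
        case False
        then obtain k where "y k \<noteq> y0 k" by blast
        then have "k \<in> {1..n}" "y k \<noteq> Y k t \<omega>" using that by (auto simp: T_def y0_def split: if_splits)
        then show ?thesis using False by (auto intro!: prod_zero bexI[of _ k] simp: indicator_def)
      qed (simp add: y0_def)
      then have "(\<Sum>y\<in>T N. g y \<omega>) = (\<Sum>y\<in>T N. if y = y0 then feynman_kac P X (catalyst n Y \<omega>) x t ^ p else 0)"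
        unfolding g_def by (intro sum.cong) auto
      also have "\<dots> = (if y0 \<in> T N then feynman_kac P X (catalyst n Y \<omega>) x t ^ p else 0)"
        using fT by simp
      also have "y0 \<in> T N \<longleftrightarrow> (\<Sum>k=1..n. l1norm (Y k t \<omega>)) \<le> N"
        by (simp add: T_def y0_def)
      finally show ?thesis .
    qed
    show "(\<lambda>N. expectation (\<lambda>\<omega>. \<Sum>y\<in>T N. g y \<omega>)) \<longlonglongrightarrow> moment x t"
      unfolding moment_def
    proof (rule integral_dominated_convergence[where w = "\<lambda>_. exp (t * real n) ^ p"])
      show "(\<lambda>\<omega>. feynman_kac P X (catalyst n Y \<omega>) x t ^ p) \<in> borel_measurable M"
        by (intro borel_measurable_power feynman_kac_measurable t)
      show "AE \<omega> in M. (\<lambda>N. \<Sum>y\<in>T N. g y \<omega>) \<longlonglongrightarrow> feynman_kac P X (catalyst n Y \<omega>) x t ^ p"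
      proof (intro AE_I2 tendsto_eventually eventually_sequentiallyI)
        fix \<omega> N assume "(\<Sum>k=1..n. l1norm (Y k t \<omega>)) \<le> N"
        then show "(\<Sum>y\<in>T N. g y \<omega>) = feynman_kac P X (catalyst n Y \<omega>) x t ^ p" by (simp add: sum_g)
      qed
      show "AE \<omega> in M. norm (\<Sum>y\<in>T N. g y \<omega>) \<le> exp (t * real n) ^ p" for N
        using fb by (intro AE_I2) (auto simp: sum_g)
    qed simp_all
    have "expectation (\<lambda>\<omega>. \<Sum>y\<in>T N. g y \<omega>) \<le> (C * K + 1) * exp (t * L)" for N
    proof -
      have "expectation (\<lambda>\<omega>. \<Sum>y\<in>T N. g y \<omega>) = (\<Sum>y\<in>T N. endpoint_moment x y t)"
        by (subst Bochner_Integration.integral_sum[OF gi]) (simp add: endpoint_moment_def g_def[abs_def])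
      also have "\<dots> \<le> (\<Sum>y\<in>T N. C * exp (- \<epsilon> * real (\<Sum>k=1..n. l1norm (y k))) * exp (t * L))"
        by (intro sum_mono C(2) t) (auto simp: T_def)
      also have "\<dots> = C * (\<Sum>y\<in>T N. exp (- \<epsilon> * real (\<Sum>k=1..n. l1norm (y k)))) * exp (t * L)"
        by (simp only: sum_distrib_left sum_distrib_right)
      also have "\<dots> \<le> C * K * exp (t * L)"
        using C(1) fT by (intro mult_right_mono mult_left_mono K(2)) (auto simp: T_def)
      also have "\<dots> \<le> (C * K + 1) * exp (t * L)" by simp
      finally show ?thesis .
    qed
    then show "\<exists>N. \<forall>m\<ge>N. expectation (\<lambda>\<omega>. \<Sum>y\<in>T m. g y \<omega>) \<le> (C * K + 1) * exp (t * L)" by blast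
  qed
  moreover have "0 < C * K + 1" using C(1) K(1) by (simp add: add_nonneg_pos)
  ultimately show ?thesis by blast
qed

lemma moment_upper:
  assumes "0 < \<epsilon>"
  shows "\<exists>C>0. \<forall>t>0. moment x t \<le> C
      * exp (t * (pam_Lam TYPE('d) n p \<kappa> \<rho> + (exp \<epsilon> - 1) * (\<Sum>e\<in>(pam_edges n p :: ((nat + nat) \<times> (int ^ 'd)) set). pam_rate \<kappa> \<rho> e)))"
  using endpoint_moment_upper[OF assms, of x] moment_le_of_endpoint_moment_le[OF assms] by metis


end

section \<open>Lower bound\<close>

lemma l1norm_eq_0_iff: "l1norm v = 0 \<longleftrightarrow> v = 0"
  by (simp add: l1norm_def vec_eq_iff)

lemma unit_step_towards_0:
  fixes u :: "int ^ 'd"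
  assumes "u \<noteq> 0"
  obtains v where "v \<in> unit_steps" "Suc (l1norm (u + v)) = l1norm u"
proof -
  obtain c where c: "u $ c \<noteq> 0" using assms by (auto simp: vec_eq_iff)
  define v :: "int ^ 'd" where "v = axis c (- sgn (u $ c))"
  have "(\<Sum>i\<in>UNIV. \<bar>v $ i\<bar>) = \<bar>v $ c\<bar> + (\<Sum>i\<in>UNIV - {c}. \<bar>v $ i\<bar>)" by (intro sum.remove) auto
  also have "(\<Sum>i\<in>UNIV - {c}. \<bar>v $ i\<bar>) = 0" by (intro sum.neutral) (auto simp: v_def axis_def)
  also have "\<bar>v $ c\<bar> = 1" using c by (auto simp: v_def axis_def sgn_if)
  finally have "v \<in> unit_steps" by (simp add: unit_steps_def nearest_neighbours_def)
  moreover have "Suc (l1norm (u + v)) = l1norm u"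
  proof -
    have "l1norm (u + v) = nat \<bar>(u + v) $ c\<bar> + (\<Sum>i\<in>UNIV - {c}. nat \<bar>(u + v) $ i\<bar>)"
      unfolding l1norm_def by (intro sum.remove) auto
    also have "(\<Sum>i\<in>UNIV - {c}. nat \<bar>(u + v) $ i\<bar>) = (\<Sum>i\<in>UNIV - {c}. nat \<bar>u $ i\<bar>)"
      by (intro sum.cong refl) (auto simp: v_def axis_def)
    finally have "Suc (l1norm (u + v)) = Suc (nat \<bar>(u + v) $ c\<bar>) + (\<Sum>i\<in>UNIV - {c}. nat \<bar>u $ i\<bar>)" by simp
    also have "Suc (nat \<bar>(u + v) $ c\<bar>) = nat \<bar>u $ c\<bar>"
      using c by (auto simp: v_def axis_def sgn_if split: if_splits)
    also have "nat \<bar>u $ c\<bar> + (\<Sum>i\<in>UNIV - {c}. nat \<bar>u $ i\<bar>) = l1norm u"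
      unfolding l1norm_def by (intro sum.remove[symmetric]) auto
    finally show ?thesis .
  qed
  ultimately show ?thesis by (rule that)
qed

text \<open>Irreducibility for the particles that can move: a step towards \<open>z0\<close> lowers
  the total distance by 1 and has a positive rate, and \<open>B ^^ k\<close> applied to the
  indicator is at least the weight of one such path of length \<open>k\<close>.\<close>

lemma pam_connected:
  fixes a z0 :: "nat + nat \<Rightarrow> int ^ 'd"
  assumes nonneg: "0 \<le> \<kappa>" "0 \<le> \<rho>"
    and a: "\<forall>i. i \<notin> {i \<in> {1..p} <+> {1..n}. 0 < rates \<kappa> \<rho> i} \<longrightarrow> a i = z0 i"
  shows "\<exists>k. 0 < (hopping.B (pam_edges n p) pam_move (pam_rate \<kappa> \<rho>) (interaction n p) ^^ k) (indicator {z0}) a"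
proof -
  interpret hopping "pam_edges n p" pam_move pam_inverse "pam_rate \<kappa> \<rho>"
    "interaction n p :: (nat + nat \<Rightarrow> int ^ 'd) \<Rightarrow> real" "real (p * n)"
    by (rule hopping_pam[OF nonneg])
  define J where "J = {i \<in> {1..p} <+> {1..n}. 0 < rates \<kappa> \<rho> i}"
  have fJ: "finite J" by (simp add: J_def)
  have "\<exists>k. 0 < (B ^^ k) (indicator {z0}) a" if "N = (\<Sum>i\<in>J. l1norm (a i - z0 i))" "\<forall>i. i \<notin> J \<longrightarrow> a i = z0 i" for N a
    using that
  proof (induction N arbitrary: a)
    case 0
    have "a i = z0 i" for i
    proof (cases "i \<in> J")
      case True
      then have "l1norm (a i - z0 i) = 0" using 0 fJ by simp
      then show ?thesis by (simp add: l1norm_eq_0_iff)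
    qed (use 0 in auto)
    then have "a = z0" by auto
    then show ?case by (intro exI[of _ 0]) simp
  next
    case (Suc N)
    have "\<exists>i\<in>J. l1norm (a i - z0 i) \<noteq> 0"
    proof (rule ccontr)
      assume "\<not> ?thesis"
      then have "(\<Sum>i\<in>J. l1norm (a i - z0 i)) = 0" by (intro sum.neutral) auto
      then show False using Suc.prems by simp
    qed
    then obtain i where i: "i \<in> J" "a i - z0 i \<noteq> 0" by (auto simp: l1norm_eq_0_iff)
    obtain v where v: "v \<in> unit_steps" "Suc (l1norm (a i - z0 i + v)) = l1norm (a i - z0 i)"
      using unit_step_towards_0[OF i(2)] by blast
    define b where "b = pam_move (i, v) a"
    have e: "(i, v) \<in> pam_edges n p" using i v by (auto simp: pam_edges_def J_def)
    have "Suc N = l1norm (a i - z0 i) + (\<Sum>j\<in>J - {i}. l1norm (a j - z0 j))"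
      using Suc.prems fJ i by (simp add: sum.remove)
    also have "\<dots> = Suc (l1norm (b i - z0 i)) + (\<Sum>j\<in>J - {i}. l1norm (b j - z0 j))"
      using v by (auto simp: b_def pam_move_def algebra_simps intro!: sum.cong)
    also have "\<dots> = Suc (\<Sum>j\<in>J. l1norm (b j - z0 j))" using fJ i by (simp add: sum.remove)
    finally have "N = (\<Sum>j\<in>J. l1norm (b j - z0 j))" by simp
    moreover have "\<forall>i. i \<notin> J \<longrightarrow> b i = z0 i" using Suc.prems i by (auto simp: b_def pam_move_def)
    ultimately obtain k where k: "0 < (B ^^ k) (indicator {z0}) b" using Suc.IH by blast
    have nn: "0 \<le> (B ^^ k) (indicator {z0}) a" for a by (rule B_pow_nonneg) simp
    have "0 < pam_rate \<kappa> \<rho> (i, v) * (B ^^ k) (indicator {z0}) b"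
      using k i by (simp add: pam_rate_def J_def)
    also have "\<dots> \<le> (\<Sum>e\<in>pam_edges n p. pam_rate \<kappa> \<rho> e * (B ^^ k) (indicator {z0}) (pam_move e a))"
      unfolding b_def by (rule member_le_sum[OF e]) (auto intro!: mult_nonneg_nonneg nn r_nonneg simp: finite_E)
    also have "\<dots> \<le> (B ^^ Suc k) (indicator {z0}) a"
      using mult_nonneg_nonneg[OF V_nonneg nn, of a a] by (simp add: B_def[of "(B ^^ k) (indicator {z0})" a])
    finally show ?case by blast
  qed
  then show ?thesis using a by (simp add: J_def)
qed

section \<open>Relocation of frozen particles\<close>

text \<open>\<open>H\<close> does not couple configurations that differ in frozen coordinates, so
  \<open>f\<close> splits into blocks \<open>F b\<close> whose squared norms and energies add up. If
  every block had a smaller quotient than \<open>f\<close>, so would the total; hence some block is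
  at least as good.\<close>

lemma pam_fibre:
  fixes n p :: nat and \<kappa> \<rho> :: real and f :: "(nat + nat \<Rightarrow> int ^ 'd) \<Rightarrow> real"
  assumes nonneg: "0 \<le> \<kappa>" "0 \<le> \<rho>" and f: "finsupp f" "ip f f = 1"
  defines "J \<equiv> {i \<in> {1..p} <+> {1..n}. 0 < rates \<kappa> \<rho> i}"
  obtains h :: "(nat + nat \<Rightarrow> int ^ 'd) \<Rightarrow> real" and b where "finsupp h" "0 < ip h h" "ip f (pam_H n p \<kappa> \<rho> f) * ip h h \<le> ip h (pam_H n p \<kappa> \<rho> h)"
    "\<And>a. h a \<noteq> 0 \<Longrightarrow> \<forall>i. i \<notin> J \<longrightarrow> a i = b i"
proof -
  interpret hopping "pam_edges n p" pam_move pam_inverse "pam_rate \<kappa> \<rho>"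
    "interaction n p :: (nat + nat \<Rightarrow> int ^ 'd) \<Rightarrow> real" "real (p * n)"
    by (rule hopping_pam[OF nonneg])
  define \<pi> where "\<pi> a = (\<lambda>i. if i \<in> J then 0 else a i)" for a :: "nat + nat \<Rightarrow> int ^ 'd"
  define F where "F b a = (if \<pi> a = b then f a else 0)" for b a
  define A where "A = {a. f a \<noteq> 0}"
  have A: "finite A" using f by (simp add: A_def)
  have F: "finsupp (F b)" for b by (rule finite_subset[OF _ f(1)]) (auto simp: F_def)
  have \<pi>_mv: "\<pi> (pam_move e a) = \<pi> a" if "e \<in> pam_edges n p" "pam_rate \<kappa> \<rho> e \<noteq> 0" for e a
  proof -
    have "fst e \<in> J" using that r_nonneg[of e] by (auto simp: J_def pam_edges_def pam_rate_def)
    then show ?thesis by (auto simp: \<pi>_def pam_move_def)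
  qed
  have ipF: "ip (F b) g = (\<Sum>a\<in>A. if \<pi> a = b then f a * g a else 0)" for b g
    using A by (subst ip_eq_sum[of A]) (auto simp: F_def A_def intro!: sum.cong)
  have total: "(\<Sum>b\<in>\<pi> ` A. ip (F b) g) = ip f g" for g
  proof -
    have "(\<Sum>b\<in>\<pi> ` A. ip (F b) g) = (\<Sum>a\<in>A. \<Sum>b\<in>\<pi> ` A. if \<pi> a = b then f a * g a else 0)"
      unfolding ipF by (rule sum.swap)
    also have "\<dots> = (\<Sum>a\<in>A. f a * g a)" using A by (intro sum.cong) auto
    also have "\<dots> = ip f g" using A by (intro ip_eq_sum[symmetric]) (auto simp: A_def)
    finally show ?thesis .
  qed
  have HF: "ip (F b) (H (F b)) = ip (F b) (H f)" for b
    unfolding ipF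
  proof (rule sum.cong[OF refl])
    fix a
    have "H (F b) a = H f a" if "\<pi> a = b"
    proof -
      have Fa: "F b a = f a" using that by (simp add: F_def)
      have "pam_rate \<kappa> \<rho> e * (F b (pam_move e a) - f a) = pam_rate \<kappa> \<rho> e * (f (pam_move e a) - f a)"
        if "e \<in> pam_edges n p" for e
        using \<pi>_mv[OF that, of a] \<open>\<pi> a = b\<close> by (cases "pam_rate \<kappa> \<rho> e = 0") (auto simp: F_def)
      then have "(\<Sum>e\<in>pam_edges n p. pam_rate \<kappa> \<rho> e * (F b (pam_move e a) - f a))
        = (\<Sum>e\<in>pam_edges n p. pam_rate \<kappa> \<rho> e * (f (pam_move e a) - f a))"
        by (rule sum.cong[OF refl])
      then show ?thesis unfolding H_def Fa by (simp only:)
    qed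
    then show "(if \<pi> a = b then f a * H (F b) a else 0) = (if \<pi> a = b then f a * H f a else 0)" by simp
  qed
  have FF: "ip (F b) (F b) = ip (F b) f" for b
    unfolding ipF by (rule sum.cong) (auto simp: F_def)
  let ?g = "ip f (H f)"
  have sum0: "(\<Sum>b\<in>\<pi> ` A. ip (F b) (H (F b)) - ?g * ip (F b) (F b)) = 0"
    unfolding HF FF sum_subtractf sum_distrib_left[symmetric] total using f by simp
  have "A \<noteq> {}"
  proof
    assume "A = {}"
    then have "ip f f = 0" using ip_eq_sum[of A f f] by (simp add: A_def)
    then show False using f by simp
  qed
  have "\<exists>b\<in>\<pi> ` A. 0 \<le> ip (F b) (H (F b)) - ?g * ip (F b) (F b)"
  proof (rule ccontr)
    assume "\<not> ?thesis"
    then have "(\<Sum>b\<in>\<pi> ` A. ip (F b) (H (F b)) - ?g * ip (F b) (F b)) < (\<Sum>b\<in>\<pi> ` A. 0)"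
      using A \<open>A \<noteq> {}\<close> by (intro sum_strict_mono) (auto simp: not_le)
    then show False using sum0 by simp
  qed
  then obtain a where a: "a \<in> A" "0 \<le> ip (F (\<pi> a)) (H (F (\<pi> a))) - ?g * ip (F (\<pi> a)) (F (\<pi> a))" by blast
  show ?thesis
  proof (rule that[of "F (\<pi> a)" "\<pi> a"])
    show "0 < ip (F (\<pi> a)) (F (\<pi> a))"
      using a(1) by (intro ip_self_pos[OF F, where a = a]) (auto simp: F_def A_def)
    show "\<forall>i. i \<notin> J \<longrightarrow> a' i = \<pi> a i" if "F (\<pi> a) a' \<noteq> 0" for a'
    proof (intro allI impI)
      fix i assume "i \<notin> J"
      then have "a' i = \<pi> a' i" by (simp add: \<pi>_def)
      also have "\<pi> a' = \<pi> a" using that by (simp add: F_def split: if_splits)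
      finally show "a' i = \<pi> a i" .
    qed
  qed (use F a(2) in auto)
qed

text \<open>A common shift of the moving particles together with new positions for all other indices
  preserves the norm and every hopping term of positive rate. Only the potential energy changes, and
  by \<open>V\<close> it does not decrease.\<close>

lemma pam_transfer:
  fixes n p :: nat and \<kappa> \<rho> :: real and h :: "(nat + nat \<Rightarrow> int ^ 'd) \<Rightarrow> real"
  assumes nonneg: "0 \<le> \<kappa>" "0 \<le> \<rho>" and h: "finsupp h"
  defines "J \<equiv> {i \<in> {1..p} <+> {1..n}. 0 < rates \<kappa> \<rho> i}"
  assumes b: "\<And>a. h a \<noteq> 0 \<Longrightarrow> \<forall>i. i \<notin> J \<longrightarrow> a i = b i"
    and V: "(\<Sum>a\<in>{a. h a \<noteq> 0}. interaction n p a * (h a)\<^sup>2)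
      \<le> (\<Sum>a\<in>{a. h a \<noteq> 0}. interaction n p (\<lambda>i. if i \<in> J then a i - v else z0 i) * (h a)\<^sup>2)"
  obtains h' :: "(nat + nat \<Rightarrow> int ^ 'd) \<Rightarrow> real" where "finsupp h'" "ip h' h' = ip h h" "ip h (pam_H n p \<kappa> \<rho> h) \<le> ip h' (pam_H n p \<kappa> \<rho> h')"
    "\<And>a. h' a \<noteq> 0 \<Longrightarrow> \<forall>i. i \<notin> J \<longrightarrow> a i = z0 i"
proof -
  interpret hopping "pam_edges n p" pam_move pam_inverse "pam_rate \<kappa> \<rho>"
    "interaction n p :: (nat + nat \<Rightarrow> int ^ 'd) \<Rightarrow> real" "real (p * n)"
    by (rule hopping_pam[OF nonneg])
  \<comment> \<open>\<open>fro\<close> maps the support of \<open>h\<close> to configurations pinned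
    at \<open>z0\<close>, and \<open>to\<close> undoes it there.\<close>
  define to where "to a = (\<lambda>i. if i \<in> J then a i + v else b i)" for a :: "nat + nat \<Rightarrow> int ^ 'd"
  define fro where "fro a = (\<lambda>i. if i \<in> J then a i - v else z0 i)" for a :: "nat + nat \<Rightarrow> int ^ 'd"
  define h' where "h' a = (if \<forall>i. i \<notin> J \<longrightarrow> a i = z0 i then h (to a) else 0)" for a
  have to_fro: "to (fro a) = a" if "h a \<noteq> 0" for a
    using b[OF that] by (auto simp: to_def fro_def)
  have fro_to: "fro (to a) = a" if "\<forall>i. i \<notin> J \<longrightarrow> a i = z0 i" for a
    using that by (auto simp: to_def fro_def)
  have fro_cls: "\<forall>i. i \<notin> J \<longrightarrow> fro a i = z0 i" for a by (simp add: fro_def)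
  have supp: "{a. h' a \<noteq> 0} = fro ` {a. h a \<noteq> 0}"
  proof safe
    fix a assume "h' a \<noteq> 0"
    then have "\<forall>i. i \<notin> J \<longrightarrow> a i = z0 i" "h (to a) \<noteq> 0" by (auto simp: h'_def split: if_splits)
    then show "a \<in> fro ` {a. h a \<noteq> 0}" using fro_to[of a] by (intro image_eqI[of _ _ "to a"]) auto
  next
    fix a assume "h a \<noteq> 0" "h' (fro a) = 0"
    then show False using fro_cls[of a] to_fro[of a] by (simp add: h'_def)
  qed
  have h': "finsupp h'" using h by (simp add: supp)
  have inj: "inj_on fro {a. h a \<noteq> 0}" by (rule inj_on_inverseI[of _ to]) (simp add: to_fro)
  have h'_fro: "h' (fro a) = h a" if "h a \<noteq> 0" for a
    using fro_cls[of a] to_fro[OF that] by (simp add: h'_def)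
  have ip': "ip h' g = (\<Sum>a\<in>{a. h a \<noteq> 0}. h a * g (fro a))" for g
  proof -
    have "ip h' g = (\<Sum>a\<in>fro ` {a. h a \<noteq> 0}. h' a * g a)"
      using h by (intro ip_eq_sum) (auto simp: supp)
    also have "\<dots> = (\<Sum>a\<in>{a. h a \<noteq> 0}. h a * g (fro a))"
      unfolding sum.reindex[OF inj] by (intro sum.cong) (auto simp: h'_fro)
    finally show ?thesis .
  qed
  have iph: "ip h g = (\<Sum>a\<in>{a. h a \<noteq> 0}. h a * g a)" for g
    using h by (intro ip_eq_sum) auto
  have norm_eq: "ip h' h' = ip h h" unfolding ip' iph by (intro sum.cong) (auto simp: h'_fro)
  have hop_eq: "pam_rate \<kappa> \<rho> e * (ip h' (\<lambda>a. h' (pam_move e a)) - ip h' h')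
      = pam_rate \<kappa> \<rho> e * (ip h (\<lambda>a. h (pam_move e a)) - ip h h)" if e: "e \<in> pam_edges n p" for e
  proof (cases "pam_rate \<kappa> \<rho> e = 0")
    case False
    then have J: "fst e \<in> J" using e r_nonneg[of e] by (auto simp: J_def pam_edges_def pam_rate_def)
    have "h' (pam_move e (fro a)) = h (pam_move e a)" if "h a \<noteq> 0" for a
    proof -
      have "\<forall>i. i \<notin> J \<longrightarrow> pam_move e (fro a) i = z0 i" using J by (auto simp: pam_move_def fro_def)
      moreover have "to (pam_move e (fro a)) = pam_move e a"
        using J b[OF that] by (auto simp: pam_move_def fro_def to_def fun_eq_iff)
      ultimately show ?thesis by (simp add: h'_def)
    qed
    then have "ip h' (\<lambda>a. h' (pam_move e a)) = ip h (\<lambda>a. h (pam_move e a))"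
      unfolding ip' iph by (intro sum.cong) auto
    then show ?thesis by (simp add: norm_eq)
  qed simp
  have "ip h (\<lambda>a. interaction n p a * h a) \<le> ip h' (\<lambda>a. interaction n p a * h' a)"
  proof -
    have "ip h (\<lambda>a. interaction n p a * h a) = (\<Sum>a\<in>{a. h a \<noteq> 0}. interaction n p a * (h a)\<^sup>2)"
      unfolding iph by (simp add: power2_eq_square mult_ac)
    also have "\<dots> \<le> (\<Sum>a\<in>{a. h a \<noteq> 0}. interaction n p (fro a) * (h a)\<^sup>2)"
      using V by (simp only: fro_def)
    also have "\<dots> = ip h' (\<lambda>a. interaction n p a * h' a)"
      unfolding ip' by (intro sum.cong) (auto simp: h'_fro power2_eq_square)
    finally show ?thesis .
  qed
  then have "ip h (H h) \<le> ip h' (H h')"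
    unfolding ip_H[OF h] ip_H[OF h'] by (simp add: hop_eq)
  then show ?thesis
    by (rule that[OF h' norm_eq]) (auto simp: h'_def split: if_splits)
qed


lemma finite_obtains_max:
  fixes f :: "'x \<Rightarrow> real"
  assumes "finite S" "S \<noteq> {}"
  obtains s0 where "\<And>s. s \<in> S \<Longrightarrow> f s \<le> f s0"
proof -
  have "Max (f ` S) \<in> f ` S" using assms by (intro Max_in) auto
  then obtain s0 where "f s0 = Max (f ` S)" by auto
  then have "f s \<le> f s0" if "s \<in> S" for s using assms that by simp
  then show ?thesis by (rule that)
qed

lemma pam_test_function:
  fixes n p :: nat and \<kappa> \<rho> :: real and f :: "(nat + nat \<Rightarrow> int ^ 'd) \<Rightarrow> real" and x :: "int ^ 'd"
  assumes n: "1 \<le> n" and p: "1 \<le> p" and nonneg: "0 \<le> \<kappa>" "0 \<le> \<rho>" and nz: "(\<kappa>, \<rho>) \<noteq> (0, 0)"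
    and f: "finsupp f" "ip f f = 1"
  defines "J \<equiv> {i \<in> {1..p} <+> {1..n}. 0 < rates \<kappa> \<rho> i}"
  obtains g :: "(nat + nat \<Rightarrow> int ^ 'd) \<Rightarrow> real" where "finsupp g" "ip g g = 1" "\<And>a. 0 \<le> g a"
    "ip f (pam_H n p \<kappa> \<rho> f) \<le> ip g (pam_H n p \<kappa> \<rho> g)"
    "\<And>a. g a \<noteq> 0 \<Longrightarrow> \<forall>i. i \<notin> J \<longrightarrow> a i = case_sum (\<lambda>_. x) (\<lambda>_. 0) i"
proof -
  interpret hopping "pam_edges n p" pam_move pam_inverse "pam_rate \<kappa> \<rho>"
    "interaction n p :: (nat + nat \<Rightarrow> int ^ 'd) \<Rightarrow> real" "real (p * n)"
    by (rule hopping_pam[OF nonneg])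
  obtain h b where h: "finsupp h" "0 < ip h h" "ip f (H f) * ip h h \<le> ip h (H h)"
    and b: "\<And>a. h a \<noteq> 0 \<Longrightarrow> \<forall>i. i \<notin> J \<longrightarrow> a i = b i"
    using pam_fibre[OF nonneg f] unfolding J_def by blast
  let ?z = "case_sum (\<lambda>_. x) (\<lambda>_. 0) :: nat + nat \<Rightarrow> int ^ 'd"
  let ?S = "{a. h a \<noteq> 0}"
  have J_iff: "Inl j \<in> J \<longleftrightarrow> j \<in> {1..p} \<and> 0 < \<kappa>" "Inr k \<in> J \<longleftrightarrow> k \<in> {1..n} \<and> 0 < \<rho>" for j k
    by (auto simp: J_def)
  have "\<exists>v. (\<Sum>a\<in>?S. interaction n p a * (h a)\<^sup>2)
      \<le> (\<Sum>a\<in>?S. interaction n p (\<lambda>i. if i \<in> J then a i - v else ?z i) * (h a)\<^sup>2)"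
  proof -
    consider "0 < \<kappa>" "0 < \<rho>" | "\<kappa> = 0" "0 < \<rho>" | "0 < \<kappa>" "\<rho> = 0"
      using nonneg nz by fastforce
    then show ?thesis
    proof cases
      case 1
      have "interaction n p (\<lambda>i. if i \<in> J then a i - 0 else ?z i) = interaction n p a" for a
        unfolding interaction_def using 1 by (intro sum.cong refl) (simp add: J_iff)
      then show ?thesis by (intro exI[of _ 0]) simp
    next
      case 2
      define W where "W v = (\<Sum>a\<in>?S. (\<Sum>k=1..n. indicator {v} (a (Inr k))) * (h a)\<^sup>2)" for v
      have "(\<Sum>a\<in>?S. interaction n p a * (h a)\<^sup>2) = (\<Sum>a\<in>?S. \<Sum>j=1..p. (\<Sum>k=1..n. indicator {b (Inl j)} (a (Inr k))) * (h a)\<^sup>2)"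
      proof (rule sum.cong[OF refl])
        fix a assume "a \<in> ?S"
        then have "a (Inl j) = b (Inl j)" for j using b[of a] 2 by (simp add: J_iff)
        then show "interaction n p a * (h a)\<^sup>2 = (\<Sum>j=1..p. (\<Sum>k=1..n. indicator {b (Inl j)} (a (Inr k))) * (h a)\<^sup>2)"
          by (simp add: interaction_def sum_distrib_right)
      qed
      also have "\<dots> = (\<Sum>j=1..p. W (b (Inl j)))" unfolding W_def by (rule sum.swap)
      finally have eq: "(\<Sum>a\<in>?S. interaction n p a * (h a)\<^sup>2) = (\<Sum>j=1..p. W (b (Inl j)))" .
      obtain j0 where j0: "\<And>j. j \<in> {1..p} \<Longrightarrow> W (b (Inl j)) \<le> W (b (Inl j0))"
        by (rule finite_obtains_max[of "{1..p}" "\<lambda>j. W (b (Inl j))"]) (use p in auto)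
      have "(\<Sum>j=1..p. W (b (Inl j))) \<le> real p * W (b (Inl j0))"
        using sum_bounded_above[of "{1..p}" "\<lambda>j. W (b (Inl j))" "W (b (Inl j0))"] j0 by simp
      \<comment> \<open>The shift by \<open>b (Inl j0) - x\<close> carries the best frozen position
        to \<open>x\<close>, which is now shared by all \<open>p\<close> walks.\<close>
      also have "\<dots> = (\<Sum>a\<in>?S. interaction n p (\<lambda>i. if i \<in> J then a i - (b (Inl j0) - x) else ?z i) * (h a)\<^sup>2)"
      proof -
        have "interaction n p (\<lambda>i. if i \<in> J then a i - (b (Inl j0) - x) else ?z i)
          = real p * (\<Sum>k=1..n. indicator {b (Inl j0)} (a (Inr k)))" for a
        proof -
          have "interaction n p (\<lambda>i. if i \<in> J then a i - (b (Inl j0) - x) else ?z i)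
            = (\<Sum>j=1..p. \<Sum>k=1..n. indicator {b (Inl j0)} (a (Inr k)))"
            unfolding interaction_def using 2 by (intro sum.cong refl) (auto simp: J_iff indicator_def algebra_simps)
          then show ?thesis by (simp only: sum_constant card_atLeastAtMost diff_Suc_1)
        qed
        note I = this
        show ?thesis unfolding I W_def by (subst sum_distrib_left) (simp only: mult.assoc)
      qed
      finally show ?thesis unfolding eq by blast
    next
      case 3
      define W where "W v = (\<Sum>a\<in>?S. (\<Sum>j=1..p. indicator {v} (a (Inl j))) * (h a)\<^sup>2)" for v
      have swap: "interaction n p a = (\<Sum>k=1..n. \<Sum>j=1..p. indicator {a (Inr k)} (a (Inl j)))" for a :: "nat + nat \<Rightarrow> int ^ 'd"
        unfolding interaction_def by (subst sum.swap, intro sum.cong refl) (auto simp: indicator_def)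
      have "(\<Sum>a\<in>?S. interaction n p a * (h a)\<^sup>2) = (\<Sum>a\<in>?S. \<Sum>k=1..n. (\<Sum>j=1..p. indicator {b (Inr k)} (a (Inl j))) * (h a)\<^sup>2)"
      proof (rule sum.cong[OF refl])
        fix a assume "a \<in> ?S"
        then have "a (Inr k) = b (Inr k)" for k using b[of a] 3 by (simp add: J_iff)
        then show "interaction n p a * (h a)\<^sup>2 = (\<Sum>k=1..n. (\<Sum>j=1..p. indicator {b (Inr k)} (a (Inl j))) * (h a)\<^sup>2)"
          by (simp add: swap sum_distrib_right)
      qed
      also have "\<dots> = (\<Sum>k=1..n. W (b (Inr k)))" unfolding W_def by (rule sum.swap)
      finally have eq: "(\<Sum>a\<in>?S. interaction n p a * (h a)\<^sup>2) = (\<Sum>k=1..n. W (b (Inr k)))" .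
      obtain k0 where k0: "\<And>k. k \<in> {1..n} \<Longrightarrow> W (b (Inr k)) \<le> W (b (Inr k0))"
        by (rule finite_obtains_max[of "{1..n}" "\<lambda>k. W (b (Inr k))"]) (use n in auto)
      have "(\<Sum>k=1..n. W (b (Inr k))) \<le> real n * W (b (Inr k0))"
        using sum_bounded_above[of "{1..n}" "\<lambda>k. W (b (Inr k))" "W (b (Inr k0))"] k0 by simp
      \<comment> \<open>Frozen catalysts belong at 0, so the shift is the best catalyst position
        itself.\<close>
      also have "\<dots> = (\<Sum>a\<in>?S. interaction n p (\<lambda>i. if i \<in> J then a i - b (Inr k0) else ?z i) * (h a)\<^sup>2)"
      proof -
        have "interaction n p (\<lambda>i. if i \<in> J then a i - b (Inr k0) else ?z i)
          = real n * (\<Sum>j=1..p. indicator {b (Inr k0)} (a (Inl j)))" for a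
        proof -
          have "interaction n p (\<lambda>i. if i \<in> J then a i - b (Inr k0) else ?z i)
            = (\<Sum>k=1..n. \<Sum>j=1..p. indicator {b (Inr k0)} (a (Inl j)))"
            unfolding swap using 3 by (intro sum.cong refl) (auto simp: J_iff indicator_def)
          then show ?thesis by (simp only: sum_constant card_atLeastAtMost diff_Suc_1)
        qed
        note I = this
        show ?thesis unfolding I W_def by (subst sum_distrib_left) (simp only: mult.assoc)
      qed
      finally show ?thesis unfolding eq by blast
    qed
  qed
  then obtain v where v: "(\<Sum>a\<in>?S. interaction n p a * (h a)\<^sup>2)
      \<le> (\<Sum>a\<in>?S. interaction n p (\<lambda>i. if i \<in> J then a i - v else ?z i) * (h a)\<^sup>2)" by blast
  obtain h' where h': "finsupp h'" "ip h' h' = ip h h" "ip h (H h) \<le> ip h' (H h')"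
    "\<And>a. h' a \<noteq> 0 \<Longrightarrow> \<forall>i. i \<notin> J \<longrightarrow> a i = ?z i"
    using pam_transfer[OF nonneg h(1) b[unfolded J_def] v[unfolded J_def]] unfolding J_def by blast
  define c where "c = 1 / sqrt (ip h h)"
  define g where "g a = c * \<bar>h' a\<bar>" for a
  have c: "0 < c" "c * c * ip h h = 1" using h(2) by (auto simp: c_def)
  have abs_h': "finsupp (\<lambda>a. \<bar>h' a\<bar>)" using h'(1) by simp
  have ip_abs: "ip (\<lambda>a. \<bar>h' a\<bar>) (\<lambda>a. \<bar>h' a\<bar>) = ip h h" using h'(2) by (simp add: ip_def)
  show ?thesis
  proof (rule that)
    show "finsupp g" by (rule finite_subset[OF _ h'(1)]) (auto simp: g_def)
    show "ip g g = 1" unfolding g_def[abs_def] ip_scale_left ip_scale_right ip_abs using c by (simp only: mult.assoc)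
    show "0 \<le> g a" for a using c by (simp add: g_def)
    have "ip f (H f) = ip f (H f) * (c * c * ip h h)" by (simp only: c mult_1_right)
    also have "\<dots> = c * c * (ip f (H f) * ip h h)" by (simp only: mult_ac)
    also have "\<dots> \<le> c * c * ip (\<lambda>a. \<bar>h' a\<bar>) (H (\<lambda>a. \<bar>h' a\<bar>))"
      using h(3) h'(3) ip_H_abs_ge[OF h'(1)] c by (intro mult_left_mono) auto
    also have "\<dots> = ip g (H g)"
      unfolding g_def[abs_def] H_scale ip_scale_left ip_scale_right by (simp only: mult.assoc)
    finally show "ip f (H f) \<le> ip g (H g)" .
    show "\<forall>i. i \<notin> J \<longrightarrow> a i = ?z i" if "g a \<noteq> 0" for a
      using h'(4)[of a] that by (simp add: g_def)
  qed
qed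

context parabolic_anderson
begin

lemma endpoint_moment_le_moment:
  assumes t: "0 < t"
  shows "endpoint_moment x y t \<le> moment x t"
proof -
  interpret prob_space M by (rule independent_srws_prob_space[OF Y n])
  have fb: "0 \<le> feynman_kac P X (catalyst n Y \<omega>) x t ^ p" "feynman_kac P X (catalyst n Y \<omega>) x t ^ p \<le> exp (t * real n) ^ p"
    if "\<omega> \<in> space M" for \<omega>
    using feynman_kac_bounds[OF t that, of x] by (auto intro: power_mono)
  have pm: "(\<lambda>\<omega>. feynman_kac P X (catalyst n Y \<omega>) x t ^ p) \<in> borel_measurable M"
    by (intro borel_measurable_power feynman_kac_measurable t)
  have i: "integrable M (\<lambda>\<omega>. feynman_kac P X (catalyst n Y \<omega>) x t ^ p)"
    by (rule integrable_const_bound[of _ "exp (t * real n) ^ p"]) (use fb pm in auto)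
  have ib: "0 \<le> (\<Prod>k=1..n. indicator {y k} (Y k t \<omega>) :: real)" "(\<Prod>k=1..n. indicator {y k} (Y k t \<omega>) :: real) \<le> 1" for \<omega>
    using indicator_prod_bounded[of y t \<omega>] by (auto intro!: prod_nonneg)
  show ?thesis
    unfolding endpoint_moment_def moment_def
  proof (rule Bochner_Integration.integral_mono)
    show "integrable M (\<lambda>\<omega>. feynman_kac P X (catalyst n Y \<omega>) x t ^ p * (\<Prod>k=1..n. indicator {y k} (Y k t \<omega>)))"
    proof (rule integrable_const_bound[of _ "exp (t * real n) ^ p * 1"])
      show "AE \<omega> in M. norm (feynman_kac P X (catalyst n Y \<omega>) x t ^ p * (\<Prod>k=1..n. indicator {y k} (Y k t \<omega>))) \<le> exp (t * real n) ^ p * 1"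
        unfolding real_norm_def abs_mult using fb ib by (intro AE_I2 mult_mono) auto
    qed (intro borel_measurable_times pm indicator_prod_measurable less_imp_le[OF t])
    show "feynman_kac P X (catalyst n Y \<omega>) x t ^ p * (\<Prod>k=1..n. indicator {y k} (Y k t \<omega>)) \<le> feynman_kac P X (catalyst n Y \<omega>) x t ^ p"
      if "\<omega> \<in> space M" for \<omega>
      using fb[OF that] ib by (intro mult_left_le) auto
  qed (rule i)
qed

text \<open>A nearly optimal function is made nonnegative and supported on configurations connected
  with \<open>?z\<close>. Keeping only the event that the catalysts end at 0 lowers the moment, but
  not its growth rate.\<close>

lemma moment_ge_exp:
  assumes p: "1 \<le> p" and nz: "(\<kappa>, \<rho>) \<noteq> (0, 0)" and \<delta>: "0 < \<delta>"
  shows "\<exists>c>0. \<forall>t\<ge>10. c * exp (t * (pam_Lam TYPE('d) n p \<kappa> \<rho> - \<delta>)) \<le> moment x t"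
proof -
  interpret hopping "pam_edges n p" pam_move pam_inverse "pam_rate \<kappa> \<rho>"
    "interaction n p :: (nat + nat \<Rightarrow> int ^ 'd) \<Rightarrow> real" "real (p * n)"
    by (rule hopping_pam[OF nonneg])
  let ?z = "case_sum (\<lambda>_. x) (\<lambda>_. 0) :: nat + nat \<Rightarrow> int ^ 'd"
  have "\<exists>f. finsupp f \<and> ip f f = 1 \<and> Lam - \<delta> < ip f (H f)"
  proof -
    have "ip (indicator {undefined} :: (nat + nat \<Rightarrow> int ^ 'd) \<Rightarrow> real) (indicator {undefined}) = 1"
      by (subst ip_eq_sum[of "{undefined}"]) (auto simp: indicator_def)
    then have ne: "{ip f (H f) |f. finsupp f \<and> ip f f = 1} \<noteq> {}"
      by (auto intro!: exI[of _ "indicator {undefined}"] simp: indicator_def)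
    have "\<exists>r\<in>{ip f (H f) |f. finsupp f \<and> ip f f = 1}. Lam - \<delta> < r"
      by (rule less_cSupD[OF ne]) (use \<delta> in \<open>simp add: Lam_def\<close>)
    then show ?thesis by blast
  qed
  then obtain f where f: "finsupp f" "ip f f = 1" "Lam - \<delta> < ip f (H f)" by blast
  obtain g where g: "finsupp g" "ip g g = 1" "\<And>a. 0 \<le> g a" "ip f (H f) \<le> ip g (H g)"
    "\<And>a. g a \<noteq> 0 \<Longrightarrow> \<forall>i. i \<notin> {i \<in> {1..p} <+> {1..n}. 0 < rates \<kappa> \<rho> i} \<longrightarrow> a i = ?z i"
    using pam_test_function[OF n p nonneg nz f(1,2), of x] by blast
  obtain c where c: "c > 0" "\<forall>t\<ge>10. \<forall>\<^sub>F N in sequentially.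
     c * exp (t * ip g (H g)) \<le> (Q (t / real (2 * N)) ^^ (2 * N)) (indicator {?z}) ?z"
    using Q_pow_lower[OF g(1-3), of ?z] pam_connected[OF nonneg g(5)] by blast
  have "c * exp (t * (Lam - \<delta>)) \<le> moment x t" if t: "t \<ge> 10" for t
  proof -
    have t0: "0 < t" using t by simp
    \<comment> \<open>\<open>Q_pow_lower\<close> speaks of even numbers of steps only.\<close>
    have "filterlim (\<lambda>N::nat. 2 * N) sequentially sequentially"
      by (rule filterlim_subseq) (auto simp: strict_mono_def)
    from filterlim_compose[OF pam_Q_pow_tendsto[OF t0, of x "\<lambda>_. 0"] this]
    have lim: "(\<lambda>N. (Q (t / real (2 * N)) ^^ (2 * N)) (start_weight n) ?z) \<longlonglongrightarrow> endpoint_moment x (\<lambda>_. 0) t"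
      by (simp only: endpoint_moment_def)
    have "\<forall>\<^sub>F N in sequentially. c * exp (t * ip g (H g)) \<le> (Q (t / real (2 * N)) ^^ (2 * N)) (start_weight n) ?z"
      using c(2)[rule_format, OF t] eventually_ge_at_top[of "Suc (nat \<lceil>t * R\<rceil>)"]
    proof eventually_elim
      case (elim N)
      \<comment> \<open>For such \<open>N\<close> the operator \<open>Q\<close> is monotone, and the
        start weight dominates the indicator of \<open>?z\<close>.\<close>
      have "t * R \<le> real N" using elim(2) by linarith
      then have "t / real (2 * N) * R \<le> 1" using elim(2) by (simp add: field_simps)
      then have "(Q (t / real (2 * N)) ^^ (2 * N)) (indicator {?z}) ?z \<le> (Q (t / real (2 * N)) ^^ (2 * N)) (start_weight n) ?z"
        using t0 by (intro Q_pow_mono) (auto simp: indicator_def start_weight_cases)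
      then show ?case using elim(1) by linarith
    qed
    then have "c * exp (t * ip g (H g)) \<le> endpoint_moment x (\<lambda>_. 0) t"
      using lim by (intro tendsto_lowerbound) auto
    moreover have "c * exp (t * (Lam - \<delta>)) \<le> c * exp (t * ip g (H g))"
      using f(3) g(4) c t0 by (intro mult_left_mono) auto
    ultimately show ?thesis using endpoint_moment_le_moment[OF t0, of x "\<lambda>_. 0"] by linarith
  qed
  then show ?thesis using c(1) by (auto simp: pam_Lam_def)
qed

lemma moment_le_exp:
  assumes \<delta>: "0 < \<delta>"
  shows "\<exists>C>0. \<forall>t>0. moment x t \<le> C * exp (t * (pam_Lam TYPE('d) n p \<kappa> \<rho> + \<delta>))"
proof -
  let ?R = "\<Sum>e\<in>(pam_edges n p :: ((nat + nat) \<times> (int ^ 'd)) set). pam_rate \<kappa> \<rho> e"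
  have R: "0 \<le> ?R" using nonneg by (intro sum_nonneg) (simp add: pam_rate_def rates_nonneg)
  \<comment> \<open>Chosen so that \<open>(exp \<epsilon> - 1) * ?R \<le> \<delta>\<close>; the
    added 1 avoids a division by 0 if \<open>?R = 0\<close>.\<close>
  define \<epsilon> where "\<epsilon> = ln (1 + \<delta> / (?R + 1))"
  have q: "0 < \<delta> / (?R + 1)" using \<delta> R by simp
  then have \<epsilon>: "0 < \<epsilon>" by (simp add: \<epsilon>_def)
  have "(exp \<epsilon> - 1) * ?R = \<delta> / (?R + 1) * ?R" using q by (simp add: \<epsilon>_def)
  also have "\<dots> \<le> \<delta>" using \<delta> R by (simp add: field_simps)
  finally have le: "(exp \<epsilon> - 1) * ?R \<le> \<delta>" .
  obtain C where C: "C > 0" "\<And>t. t > 0 \<Longrightarrow> moment x t \<le> C * exp (t * (pam_Lam TYPE('d) n p \<kappa> \<rho> + (exp \<epsilon> - 1) * ?R))"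
    using moment_upper[OF \<epsilon>, of x] by blast
  have "moment x t \<le> C * exp (t * (pam_Lam TYPE('d) n p \<kappa> \<rho> + \<delta>))" if "t > 0" for t
  proof -
    have "C * exp (t * (pam_Lam TYPE('d) n p \<kappa> \<rho> + (exp \<epsilon> - 1) * ?R)) \<le> C * exp (t * (pam_Lam TYPE('d) n p \<kappa> \<rho> + \<delta>))"
      using le C(1) that by (intro mult_left_mono) auto
    then show ?thesis using C(2)[OF that] by linarith
  qed
  then show ?thesis using C(1) by blast
qed

text \<open>Without motion \<open>H\<close> is multiplication by the potential, and
  \<open>(1 + t * v / m) ^ m\<close> tends to \<open>exp (t * v)\<close>. The rate is the potential
  of the initial configuration and depends on \<open>x\<close>, so it cannot be expressed by
  \<open>Lam\<close> in general.\<close>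

lemma moment_at_zero_rates:
  fixes x :: "int ^ 'd"
  assumes "\<kappa> = 0" "\<rho> = 0"
  defines "v \<equiv> interaction n p (case_sum (\<lambda>_. x) (\<lambda>_. 0 :: int ^ 'd))"
  shows "\<exists>C>0. \<forall>t>0. exp (t * v) \<le> moment x t \<and> moment x t \<le> C * exp (t * v)"
proof -
  interpret hopping "pam_edges n p" pam_move pam_inverse "pam_rate \<kappa> \<rho>"
    "interaction n p :: (nat + nat \<Rightarrow> int ^ 'd) \<Rightarrow> real" "real (p * n)"
    by (rule hopping_pam[OF nonneg])
  have r0: "pam_rate \<kappa> \<rho> e = 0" for e :: "(nat + nat) \<times> (int ^ 'd)"
    using assms by (cases "fst e") (auto simp: pam_rate_def)
  have Q_eq: "Q s f a = (1 + s * interaction n p a) * f a" for s f a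
    unfolding Q_def H_def r0 by (simp add: distrib_right)
  have Q_pow: "(Q s ^^ m) f a = (1 + s * interaction n p a) ^ m * f a" for s m f a
  proof (induction m)
    case (Suc m)
    have "(Q s ^^ Suc m) f a = Q s ((Q s ^^ m) f) a" by simp
    also have "\<dots> = (1 + s * interaction n p a) * (Q s ^^ m) f a" by (rule Q_eq)
    also have "\<dots> = (1 + s * interaction n p a) ^ Suc m * f a" by (simp only: Suc power_Suc mult.assoc)
    finally show ?case .
  qed simp
  have em: "endpoint_moment x y t = exp (t * interaction n p (case_sum (\<lambda>_. x) y)) * start_weight n (case_sum (\<lambda>_. x) y)"
    if "0 < t" for y t
  proof (rule LIMSEQ_unique)
    show "(\<lambda>m. (Q (t / real m) ^^ m) (start_weight n) (case_sum (\<lambda>_. x) y)) \<longlonglongrightarrow> endpoint_moment x y t"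
      unfolding endpoint_moment_def by (rule pam_Q_pow_tendsto[OF that])
    have "(\<lambda>m. (1 + (t * interaction n p (case_sum (\<lambda>_. x) y)) / real m) ^ m * start_weight n (case_sum (\<lambda>_. x) y))
      \<longlonglongrightarrow> exp (t * interaction n p (case_sum (\<lambda>_. x) y)) * start_weight n (case_sum (\<lambda>_. x) y)"
      by (intro tendsto_mult tendsto_exp_limit_sequentially tendsto_const)
    then show "(\<lambda>m. (Q (t / real m) ^^ m) (start_weight n) (case_sum (\<lambda>_. x) y))
      \<longlonglongrightarrow> exp (t * interaction n p (case_sum (\<lambda>_. x) y)) * start_weight n (case_sum (\<lambda>_. x) y)"
      by (simp add: Q_pow)
  qed
  have "\<exists>C>0. \<forall>t>0. moment x t \<le> C * exp (t * v)"
  \<comment> \<open>Only the endpoint 0 contributes, where the decay factor is 1; any positive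
    \<epsilon> would do.\<close>
  proof (rule moment_le_of_endpoint_moment_le[where C = 1 and \<epsilon> = 1])
    fix y :: "nat \<Rightarrow> int ^ 'd" and t :: real
    assume t: "0 < t" and y: "\<forall>k. k \<notin> {1..n} \<longrightarrow> y k = 0"
    show "endpoint_moment x y t \<le> 1 * exp (- 1 * real (\<Sum>k=1..n. l1norm (y k))) * exp (t * v)"
    proof (cases "\<forall>k\<in>{1..n}. y k = 0")
      case True
      then have "y = (\<lambda>_. 0)" using y by blast
      then show ?thesis by (simp add: em[OF t] start_weight_cases v_def)
    next
      case False
      then have "start_weight n (case_sum (\<lambda>_. x) y) = 0" by (simp add: start_weight_cases)
      then show ?thesis by (simp add: em[OF t])
    qed
  qed simp_all
  moreover have "exp (t * v) \<le> moment x t" if "0 < t" for t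
    using endpoint_moment_le_moment[OF that, of x "\<lambda>_. 0"] by (simp add: em[OF that] start_weight_cases v_def)
  ultimately show ?thesis by blast
qed

end

section \<open>From exponential bounds to the rate and its regularity\<close>

lemma log_rate_tendsto:
  fixes m :: "real \<Rightarrow> real"
  assumes p: "1 \<le> p"
    and up: "\<And>\<delta>. 0 < \<delta> \<Longrightarrow> \<exists>C>0. \<forall>t>0. m t \<le> C * exp (t * (L + \<delta>))"
    and low: "\<And>\<delta>. 0 < \<delta> \<Longrightarrow> \<exists>c>0. \<forall>t\<ge>10. c * exp (t * (L - \<delta>)) \<le> m t"
  shows "((\<lambda>t. 1 / (real p * t) * ln (m t)) \<longlongrightarrow> L / real p) at_top"
proof -
  have "((\<lambda>t. ln (m t) / t) \<longlongrightarrow> L) at_top"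
  proof (rule tendstoI)
    fix e :: real assume e: "0 < e"
    obtain C where C: "C > 0" "\<And>t. t > 0 \<Longrightarrow> m t \<le> C * exp (t * (L + e / 2))" using up[of "e / 2"] e by auto
    obtain c where c: "c > 0" "\<And>t. t \<ge> 10 \<Longrightarrow> c * exp (t * (L - e / 2)) \<le> m t" using low[of "e / 2"] e by auto
    show "\<forall>\<^sub>F t in at_top. dist (ln (m t) / t) L < e"
      \<comment> \<open>Beyond this time the logarithms of the two constants stay below
        \<open>t * e / 2\<close>; the other half of the tolerance is used up by the slack in the
        exponents.\<close>
      using eventually_ge_at_top[of "max 10 (2 * (\<bar>ln C\<bar> + \<bar>ln c\<bar> + 1) / e)"]
    proof eventually_elim
      case (elim t)
      then have t: "t \<ge> 10" "2 * (\<bar>ln C\<bar> + \<bar>ln c\<bar> + 1) / e \<le> t" by auto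
      have te: "\<bar>ln C\<bar> + \<bar>ln c\<bar> + 1 \<le> t * (e / 2)" using t(2) e by (simp add: field_simps)
      have mpos: "0 < m t" using c(2)[OF t(1)] c(1) by (meson exp_gt_zero less_le_trans mult_pos_pos)
      have "ln (m t) \<le> ln (C * exp (t * (L + e / 2)))" using C t mpos by (intro ln_mono) auto
      also have "\<dots> = ln C + t * (L + e / 2)" using C by (simp add: ln_mult)
      finally have u: "ln (m t) \<le> ln C + t * (L + e / 2)" .
      have "ln c + t * (L - e / 2) = ln (c * exp (t * (L - e / 2)))" using c by (simp add: ln_mult)
      also have "\<dots> \<le> ln (m t)" using c t mpos by (intro ln_mono) auto
      finally have l: "ln c + t * (L - e / 2) \<le> ln (m t)" .
      have "ln (m t) - t * L < t * e" "- (t * e) < ln (m t) - t * L"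
        using u l te by (auto simp: algebra_simps)
      then have "\<bar>ln (m t) - t * L\<bar> < t * e" by (simp add: abs_less_iff)
      moreover have "ln (m t) / t - L = (ln (m t) - t * L) / t" using t by (simp add: field_simps)
      ultimately show ?case using t by (simp add: dist_real_def divide_less_eq abs_divide mult.commute)
    qed
  qed
  then have "((\<lambda>t. ln (m t) / t / real p) \<longlongrightarrow> L / real p) at_top" by (intro tendsto_divide) (use p in auto)
  then show ?thesis by (simp add: mult.commute)
qed

text \<open>\<open>T\<close> collects, for every normalised test function, its two kinetic energies and its potential energy.\<close>

lemma Sup_affine_properties:
  fixes T :: "(real \<times> real \<times> real) set"
  assumes ne: "T \<noteq> {}" and T: "\<And>\<alpha> \<beta> \<gamma>. (\<alpha>, \<beta>, \<gamma>) \<in> T \<Longrightarrow> - c \<le> \<alpha> \<and> \<alpha> \<le> 0 \<and> - c \<le> \<beta> \<and> \<beta> \<le> 0 \<and> \<gamma> \<le> d"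
  defines "L \<equiv> \<lambda>\<kappa> \<rho>. SUP (\<alpha>, \<beta>, \<gamma>)\<in>T. \<kappa> * \<alpha> + \<rho> * \<beta> + \<gamma>"
  shows "continuous_on ({0..} \<times> {0..}) (\<lambda>(\<kappa>, \<rho>). L \<kappa> \<rho>)"
    and "convex_on ({0..} \<times> {0..}) (\<lambda>(\<kappa>, \<rho>). L \<kappa> \<rho>)"
    and "0 \<le> \<rho> \<Longrightarrow> antimono_on {0..} (\<lambda>\<kappa>. L \<kappa> \<rho>)"
    and "0 \<le> \<kappa> \<Longrightarrow> antimono_on {0..} (\<lambda>\<rho>. L \<kappa> \<rho>)"
proof -
  have upper: "\<kappa> * \<alpha> + \<rho> * \<beta> + \<gamma> \<le> L \<kappa> \<rho>" if "(\<alpha>, \<beta>, \<gamma>) \<in> T" "0 \<le> \<kappa>" "0 \<le> \<rho>" for \<alpha> \<beta> \<gamma> \<kappa> \<rho>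
  proof -
    have "bdd_above ((\<lambda>(\<alpha>, \<beta>, \<gamma>). \<kappa> * \<alpha> + \<rho> * \<beta> + \<gamma>) ` T)"
    proof (rule bdd_aboveI[of _ d])
      fix z assume "z \<in> (\<lambda>(\<alpha>, \<beta>, \<gamma>). \<kappa> * \<alpha> + \<rho> * \<beta> + \<gamma>) ` T"
      then obtain \<alpha> \<beta> \<gamma> where z: "(\<alpha>, \<beta>, \<gamma>) \<in> T" "z = \<kappa> * \<alpha> + \<rho> * \<beta> + \<gamma>" by auto
      have "\<kappa> * \<alpha> \<le> 0" "\<rho> * \<beta> \<le> 0" using T[OF z(1)] that by (auto intro: mult_nonneg_nonpos)
      then show "z \<le> d" using T[OF z(1)] z(2) by linarith
    qed
    then show ?thesis unfolding L_def using that by (intro cSup_upper) force+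
  qed
  have least: "L \<kappa> \<rho> \<le> b" if "\<And>\<alpha> \<beta> \<gamma>. (\<alpha>, \<beta>, \<gamma>) \<in> T \<Longrightarrow> \<kappa> * \<alpha> + \<rho> * \<beta> + \<gamma> \<le> b" for \<kappa> \<rho> b
    unfolding L_def using ne that by (intro cSUP_least) auto
  have c: "0 \<le> c" using ne T by force
  \<comment> \<open>All slopes lie between \<open>- c\<close> and 0, so a change of the rates
    changes each affine function, and therefore the supremum, by at most \<open>c\<close> times the
    change.\<close>
  have lip: "L \<kappa> \<rho> \<le> L \<kappa>' \<rho>' + c * \<bar>\<kappa> - \<kappa>'\<bar> + c * \<bar>\<rho> - \<rho>'\<bar>" if "0 \<le> \<kappa>'" "0 \<le> \<rho>'" for \<kappa> \<rho> \<kappa>' \<rho>'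
  proof (rule least)
    fix \<alpha> \<beta> \<gamma> assume i: "(\<alpha>, \<beta>, \<gamma>) \<in> T"
    have le: "u * v \<le> \<bar>u\<bar> * c" if "- c \<le> v" "v \<le> 0" for u v :: real
    proof -
      have "u * v \<le> \<bar>u\<bar> * \<bar>v\<bar>" by (metis abs_ge_self abs_mult)
      also have "\<dots> \<le> \<bar>u\<bar> * c" using that by (intro mult_left_mono) auto
      finally show ?thesis .
    qed
    have "(\<kappa> - \<kappa>') * \<alpha> \<le> \<bar>\<kappa> - \<kappa>'\<bar> * c" "(\<rho> - \<rho>') * \<beta> \<le> \<bar>\<rho> - \<rho>'\<bar> * c"
      using T[OF i] by (auto intro: le)
    then show "\<kappa> * \<alpha> + \<rho> * \<beta> + \<gamma> \<le> L \<kappa>' \<rho>' + c * \<bar>\<kappa> - \<kappa>'\<bar> + c * \<bar>\<rho> - \<rho>'\<bar>"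
      using upper[OF i that] by (simp add: algebra_simps)
  qed
  show "continuous_on ({0..} \<times> {0..}) (\<lambda>(\<kappa>, \<rho>). L \<kappa> \<rho>)"
    unfolding continuous_on_def
  proof (intro ballI)
    fix z :: "real \<times> real" assume z: "z \<in> {0..} \<times> {0..}"
    obtain \<kappa> \<rho> where zz: "z = (\<kappa>, \<rho>)" by (cases z)
    let ?F = "at z within {0..} \<times> {0..}"
    have tz: "((\<lambda>w. c * \<bar>fst w - \<kappa>\<bar> + c * \<bar>snd w - \<rho>\<bar>) \<longlongrightarrow> c * \<bar>fst z - \<kappa>\<bar> + c * \<bar>snd z - \<rho>\<bar>) ?F"
      by (intro tendsto_intros)
    have "((\<lambda>w. (case w of (\<kappa>, \<rho>) \<Rightarrow> L \<kappa> \<rho>) - L \<kappa> \<rho>) \<longlongrightarrow> 0) ?F"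
    proof (rule Lim_null_comparison)
      show "\<forall>\<^sub>F w in ?F. norm ((case w of (\<kappa>, \<rho>) \<Rightarrow> L \<kappa> \<rho>) - L \<kappa> \<rho>) \<le> c * \<bar>fst w - \<kappa>\<bar> + c * \<bar>snd w - \<rho>\<bar>"
        unfolding eventually_at_filter
      proof (intro always_eventually allI impI)
        fix w :: "real \<times> real" assume w: "w \<in> {0..} \<times> {0..}"
        obtain \<kappa>' \<rho>' where ww: "w = (\<kappa>', \<rho>')" by (cases w)
        show "norm ((case w of (\<kappa>, \<rho>) \<Rightarrow> L \<kappa> \<rho>) - L \<kappa> \<rho>) \<le> c * \<bar>fst w - \<kappa>\<bar> + c * \<bar>snd w - \<rho>\<bar>"
          using lip[of \<kappa> \<rho> \<kappa>' \<rho>'] lip[of \<kappa>' \<rho>' \<kappa> \<rho>] w z zz ww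
          by (simp add: abs_le_iff abs_minus_commute)
      qed
      show "((\<lambda>w. c * \<bar>fst w - \<kappa>\<bar> + c * \<bar>snd w - \<rho>\<bar>) \<longlongrightarrow> 0) ?F" using tz zz by simp
    qed
    then show "((\<lambda>(\<kappa>, \<rho>). L \<kappa> \<rho>) \<longlongrightarrow> (case z of (\<kappa>, \<rho>) \<Rightarrow> L \<kappa> \<rho>)) ?F"
      unfolding zz by (simp add: LIM_zero_iff)
  qed
  show "convex_on ({0..} \<times> {0..}) (\<lambda>(\<kappa>, \<rho>). L \<kappa> \<rho>)"
  proof (rule convex_onI)
    fix t :: real and z w :: "real \<times> real"
    assume t: "0 < t" "t < 1" and zw: "z \<in> {0..} \<times> {0..}" "w \<in> {0..} \<times> {0..}"
    obtain \<kappa> \<rho> where z: "z = (\<kappa>, \<rho>)" by (cases z)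
    obtain \<kappa>' \<rho>' where w: "w = (\<kappa>', \<rho>')" by (cases w)
    have "L ((1 - t) * \<kappa> + t * \<kappa>') ((1 - t) * \<rho> + t * \<rho>') \<le> (1 - t) * L \<kappa> \<rho> + t * L \<kappa>' \<rho>'"
    proof (rule least)
      fix \<alpha> \<beta> \<gamma> assume i: "(\<alpha>, \<beta>, \<gamma>) \<in> T"
      have "(1 - t) * (\<kappa> * \<alpha> + \<rho> * \<beta> + \<gamma>) + t * (\<kappa>' * \<alpha> + \<rho>' * \<beta> + \<gamma>) \<le> (1 - t) * L \<kappa> \<rho> + t * L \<kappa>' \<rho>'"
        using t zw z w by (intro add_mono mult_left_mono upper[OF i]) auto
      then show "((1 - t) * \<kappa> + t * \<kappa>') * \<alpha> + ((1 - t) * \<rho> + t * \<rho>') * \<beta> + \<gamma> \<le> (1 - t) * L \<kappa> \<rho> + t * L \<kappa>' \<rho>'"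
        by (simp add: algebra_simps)
    qed
    then show "(case (1 - t) *\<^sub>R z + t *\<^sub>R w of (\<kappa>, \<rho>) \<Rightarrow> L \<kappa> \<rho>)
      \<le> (1 - t) * (case z of (\<kappa>, \<rho>) \<Rightarrow> L \<kappa> \<rho>) + t * (case w of (\<kappa>, \<rho>) \<Rightarrow> L \<kappa> \<rho>)"
      by (simp add: z w)
  qed (intro convex_Times convex_real_interval)
  have mono: "L \<kappa>' \<rho>' \<le> L \<kappa> \<rho>" if "0 \<le> \<kappa>" "\<kappa> \<le> \<kappa>'" "0 \<le> \<rho>" "\<rho> \<le> \<rho>'" for \<kappa> \<rho> \<kappa>' \<rho>'
  proof (rule least)
    fix \<alpha> \<beta> \<gamma> assume i: "(\<alpha>, \<beta>, \<gamma>) \<in> T"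
    have "\<kappa>' * \<alpha> \<le> \<kappa> * \<alpha>" "\<rho>' * \<beta> \<le> \<rho> * \<beta>" using T[OF i] that by (auto intro: mult_right_mono_neg)
    then show "\<kappa>' * \<alpha> + \<rho>' * \<beta> + \<gamma> \<le> L \<kappa> \<rho>" using upper[OF i that(1,3)] by linarith
  qed
  show "antimono_on {0..} (\<lambda>\<kappa>. L \<kappa> \<rho>)" if "0 \<le> \<rho>" using mono that by (auto intro!: monotone_onI)
  show "antimono_on {0..} (\<lambda>\<rho>. L \<kappa> \<rho>)" if "0 \<le> \<kappa>" using mono that by (auto intro!: monotone_onI)
qed

section \<open>The Lyapunov exponents as a supremum of affine functions\<close>

lemma interaction_zero: "interaction n p (\<lambda>_. 0) = real (p * n)"
  by (simp add: interaction_def)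

text \<open>All particles on one site realise the maximal potential. Hence \<open>Lam\<close> at
  zero rates matches the growth rate for \<open>x = 0\<close>, and continuity up to the corner of
  the quadrant follows from that of \<open>Lam\<close>.\<close>

lemma pam_Lam_zero_rates: "pam_Lam TYPE('d::finite) n p 0 0 = real (p * n)"
proof -
  interpret hopping "pam_edges n p" pam_move pam_inverse "pam_rate 0 0"
    "interaction n p :: (nat + nat \<Rightarrow> int ^ 'd) \<Rightarrow> real" "real (p * n)"
    by (rule hopping_pam) auto
  let ?f = "indicator {\<lambda>_. 0} :: (nat + nat \<Rightarrow> int ^ 'd) \<Rightarrow> real"
  have f: "finsupp ?f" by (simp add: indicator_def)
  have r0: "pam_rate 0 0 e = 0" for e :: "(nat + nat) \<times> (int ^ 'd)"
    by (cases "fst e") (auto simp: pam_rate_def)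
  have supp: "ip ?f g = g (\<lambda>_. 0)" for g
    by (subst ip_eq_sum[of "{\<lambda>_. 0}"]) (auto simp: indicator_def)
  have "ip ?f (H ?f) = real (p * n)" "ip ?f ?f = 1"
    unfolding supp H_def r0 by (simp_all add: interaction_zero)
  then have "real (p * n) \<in> {ip f (H f) |f. finsupp f \<and> ip f f = 1}"
    using f by (intro CollectI exI[of _ ?f]) simp
  moreover have "z \<le> real (p * n)" if "z \<in> {ip f (H f) |f. finsupp f \<and> ip f f = 1}" for z
    using that ip_H_le by force
  ultimately have "Lam = real (p * n)" unfolding Lam_def by (rule cSup_eq_maximum)
  then show ?thesis by (simp add: pam_Lam_def)
qed

text \<open>The entries are the quadratic forms of the Laplacians of all walks, of all catalysts,
  and of the potential. They do not involve the rates, which makes \<open>ip f (H f)\<close> affine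
  in the rates for fixed \<open>f\<close>.\<close>

definition energies :: "nat \<Rightarrow> nat \<Rightarrow> ((nat + nat \<Rightarrow> int ^ 'd) \<Rightarrow> real) \<Rightarrow> real \<times> real \<times> real"
  where "energies n p f =
    (\<Sum>j=1..p. \<Sum>v\<in>unit_steps. ip f (\<lambda>a. f (pam_move (Inl j, v) a)) - ip f f,
     \<Sum>k=1..n. \<Sum>v\<in>unit_steps. ip f (\<lambda>a. f (pam_move (Inr k, v) a)) - ip f f,
     ip f (\<lambda>a. interaction n p a * f a))"

lemma pam_Lam_eq_SUP:
  assumes "0 \<le> \<kappa>" "0 \<le> \<rho>"
  shows "pam_Lam TYPE('d::finite) n p \<kappa> \<rho> =
    (SUP (\<alpha>, \<beta>, \<gamma>)\<in>energies n p ` {f :: (nat + nat \<Rightarrow> int ^ 'd) \<Rightarrow> real. finsupp f \<and> ip f f = 1}. \<kappa> * \<alpha> + \<rho> * \<beta> + \<gamma>)"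
proof -
  interpret hopping "pam_edges n p" pam_move pam_inverse "pam_rate \<kappa> \<rho>"
    "interaction n p :: (nat + nat \<Rightarrow> int ^ 'd) \<Rightarrow> real" "real (p * n)"
    by (rule hopping_pam[OF assms])
  have eq: "(case energies n p f of (\<alpha>, \<beta>, \<gamma>) \<Rightarrow> \<kappa> * \<alpha> + \<rho> * \<beta> + \<gamma>) = ip f (H f)"
    if "finsupp f" for f
  proof -
    have "(\<Sum>e\<in>pam_edges n p. pam_rate \<kappa> \<rho> e * (ip f (\<lambda>a. f (pam_move e a)) - ip f f))
      = (\<Sum>i\<in>{1..p} <+> {1..n}. \<Sum>v\<in>unit_steps. rates \<kappa> \<rho> i * (ip f (\<lambda>a. f (pam_move (i, v) a)) - ip f f))"
      unfolding pam_edges_def sum.cartesian_product by (rule sum.cong) (auto simp: pam_rate_def)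
    also have "\<dots> = \<kappa> * (\<Sum>j=1..p. \<Sum>v\<in>unit_steps. ip f (\<lambda>a. f (pam_move (Inl j, v) a)) - ip f f)
        + \<rho> * (\<Sum>k=1..n. \<Sum>v\<in>unit_steps. ip f (\<lambda>a. f (pam_move (Inr k, v) a)) - ip f f)"
      by (simp add: sum.Plus sum_distrib_left del: sum_subtractf sum_constant)
    finally show ?thesis by (simp add: energies_def ip_H[OF that])
  qed
  have "{ip f (H f) |f. finsupp f \<and> ip f f = 1} = (\<lambda>f. ip f (H f)) ` {f. finsupp f \<and> ip f f = 1}"
    by auto
  also have "\<dots> = (\<lambda>(\<alpha>, \<beta>, \<gamma>). \<kappa> * \<alpha> + \<rho> * \<beta> + \<gamma>) ` energies n p ` {f :: (nat + nat \<Rightarrow> int ^ 'd) \<Rightarrow> real. finsupp f \<and> ip f f = 1}"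
    unfolding image_image by (rule image_cong[OF refl]) (simp only: eq mem_Collect_eq)
  finally have "{ip f (H f) |f. finsupp f \<and> ip f f = 1}
    = (\<lambda>(\<alpha>, \<beta>, \<gamma>). \<kappa> * \<alpha> + \<rho> * \<beta> + \<gamma>) ` energies n p ` {f :: (nat + nat \<Rightarrow> int ^ 'd) \<Rightarrow> real. finsupp f \<and> ip f f = 1}" .
  then show ?thesis by (simp add: pam_Lam_def Lam_def)
qed

text \<open>By Cauchy-Schwarz each kinetic summand lies between -2 and 0. There are at most
  \<open>p + n\<close> particles of either kind, so one constant \<open>c\<close> serves both
  slopes.\<close>

lemma energies_bounds:
  fixes f :: "(nat + nat \<Rightarrow> int ^ 'd) \<Rightarrow> real"
  assumes f: "finsupp f" "ip f f = 1" and e: "energies n p f = (\<alpha>, \<beta>, \<gamma>)"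
  defines "c \<equiv> real (p + n) * (2 * card (unit_steps :: (int ^ 'd) set))"
  shows "- c \<le> \<alpha> \<and> \<alpha> \<le> 0 \<and> - c \<le> \<beta> \<and> \<beta> \<le> 0 \<and> \<gamma> \<le> real (p * n)"
proof -
  \<comment> \<open>Zero rates reduce \<open>H\<close> to the potential, so the general bound on
    \<open>ip f (H f)\<close> becomes the bound on \<gamma>; the estimate for shifted functions is
    the same for all rates.\<close>
  interpret hopping "pam_edges n p" pam_move pam_inverse "pam_rate 0 0"
    "interaction n p :: (nat + nat \<Rightarrow> int ^ 'd) \<Rightarrow> real" "real (p * n)"
    by (rule hopping_pam) auto
  let ?S = "unit_steps :: (int ^ 'd) set"
  define k where "k i v = ip f (\<lambda>a. f (pam_move (i, v) a)) - ip f f" for i and v :: "int ^ 'd"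
  have k: "- 2 \<le> k i v" "k i v \<le> 0" for i v
    using ip_mv_le[OF f(1), of "(i, v)"] f(2) by (auto simp: k_def abs_le_iff)
  have inner: "- (2 * real (card ?S)) \<le> (\<Sum>v\<in>?S. k i v)" "(\<Sum>v\<in>?S. k i v) \<le> 0" for i
    using sum_bounded_below[of ?S "- 2" "k i"] k by (auto intro: sum_nonpos simp: mult.commute)
  have outer: "- c \<le> (\<Sum>j=1..m. \<Sum>v\<in>?S. k (g j) v)" "(\<Sum>j=1..m. \<Sum>v\<in>?S. k (g j) v) \<le> 0" if "m \<le> p + n" for m and g :: "nat \<Rightarrow> nat + nat"
  proof -
    have "- c \<le> real m * - (2 * real (card ?S))"
      using that mult_right_mono[of "real m" "real (p + n)" "2 * real (card ?S)"] by (simp add: c_def)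
    also have "\<dots> \<le> (\<Sum>j=1..m. \<Sum>v\<in>?S. k (g j) v)"
      using sum_bounded_below[of "{1..m}" "- (2 * real (card ?S))" "\<lambda>j. \<Sum>v\<in>?S. k (g j) v"] inner by simp
    finally show "- c \<le> (\<Sum>j=1..m. \<Sum>v\<in>?S. k (g j) v)" .
    show "(\<Sum>j=1..m. \<Sum>v\<in>?S. k (g j) v) \<le> 0" by (intro sum_nonpos inner)
  qed
  have "ip f (\<lambda>a. interaction n p a * f a) \<le> real (p * n)"
  proof -
    have "H f = (\<lambda>a. interaction n p a * f a)"
    proof
      fix a
      have "pam_rate 0 0 e = 0" for e :: "(nat + nat) \<times> (int ^ 'd)" by (cases "fst e") (auto simp: pam_rate_def)
      then show "H f a = interaction n p a * f a" by (simp add: H_def)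
    qed
    then show ?thesis using ip_H_le[OF f(1)] f(2) by simp
  qed
  moreover have "\<alpha> = (\<Sum>j=1..p. \<Sum>v\<in>?S. k (Inl j) v)" "\<beta> = (\<Sum>j=1..n. \<Sum>v\<in>?S. k (Inr j) v)" "\<gamma> = ip f (\<lambda>a. interaction n p a * f a)"
    using e by (auto simp: energies_def k_def)
  ultimately show ?thesis using outer[of p Inl] outer[of n Inr] by simp
qed

lemma pam_Lam_properties:
  fixes n p :: nat
  defines "L \<equiv> pam_Lam TYPE('d::finite) n p"
  shows "continuous_on ({0..} \<times> {0..}) (\<lambda>(\<kappa>, \<rho>). L \<kappa> \<rho>)"
    and "convex_on ({0..} \<times> {0..}) (\<lambda>(\<kappa>, \<rho>). L \<kappa> \<rho>)"
    and "0 \<le> \<rho> \<Longrightarrow> antimono_on {0..} (\<lambda>\<kappa>. L \<kappa> \<rho>)"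
    and "0 \<le> \<kappa> \<Longrightarrow> antimono_on {0..} (\<lambda>\<rho>. L \<kappa> \<rho>)"
proof -
  let ?F = "{f :: (nat + nat \<Rightarrow> int ^ 'd) \<Rightarrow> real. finsupp f \<and> ip f f = 1}"
  let ?T = "energies n p ` ?F"
  define L' where "L' \<kappa> \<rho> = (SUP (\<alpha>, \<beta>, \<gamma>)\<in>?T. \<kappa> * \<alpha> + \<rho> * \<beta> + \<gamma>)" for \<kappa> \<rho>
  have "ip (indicator {\<lambda>_. 0} :: (nat + nat \<Rightarrow> int ^ 'd) \<Rightarrow> real) (indicator {\<lambda>_. 0}) = 1"
    by (subst ip_eq_sum[of "{\<lambda>_. 0}"]) (auto simp: indicator_def)
  then have "(indicator {\<lambda>_. 0} :: (nat + nat \<Rightarrow> int ^ 'd) \<Rightarrow> real) \<in> ?F" by (simp add: indicator_def)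
  then have ne: "?T \<noteq> {}" by blast
  define c where "c = real (p + n) * (2 * card (unit_steps :: (int ^ 'd) set))"
  have bounds: "- c \<le> \<alpha> \<and> \<alpha> \<le> 0 \<and> - c \<le> \<beta> \<and> \<beta> \<le> 0 \<and> \<gamma> \<le> real (p * n)"
    if "(\<alpha>, \<beta>, \<gamma>) \<in> ?T" for \<alpha> \<beta> \<gamma>
  proof -
    from that obtain f :: "(nat + nat \<Rightarrow> int ^ 'd) \<Rightarrow> real" where f: "finsupp f" "ip f f = 1" "(\<alpha>, \<beta>, \<gamma>) = energies n p f"
      by blast
    show ?thesis using energies_bounds[OF f(1,2) f(3)[symmetric]] unfolding c_def .
  qed
  note props = Sup_affine_properties[OF ne bounds, folded L'_def]
  \<comment> \<open>The supremum formula holds on the quadrant, and the four properties concern the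
    quadrant only.\<close>
  have eq: "L \<kappa> \<rho> = L' \<kappa> \<rho>" if "0 \<le> \<kappa>" "0 \<le> \<rho>" for \<kappa> \<rho>
    using that by (simp add: L_def L'_def pam_Lam_eq_SUP)
  show "continuous_on ({0..} \<times> {0..}) (\<lambda>(\<kappa>, \<rho>). L \<kappa> \<rho>)"
    by (rule continuous_on_cong[THEN iffD1, OF refl _ props(1)]) (auto simp: eq)
  have "convex ({0..} \<times> {0..} :: (real \<times> real) set)" by (intro convex_Times convex_real_interval)
  then show "convex_on ({0..} \<times> {0..}) (\<lambda>(\<kappa>, \<rho>). L \<kappa> \<rho>)"
  proof (intro convex_onI)
    fix t :: real and z w :: "real \<times> real"
    assume t: "0 < t" "t < 1" and zw: "z \<in> {0..} \<times> {0..}" "w \<in> {0..} \<times> {0..}"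
    then have "(1 - t) *\<^sub>R z + t *\<^sub>R w \<in> {0..} \<times> {0..}" by (auto intro!: add_nonneg_nonneg)
    then show "(case (1 - t) *\<^sub>R z + t *\<^sub>R w of (\<kappa>, \<rho>) \<Rightarrow> L \<kappa> \<rho>)
      \<le> (1 - t) * (case z of (\<kappa>, \<rho>) \<Rightarrow> L \<kappa> \<rho>) + t * (case w of (\<kappa>, \<rho>) \<Rightarrow> L \<kappa> \<rho>)"
      using convex_onD[OF props(2), of t z w] t zw by (auto simp: eq)
  qed
  show "antimono_on {0..} (\<lambda>\<kappa>. L \<kappa> \<rho>)" if "0 \<le> \<rho>"
  proof -
    have "antimono_on {0..} (\<lambda>\<kappa>. L' \<kappa> \<rho>)" by (rule props(3)[OF _ that])
    then show ?thesis using that by (simp add: monotone_on_def eq)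
  qed
  show "antimono_on {0..} (\<lambda>\<rho>. L \<kappa> \<rho>)" if "0 \<le> \<kappa>"
  proof -
    have "antimono_on {0..} (\<lambda>\<rho>. L' \<kappa> \<rho>)" by (rule props(4)[OF _ that])
    then show ?thesis using that by (simp add: monotone_on_def eq)
  qed
qed

theorem theorem1p1:
  fixes n p :: nat
    and M :: "real \<Rightarrow> 'a measure"
    and Y :: "real \<Rightarrow> nat \<Rightarrow> real \<Rightarrow> 'a \<Rightarrow> int ^ 'd"
    and P :: "real \<Rightarrow> int ^ 'd \<Rightarrow> 'b measure"
    and X :: "real \<Rightarrow> real \<Rightarrow> 'b \<Rightarrow> int ^ 'd"
  assumes "n \<ge> 1" and "p \<ge> 1"
    and "\<And>\<rho>. \<rho> \<ge> 0 \<Longrightarrow> independent_srws (M \<rho>) n \<rho> 0 (Y \<rho>)"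
    and "\<And>\<kappa> x. \<kappa> \<ge> 0 \<Longrightarrow> simple_random_walk (P \<kappa> x) \<kappa> x (X \<kappa>)"
  shows "\<exists>lyap :: real \<Rightarrow> real \<Rightarrow> int ^ 'd \<Rightarrow> real.
    (\<forall>\<kappa>\<ge>0. \<forall>\<rho>\<ge>0. \<forall>x.
      (log_moment_rate n p (M \<rho>) (Y \<rho>) (P \<kappa>) (X \<kappa>) x \<longlongrightarrow> lyap \<kappa> \<rho> x) at_top) \<and>
    (\<forall>\<kappa>\<ge>0. \<forall>\<rho>\<ge>0. (\<kappa>, \<rho>) \<noteq> (0, 0) \<longrightarrow> (\<forall>x y. lyap \<kappa> \<rho> x = lyap \<kappa> \<rho> y)) \<and>
    continuous_on ({0..} \<times> {0..}) (\<lambda>(\<kappa>, \<rho>). lyap \<kappa> \<rho> 0) \<and>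
    convex_on ({0..} \<times> {0..}) (\<lambda>(\<kappa>, \<rho>). lyap \<kappa> \<rho> 0) \<and>
    (\<forall>\<rho>\<ge>0. antimono_on {0..} (\<lambda>\<kappa>. lyap \<kappa> \<rho> 0)) \<and>
    (\<forall>\<kappa>\<ge>0. antimono_on {0..} (\<lambda>\<rho>. lyap \<kappa> \<rho> 0))"
proof -
  define L where "L = pam_Lam TYPE('d) n p"
  define V where "V x = interaction n p (case_sum (\<lambda>_. x) (\<lambda>_. 0 :: int ^ 'd))" for x
  \<comment> \<open>Only at the origin does the limit depend on \<open>x\<close>; there it is
    determined by the potential with all walks at \<open>x\<close> and all catalysts at 0.\<close>
  define lyap where "lyap \<kappa> \<rho> x = (if (\<kappa>, \<rho>) = (0, 0) then V x else L \<kappa> \<rho>) / real p" for \<kappa> \<rho> x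
  \<comment> \<open>Positivity of the catalyst kernel for all starting points is taken from the
    walks \<open>X \<rho>\<close>, as the catalysts start at 0.\<close>
  have pam: "parabolic_anderson n \<kappa> \<rho> (M \<rho>) (Y \<rho>) (P \<kappa>) (X \<kappa>)" if "0 \<le> \<kappa>" "0 \<le> \<rho>" for \<kappa> \<rho>
    by unfold_locales (use that assms srw_transition_nonneg[OF assms(4)] in auto)
  have lim: "(log_moment_rate n p (M \<rho>) (Y \<rho>) (P \<kappa>) (X \<kappa>) x \<longlongrightarrow> lyap \<kappa> \<rho> x) at_top"
    if nonneg: "0 \<le> \<kappa>" "0 \<le> \<rho>" for \<kappa> \<rho> x
  proof -
    interpret parabolic_anderson n p \<kappa> \<rho> "M \<rho>" "Y \<rho>" "P \<kappa>" "X \<kappa>" by (rule pam[OF nonneg])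
    have rate: "log_moment_rate n p (M \<rho>) (Y \<rho>) (P \<kappa>) (X \<kappa>) x = (\<lambda>t. 1 / (real p * t) * ln (moment x t))"
      by (auto simp: log_moment_rate_def moment_def)
    show ?thesis
    proof (cases "(\<kappa>, \<rho>) = (0, 0)")
      case True
      obtain C where C: "C > 0" "\<And>t. 0 < t \<Longrightarrow> exp (t * V x) \<le> moment x t \<and> moment x t \<le> C * exp (t * V x)"
        using moment_at_zero_rates[of x] True unfolding V_def by auto
      have "((\<lambda>t. 1 / (real p * t) * ln (moment x t)) \<longlongrightarrow> V x / real p) at_top"
      proof (rule log_rate_tendsto[OF assms(2)])
        fix \<delta> :: real assume \<delta>: "0 < \<delta>"
        have "moment x t \<le> C * exp (t * (V x + \<delta>))" if "0 < t" for t
        proof -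
          have "C * exp (t * V x) \<le> C * exp (t * (V x + \<delta>))" using C \<delta> that by (intro mult_left_mono) auto
          then show ?thesis using C(2)[OF that] by linarith
        qed
        then show "\<exists>C>0. \<forall>t>0. moment x t \<le> C * exp (t * (V x + \<delta>))" using C(1) by blast
        have "1 * exp (t * (V x - \<delta>)) \<le> moment x t" if "10 \<le> t" for t
        proof -
          have "exp (t * (V x - \<delta>)) \<le> exp (t * V x)" using \<delta> that by simp
          then show ?thesis using C(2)[of t] that by linarith
        qed
        then show "\<exists>c>0. \<forall>t\<ge>10. c * exp (t * (V x - \<delta>)) \<le> moment x t" by (intro exI[of _ 1]) auto
      qed
      then show ?thesis using True unfolding rate lyap_def by simp
    next
      case False
      have "((\<lambda>t. 1 / (real p * t) * ln (moment x t)) \<longlongrightarrow> L \<kappa> \<rho> / real p) at_top"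
        unfolding L_def by (intro log_rate_tendsto assms(2) moment_le_exp moment_ge_exp False)
      then show ?thesis using False unfolding rate lyap_def by auto
    qed
  qed
  have V0: "V 0 = real (p * n)"
  proof -
    have "case_sum (\<lambda>_. 0) (\<lambda>_. 0 :: int ^ 'd) = (\<lambda>_ :: nat + nat. 0)" by (auto simp: fun_eq_iff split: sum.split)
    then show ?thesis by (simp add: V_def interaction_zero)
  qed
  \<comment> \<open>At \<open>x = 0\<close> the two branches of \<open>lyap\<close> are given by the
    same function \<open>Lam\<close>, because both equal \<open>p * n\<close> before division at
    zero rates.\<close>
  then have lyap0: "lyap \<kappa> \<rho> 0 = 1 / real p * L \<kappa> \<rho>" for \<kappa> \<rho>
    by (simp add: lyap_def L_def pam_Lam_zero_rates)
  then have lyap0_fun: "(\<lambda>(\<kappa>, \<rho>). lyap \<kappa> \<rho> 0) = (\<lambda>z. 1 / real p * (case z of (\<kappa>, \<rho>) \<Rightarrow> L \<kappa> \<rho>))"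
    by auto
  note props = pam_Lam_properties[where 'd = 'd and n = n and p = p, folded L_def]
  show ?thesis
  proof (intro exI[of _ lyap] conjI allI impI)
    show "(log_moment_rate n p (M \<rho>) (Y \<rho>) (P \<kappa>) (X \<kappa>) x \<longlongrightarrow> lyap \<kappa> \<rho> x) at_top"
      if "0 \<le> \<kappa>" "0 \<le> \<rho>" for \<kappa> \<rho> x by (rule lim[OF that])
    show "lyap \<kappa> \<rho> x = lyap \<kappa> \<rho> y" if "(\<kappa>, \<rho>) \<noteq> (0, 0)" for \<kappa> \<rho> x y
      using that by (auto simp: lyap_def)
    show "continuous_on ({0..} \<times> {0..}) (\<lambda>(\<kappa>, \<rho>). lyap \<kappa> \<rho> 0)"
      unfolding lyap0_fun by (rule continuous_on_mult_left[OF props(1)])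
    show "convex_on ({0..} \<times> {0..}) (\<lambda>(\<kappa>, \<rho>). lyap \<kappa> \<rho> 0)"
      unfolding lyap0_fun by (rule convex_on_cmul[OF _ props(2)]) simp
    show "antimono_on {0..} (\<lambda>\<kappa>. lyap \<kappa> \<rho> 0)" if "0 \<le> \<rho>" for \<rho>
      using props(3)[OF that] by (auto simp: monotone_on_def lyap0 intro: divide_right_mono)
    show "antimono_on {0..} (\<lambda>\<rho>. lyap \<kappa> \<rho> 0)" if "0 \<le> \<kappa>" for \<kappa>
      using props(4)[OF that] by (auto simp: monotone_on_def lyap0 intro: divide_right_mono)
  qed
qed

end
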